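(* Let $b=b_1\otimes b_2$ and $b'=b_1'\otimes b_2'$ be pseudo-accretive functions in $L^\infty(\mathbb{R}^n\times\mathbb{R}^m)$, let $\mathcal{D}^n,\mathcal{D}^m$ be dyadic grids on $\mathbb{R}^n,\mathbb{R}^m$, and let $a\in BMO(\mathbb{R}^n\times\mathbb{R}^m)$. Then the mixed paraproduct $$\tilde\pi_a^{b',b}(f)=\sum_{K\in\mathcal{D}^n,\,V\in\mathcal{D}^m}E_K^{b_1'*}\left((E_V^{b_2'}f)\,M_b\Delta_K^{b_1}\Delta_V^{b_2}a\right)$$ is bounded on $L^2(\mathbb{R}^n\times\mathbb{R}^m)$, and $$\|\tilde\pi_a^{b',b}(f)\|_{L^2(\mathbb{R}^n\times\mathbb{R}^m)}\le C\|a\|_{BMO(\mathbb{R}^n\times\mathbb{R}^m)}\|f\|_{L^2(\mathbb{R}^n\times\mathbb{R}^m)}\quad\text{for all } f\in L^2(\mathbb{R}^n\times\mathbb{R}^m),$$ where $C$ depends only on $n,m$ and the $L^\infty$ and pseudo-accretivity constants of $b,b'$.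
   Context: A function $b\in L^\infty(\mathbb{R}^n\times\mathbb{R}^m)$ is pseudo-accretive if there is $C>0$ with $\frac1{|R|}|\int_Rb|>C$ for every rectangle $R=K\times V$ ($K\subset\mathbb{R}^n$, $V\subset\mathbb{R}^m$ cubes with sides parallel to the axes). For $b=b_1\otimes b_2$, i.e. $b(x_1,x_2)=b_1(x_1)b_2(x_2)$, both factors are bounded and pseudo-accretive on cubes. A dyadic grid $\mathcal{D}^n$ is a shift $\{I+\sum_{i:2^{-i}<\ell(I)}2^{-i}\omega_i:I\in\mathcal{D}_0^n\}$ of the standard dyadic grid $\mathcal{D}_0^n$, $\omega_i\in\{0,1\}^n$, $i\in\mathbb{Z}$; $\mathcal{D}^n_p$ is the set of its cubes of side $2^{-p}$. Acting in the first variable, $E_p^{b_1}f=\sum_{I\in\mathcal{D}^n_p}\frac{\int_Ifb_1\,dx_1}{\int_Ib_1}\chi_I$, $E_I^{b_1}=\chi_IE_p^{b_1}$, $\Delta_p^{b_1}=E_{p+1}^{b_1}-E_p^{b_1}$, and $\Delta_I^{b_1}=\chi_I\Delta_p^{b_1}$ for $I\in\mathcal{D}_p^n$; the same definitions apply with $b_1'$, and in the second variable with $b_2,b_2'$. Thus $E_V^{b_2'}f=\chi_V(x_2)\frac{\int_Vf(x_1,\cdot)b_2'}{\int_Vb_2'}$. The star denotes the transpose for the bilinear pairing $\langle f,g\rangle=\int fg$, so $E_K^{b_1'*}h=b_1'(x_1)\chi_K(x_1)\frac{\int_Kh(\cdot,x_2)\,dx_1}{\int_Kb_1'}$. $M_bf=bf$.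 $BMO(\mathbb{R}^n\times\mathbb{R}^m)$ is product BMO, the dual of the product Hardy space $H^1(\mathbb{R}^n\times\mathbb{R}^m)$; equivalently, in the dyadic setting, one uses the dual of dyadic product $H^1$ for the given grids. The function $M_b\Delta_K^{b_1}\Delta_V^{b_2}a$ is determined by $\langle M_b\Delta_K^{b_1}\Delta_V^{b_2}a,g\rangle=\langle a,M_b\Delta_K^{b_1}\Delta_V^{b_2}g\rangle$. The series is understood weakly, via pairing with $L^2$ functions. *)

theory Defs
  imports "HOL-Analysis.Analysis"
begin

section \<open>Cubes, dyadic grids and pseudo-accretive functions\<close>

definition cube :: "real^'n \<Rightarrow> real \<Rightarrow> (real^'n) set" where
  "cube u l = {x. \<forall>j. u $ j \<le> x $ j \<and> x $ j < u $ j + l}"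

definition tensor :: "('a \<Rightarrow> complex) \<Rightarrow> ('b \<Rightarrow> complex) \<Rightarrow> 'a \<times> 'b \<Rightarrow> complex" where
  "tensor g h = (\<lambda>(x1, x2). g x1 * h x2)"

definition Linf_bound :: "real \<Rightarrow> ('a::euclidean_space \<Rightarrow> complex) \<Rightarrow> bool" where
  "Linf_bound B b \<longleftrightarrow> b \<in> borel_measurable borel \<and> (AE x in lborel. cmod (b x) \<le> B)"

definition pseudo_accretive :: "real \<Rightarrow> ((real^'n) \<times> (real^'m) \<Rightarrow> complex) \<Rightarrow> bool" where
  "pseudo_accretive c b \<longleftrightarrow> 0 < c \<and>
     (\<forall>u l v r. 0 < l \<longrightarrow> 0 < r \<longrightarrow>
        cmod (LINT x:(cube u l \<times> cube v r)|lborel. b x)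
          / measure lborel (cube u l \<times> cube v r) > c)"

definition standard_dyadic :: "int \<Rightarrow> (real^'n) set set" where
  "standard_dyadic p =
     range (\<lambda>k :: int^'n. cube (\<chi> j. 2 powi (- p) * of_int (k $ j)) (2 powi (- p)))"

text \<open>The translation of the cubes of side \<open>2\<^sup>-\<^sup>p\<close>: the condition \<open>2\<^sup>-\<^sup>i < 2\<^sup>-\<^sup>p\<close> reads \<open>i > p\<close>.\<close>

definition grid_shift :: "(int \<Rightarrow> real^'n) \<Rightarrow> int \<Rightarrow> real^'n" where
  "grid_shift \<omega> p = (\<Sum>\<^sub>\<infinity>i\<in>{p<..}. (2 powi (- i)) *\<^sub>R \<omega> i)"

definition dyadic_grid :: "(real^'n) set set \<Rightarrow> bool" where
  "dyadic_grid D \<longleftrightarrow>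
     (\<exists>\<omega>. (\<forall>i j. \<omega> i $ j \<in> {0, 1}) \<and>
          D = (\<Union>p. (\<lambda>I. (+) (grid_shift \<omega> p) ` I) ` standard_dyadic p))"

definition generation :: "(real^'n) set set \<Rightarrow> int \<Rightarrow> (real^'n) set set" where
  "generation D p = {I \<in> D. \<exists>u. I = cube u (2 powi (- p))}"

definition cube_level :: "(real^'n) set \<Rightarrow> int" where
  "cube_level I = (THE p. \<exists>u. I = cube u (2 powi (- p)))"


section \<open>Adapted averages and martingale differences\<close>

definition avg_gen ::
    "(real^'n) set set \<Rightarrow> (real^'n \<Rightarrow> complex) \<Rightarrow> int \<Rightarrow> (real^'n \<Rightarrow> complex) \<Rightarrow> real^'n \<Rightarrow> complex" where
  "avg_gen D b p f x =
     (\<Sum>\<^sub>\<infinity>I\<in>generation D p.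
        (LINT y:I|lborel. f y * b y) / (LINT y:I|lborel. b y) * indicator I x)"

definition diff_gen ::
    "(real^'n) set set \<Rightarrow> (real^'n \<Rightarrow> complex) \<Rightarrow> int \<Rightarrow> (real^'n \<Rightarrow> complex) \<Rightarrow> real^'n \<Rightarrow> complex" where
  "diff_gen D b p f x = avg_gen D b (p + 1) f x - avg_gen D b p f x"

definition avg_cube ::
    "(real^'n) set set \<Rightarrow> (real^'n \<Rightarrow> complex) \<Rightarrow> (real^'n) set \<Rightarrow> (real^'n \<Rightarrow> complex) \<Rightarrow> real^'n \<Rightarrow> complex" where
  "avg_cube D b I f x = indicator I x * avg_gen D b (cube_level I) f x"

definition diff_cube ::
    "(real^'n) set set \<Rightarrow> (real^'n \<Rightarrow> complex) \<Rightarrow> (real^'n) set \<Rightarrow> (real^'n \<Rightarrow> complex) \<Rightarrow> real^'n \<Rightarrow> complex" where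
  "diff_cube D b I f x = indicator I x * diff_gen D b (cube_level I) f x"

text \<open>The transpose of \<^const>\<open>avg_cube\<close> for the bilinear pairing \<open>\<integral> f g\<close>.\<close>

definition avg_cube_star ::
    "(real^'n \<Rightarrow> complex) \<Rightarrow> (real^'n) set \<Rightarrow> (real^'n \<Rightarrow> complex) \<Rightarrow> real^'n \<Rightarrow> complex" where
  "avg_cube_star b I h x =
     b x * indicator I x * ((LINT y:I|lborel. h y) / (LINT y:I|lborel. b y))"

definition in_fst ::
    "(('a \<Rightarrow> complex) \<Rightarrow> 'a \<Rightarrow> complex) \<Rightarrow> ('a \<times> 'b \<Rightarrow> complex) \<Rightarrow> 'a \<times> 'b \<Rightarrow> complex" where
  "in_fst T f = (\<lambda>(x1, x2). T (\<lambda>y. f (y, x2)) x1)"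

definition in_snd ::
    "(('b \<Rightarrow> complex) \<Rightarrow> 'b \<Rightarrow> complex) \<Rightarrow> ('a \<times> 'b \<Rightarrow> complex) \<Rightarrow> 'a \<times> 'b \<Rightarrow> complex" where
  "in_snd T f = (\<lambda>(x1, x2). T (\<lambda>y. f (x1, y)) x2)"

definition diff_rect ::
    "(real^'n) set set \<Rightarrow> (real^'m) set set \<Rightarrow> (real^'n \<Rightarrow> complex) \<Rightarrow> (real^'m \<Rightarrow> complex) \<Rightarrow>
     (real^'n) set \<Rightarrow> (real^'m) set \<Rightarrow> ((real^'n) \<times> (real^'m) \<Rightarrow> complex) \<Rightarrow> (real^'n) \<times> (real^'m) \<Rightarrow> complex" where
  "diff_rect D1 D2 b1 b2 K V f = in_fst (diff_cube D1 b1 K) (in_snd (diff_cube D2 b2 V) f)"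


section \<open>Square-integrable functions\<close>

definition L2 :: "('a::euclidean_space \<Rightarrow> complex) set" where
  "L2 = {f. f \<in> borel_measurable borel \<and> integrable lborel (\<lambda>x. (cmod (f x))\<^sup>2)}"

definition L2_norm :: "('a::euclidean_space \<Rightarrow> complex) \<Rightarrow> real" where
  "L2_norm f = sqrt (LINT x|lborel. (cmod (f x))\<^sup>2)"

definition pairing :: "('a::euclidean_space \<Rightarrow> complex) \<Rightarrow> ('a \<Rightarrow> complex) \<Rightarrow> complex" where
  "pairing f g = (LINT x|lborel. f x * g x)"

definition weakly_sums ::
    "('i \<Rightarrow> 'a::euclidean_space \<Rightarrow> complex) \<Rightarrow> 'i set \<Rightarrow> ('a \<Rightarrow> complex) \<Rightarrow> bool" where
  "weakly_sums t A F \<longleftrightarrow>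
     (\<forall>i\<in>A. t i \<in> L2) \<and> F \<in> L2 \<and>
     (\<forall>g\<in>L2. ((\<lambda>i. pairing (t i) g) has_sum pairing F g) A)"


section \<open>Dyadic product Hardy space and product BMO for the given grids\<close>

text \<open>The classical martingale differences are the adapted ones for the function \<open>1\<close>. The real
  infinite sum is \<open>0\<close> where it diverges, so membership in \<open>dyadic_H1\<close> demands convergence explicitly.\<close>

definition square_fun ::
    "(real^'n) set set \<Rightarrow> (real^'m) set set \<Rightarrow> ((real^'n) \<times> (real^'m) \<Rightarrow> complex) \<Rightarrow> (real^'n) \<times> (real^'m) \<Rightarrow> real" where
  "square_fun D1 D2 f x =
     sqrt (\<Sum>\<^sub>\<infinity>(K, V)\<in>D1 \<times> D2. (cmod (diff_rect D1 D2 (\<lambda>_. 1) (\<lambda>_. 1) K V f x))\<^sup>2)"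

definition dyadic_H1 ::
    "(real^'n) set set \<Rightarrow> (real^'m) set set \<Rightarrow> ((real^'n) \<times> (real^'m) \<Rightarrow> complex) set" where
  "dyadic_H1 D1 D2 = {f. integrable lborel f \<and>
     (AE x in lborel.
        (\<lambda>(K, V). (cmod (diff_rect D1 D2 (\<lambda>_. 1) (\<lambda>_. 1) K V f x))\<^sup>2) summable_on D1 \<times> D2) \<and>
     integrable lborel (square_fun D1 D2 f)}"

definition dyadic_H1_norm ::
    "(real^'n) set set \<Rightarrow> (real^'m) set set \<Rightarrow> ((real^'n) \<times> (real^'m) \<Rightarrow> complex) \<Rightarrow> real" where
  "dyadic_H1_norm D1 D2 f = (LINT x|lborel. square_fun D1 D2 f x)"

text \<open>BMO is the dual of \<open>dyadic_H1\<close>, so its elements are bounded linear functionals there. Their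
  values outside \<open>dyadic_H1\<close> are irrelevant, and boundedness makes them insensitive to null sets.
  The elements of the dual of the non-dyadic \<open>H\<^sup>1\<close> restrict to such functionals, with control of
  the norm, because dyadic \<open>H\<^sup>1\<close> embeds continuously into it.\<close>

definition dyadic_BMO ::
    "(real^'n) set set \<Rightarrow> (real^'m) set set \<Rightarrow> (((real^'n) \<times> (real^'m) \<Rightarrow> complex) \<Rightarrow> complex) set" where
  "dyadic_BMO D1 D2 = {a.
     (\<forall>g\<in>dyadic_H1 D1 D2. \<forall>h\<in>dyadic_H1 D1 D2. a (\<lambda>x. g x + h x) = a g + a h) \<and>
     (\<forall>z. \<forall>h\<in>dyadic_H1 D1 D2. a (\<lambda>x. z * h x) = z * a h) \<and>
     (\<exists>A. \<forall>h\<in>dyadic_H1 D1 D2. cmod (a h) \<le> A * dyadic_H1_norm D1 D2 h)}"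

definition dyadic_BMO_norm ::
    "(real^'n) set set \<Rightarrow> (real^'m) set set \<Rightarrow> (((real^'n) \<times> (real^'m) \<Rightarrow> complex) \<Rightarrow> complex) \<Rightarrow> real" where
  "dyadic_BMO_norm D1 D2 a = (SUP h\<in>{h \<in> dyadic_H1 D1 D2. dyadic_H1_norm D1 D2 h \<le> 1}. cmod (a h))"


section \<open>The mixed paraproduct\<close>

text \<open>The function \<open>M\<^sub>b \<Delta>\<^sub>K \<Delta>\<^sub>V a\<close>, where \<open>b\<close> is the tensor product of \<open>b1\<close> and \<open>b2\<close>: the element
  of \<open>L2\<close>, unique up to null sets, that represents the functional \<open>g \<mapsto> \<langle>a, M\<^sub>b \<Delta>\<^sub>K \<Delta>\<^sub>V g\<rangle>\<close>.\<close>

definition mult_diff_BMO ::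
    "(real^'n) set set \<Rightarrow> (real^'m) set set \<Rightarrow> (real^'n \<Rightarrow> complex) \<Rightarrow> (real^'m \<Rightarrow> complex) \<Rightarrow>
     (real^'n) set \<Rightarrow> (real^'m) set \<Rightarrow> (((real^'n) \<times> (real^'m) \<Rightarrow> complex) \<Rightarrow> complex) \<Rightarrow>
     (real^'n) \<times> (real^'m) \<Rightarrow> complex" where
  "mult_diff_BMO D1 D2 b1 b2 K V a =
     (SOME \<phi>. \<phi> \<in> L2 \<and>
        (\<forall>g\<in>L2. pairing \<phi> g = a (\<lambda>x. tensor b1 b2 x * diff_rect D1 D2 b1 b2 K V g x)))"

definition paraproduct_term ::
    "(real^'n) set set \<Rightarrow> (real^'m) set set \<Rightarrow> (real^'n \<Rightarrow> complex) \<Rightarrow> (real^'m \<Rightarrow> complex) \<Rightarrow>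
     (real^'n \<Rightarrow> complex) \<Rightarrow> (real^'m \<Rightarrow> complex) \<Rightarrow> (((real^'n) \<times> (real^'m) \<Rightarrow> complex) \<Rightarrow> complex) \<Rightarrow>
     ((real^'n) \<times> (real^'m) \<Rightarrow> complex) \<Rightarrow> (real^'n) set \<times> (real^'m) set \<Rightarrow>
     (real^'n) \<times> (real^'m) \<Rightarrow> complex" where
  "paraproduct_term D1 D2 b1' b2' b1 b2 a f = (\<lambda>(K, V).
     in_fst (avg_cube_star b1' K)
       (\<lambda>x. in_snd (avg_cube D2 b2' V) f x * mult_diff_BMO D1 D2 b1 b2 K V a x))"

text \<open>The limit is unique up to null sets.\<close>

definition mixed_paraproduct ::
    "(real^'n) set set \<Rightarrow> (real^'m) set set \<Rightarrow> (real^'n \<Rightarrow> complex) \<Rightarrow> (real^'m \<Rightarrow> complex) \<Rightarrow>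
     (real^'n \<Rightarrow> complex) \<Rightarrow> (real^'m \<Rightarrow> complex) \<Rightarrow> (((real^'n) \<times> (real^'m) \<Rightarrow> complex) \<Rightarrow> complex) \<Rightarrow>
     ((real^'n) \<times> (real^'m) \<Rightarrow> complex) \<Rightarrow> (real^'n) \<times> (real^'m) \<Rightarrow> complex" where
  "mixed_paraproduct D1 D2 b1' b2' b1 b2 a f =
     (SOME F. weakly_sums (paraproduct_term D1 D2 b1' b2' b1 b2 a f) (D1 \<times> D2) F)"

end

theory Submission
  imports Defs
begin

text \<open>
  With \<open>w\<^sub>J = b (\<chi>\<^sub>J / \<integral>\<^sub>J b - \<chi>\<^sub>K / \<integral>\<^sub>K b)\<close> for a cube \<open>J\<close> with dyadic parent \<open>K\<close>, the operator
  \<open>M\<^sub>b \<Delta>\<^sub>K\<close> is the sum of \<open>(\<integral>\<^sub>J b) \<langle>\<cdot>, w\<^sub>J\<rangle> w\<^sub>J\<close> over the children \<open>J\<close> of \<open>K\<close>.  Writing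
  \<open>e'\<^sub>K = b' \<chi>\<^sub>K / \<integral>\<^sub>K b'\<close>, pairing the paraproduct of \<open>f\<close> with \<open>g\<close> therefore gives the sum over child rectangles
  \<open>J \<times> L \<subseteq> K \<times> V\<close> of
  \<open>\<integral>\<^sub>J b\<^sub>1 \<integral>\<^sub>L b\<^sub>2 \<langle>a, w\<^sub>J \<otimes> w\<^sub>L\<rangle> \<langle>f, w\<^sub>J \<otimes> e'\<^sub>V\<rangle> \<langle>g, e'\<^sub>K \<otimes> w\<^sub>L\<rangle>\<close>.

  The numbers \<open>\<langle>a, w\<^sub>J \<otimes> w\<^sub>L\<rangle>\<close> satisfy a Carleson condition over arbitrary finite unions of rectangles: the
  \<open>H\<^sup>1\<close> norm of a wavelet sum supported in \<open>\<Omega>\<close> is at most \<open>|\<Omega>|\<^sup>1\<^sup>/\<^sup>2\<close> times its \<open>L\<^sup>2\<close> norm, which the adapted square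
  function estimate controls by duality.  By the product Carleson embedding the sum is then bounded by the integral
  of a square function in the last two factors, and this is a product of two hybrids of a square function in one
  variable with a maximal function in the other, each bounded on \<open>L\<^sup>2\<close>.  All bounds are on absolute values, so the
  series converges unconditionally.
\<close>

section \<open>Dyadic filtrations\<close>

text \<open>The functions \<open>w_J\<close> of the children of one cube are linearly dependent, so
  they form no basis. Only upper bounds are used for them: a square function estimate and its dual.
  The one-variable bounds come from energies on cubes whose total does not decrease from a cube to
  its children. Over a finite forest these telescope, so no limit in the scale is taken. Only the
  constants of the tensor product are given, and its factors can be rescaled against each other.
  Every estimate for a factor therefore depends on the ratio \<kappa> of its essential bound to its
  accretivity constant, which scaling preserves; the essential bounds enter only through their
  product, in the coefficients of the paraproduct. The Hardy space is defined by classical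
  differences, whereas the wavelets are adapted to \<open>b\<close>. The two meet because
  \<open>w_J\<close> has mean zero and lives on the parent of \<open>J\<close>: the classical square
  function of a product of two wavelets cannot leave the parent rectangle. Rectangles are not nested
  as cubes are, which is why the Carleson condition has to be tested on arbitrary finite
  unions.\<close>

locale dyadic_filtration =
  fixes Q :: "int \<Rightarrow> 'a::euclidean_space \<Rightarrow> 'a set" and \<mu> :: "int \<Rightarrow> real" and d :: real
  assumes in_Q: "x \<in> Q p x"
    and Q_eq: "y \<in> Q p x \<Longrightarrow> Q p y = Q p x"
    and Q_succ: "Q (p + 1) x \<subseteq> Q p x"
    and Q_borel: "Q p x \<in> sets borel"
    and emeasure_Q: "emeasure lborel (Q p x) = ennreal (\<mu> p)"
    and mu_pos: "0 < \<mu> p"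
    and mu_succ: "\<mu> p = d * \<mu> (p + 1)"
    and d_gt_1: "1 < d"
    and countable_Q: "countable (range (Q p))"
begin

definition cubes :: "'a set set" where "cubes = (\<Union>p. range (Q p))"
text \<open>A cube is recorded as a set, so its generation has to be read off from it. The volumes
  \<mu> decrease strictly with the generation because \<open>d > 1\<close>, hence a set arises from
  one generation only.\<close>

definition level :: "'a set \<Rightarrow> int" where "level I = (THE p. I \<in> range (Q p))"
text \<open>Any point of the cube gives the same parent; \<open>par_Q\<close> removes the
  choice.\<close>

definition par :: "'a set \<Rightarrow> 'a set" where "par I = Q (level I - 1) (SOME x. x \<in> I)"
definition ch :: "'a set \<Rightarrow> 'a set set" where "ch I = Q (level I + 1) ` I"

abbreviation vol :: "'a set \<Rightarrow> real" where "vol \<equiv> measure lborel"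

lemma vol_Q: "vol (Q p x) = \<mu> p"
  using emeasure_Q[of p x] mu_pos[of p] by (simp add: measure_def)

lemma mu_add: "\<mu> p = d ^ k * \<mu> (p + int k)"
proof (induction k)
  case (Suc k)
  have "\<mu> (p + int k) = d * \<mu> (p + int (Suc k))"
    using mu_succ[of "p + int k"] by (simp add: algebra_simps)
  then show ?case using Suc by simp
qed simp

lemma mu_inj:
  assumes "\<mu> p = \<mu> q"
  shows "p = q"
proof -
  have *: False if "\<mu> p = \<mu> q" "p < q" for p q
  proof -
    define k where "k = nat (q - p)"
    have k: "q = p + int k" "0 < k" using \<open>p < q\<close> by (auto simp: k_def)
    have "d ^ k = 1"
      using mu_add[of p k] that(1) k(1) mu_pos[of q] by auto
    moreover have "1 < d ^ k" using d_gt_1 k(2) by simp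
    ultimately show False by simp
  qed
  then show ?thesis using assms by (metis linorder_neqE)
qed

lemma Q_eq_imp_level: "Q p x = Q q y \<Longrightarrow> p = q"
  using mu_inj vol_Q by metis

lemma level_Q [simp]: "level (Q p x) = p"
  unfolding level_def by (rule the_equality) (auto dest: Q_eq_imp_level)

lemma Q_in_cubes [simp]: "Q p x \<in> cubes"
  by (auto simp: cubes_def)

lemma cubesE:
  assumes "I \<in> cubes" obtains x where "I = Q (level I) x" "x \<in> I"
proof -
  obtain p x where "I = Q p x" using assms by (auto simp: cubes_def)
  then show ?thesis using that[of x] in_Q by simp
qed

lemma Q_level_eq: "I \<in> cubes \<Longrightarrow> x \<in> I \<Longrightarrow> Q (level I) x = I"
  by (metis cubesE Q_eq)

lemma Q_antimono:
  assumes "p \<le> q" shows "Q q x \<subseteq> Q p x"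
proof -
  have "Q (p + int k) x \<subseteq> Q p x" for k
  proof (induction k)
    case (Suc k)
    then show ?case using Q_succ[of "p + int k" x] by (auto simp: algebra_simps)
  qed simp
  from this[of "nat (q - p)"] assms show ?thesis by simp
qed

lemma par_Q [simp]: "par (Q p x) = Q (p - 1) x"
proof -
  have "(SOME y. y \<in> Q p x) \<in> Q p x" using in_Q by (metis someI)
  then have "(SOME y. y \<in> Q p x) \<in> Q (p - 1) x"
    using Q_succ[of "p - 1" x] by auto
  then show ?thesis unfolding par_def by (simp add: Q_eq)
qed

lemma par_eq: "I \<in> cubes \<Longrightarrow> x \<in> I \<Longrightarrow> par I = Q (level I - 1) x"
  by (metis Q_level_eq par_Q)

lemma par_in_cubes [simp]: "I \<in> cubes \<Longrightarrow> par I \<in> cubes"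
  by (metis cubesE par_eq Q_in_cubes)

lemma subset_par: "I \<in> cubes \<Longrightarrow> I \<subseteq> par I"
  by (metis cubesE par_Q Q_antimono diff_ge_0_iff_ge diff_add_cancel add_0 zle_diff1_eq less_le_not_le linorder_linear zle_add1_eq_le)

lemma level_par [simp]: "I \<in> cubes \<Longrightarrow> level (par I) = level I - 1"
  by (metis cubesE par_eq level_Q)

lemma
  assumes "K \<in> cubes" "J \<in> ch K"
  shows ch_in_cubes: "J \<in> cubes" and par_ch: "par J = K" and level_ch: "level J = level K + 1"
    and ch_subset: "J \<subseteq> K"
proof -
  obtain x where x: "x \<in> K" "J = Q (level K + 1) x" using assms(2) by (auto simp: ch_def)
  then show "J \<in> cubes" "level J = level K + 1" by auto
  show "par J = K" using x Q_level_eq[OF assms(1)] by simp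
  then show "J \<subseteq> K" using subset_par[OF \<open>J \<in> cubes\<close>] by simp
qed

lemma cubes_nonempty: "I \<in> cubes \<Longrightarrow> I \<noteq> {}"
  by (metis cubesE empty_iff)

lemma cubes_borel [measurable]: "I \<in> cubes \<Longrightarrow> I \<in> sets borel"
  by (metis cubesE Q_borel)

lemma cubes_fin: "I \<in> cubes \<Longrightarrow> emeasure lborel I < \<infinity>"
  by (metis cubesE emeasure_Q ennreal_less_top infinity_ennreal_def)

lemma vol_pos: "I \<in> cubes \<Longrightarrow> 0 < vol I"
  by (metis cubesE vol_Q mu_pos)

lemma emeasure_cubes: "I \<in> cubes \<Longrightarrow> emeasure lborel I = ennreal (vol I)"
  by (metis cubesE vol_Q emeasure_Q)

lemma vol_par: "I \<in> cubes \<Longrightarrow> vol (par I) = d * vol I"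
  by (metis (no_types, lifting) cubesE vol_Q par_eq mu_succ diff_add_cancel)

lemma countable_cubes: "countable cubes"
  unfolding cubes_def by (rule countable_UN) (auto intro: countable_Q)

lemma infinite_cubes: "infinite cubes"
proof -
  fix x :: 'a
  have "inj (\<lambda>p. Q p x)" by (auto intro!: injI dest: Q_eq_imp_level)
  then have "infinite (range (\<lambda>p. Q p x))" by (simp add: finite_image_iff infinite_UNIV_int)
  moreover have "range (\<lambda>p. Q p x) \<subseteq> cubes" by auto
  ultimately show ?thesis using finite_subset by blast
qed

lemma same_level_disjoint:
  assumes "I \<in> cubes" "J \<in> cubes" "level I = level J" "I \<noteq> J"
  shows "I \<inter> J = {}"
proof (rule ccontr)
  assume "I \<inter> J \<noteq> {}"
  then obtain x where "x \<in> I" "x \<in> J" by auto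
  then show False using assms Q_level_eq by metis
qed

text \<open>For a common point \<open>x\<close>, both sets are cubes \<open>Q p x\<close> of that
  point, and these shrink as \<open>p\<close> grows.\<close>

lemma nested:
  assumes "I \<in> cubes" "J \<in> cubes" "level I \<le> level J" "I \<inter> J \<noteq> {}"
  shows "J \<subseteq> I"
proof -
  obtain x where "x \<in> I" "x \<in> J" using assms(4) by auto
  then show ?thesis using assms Q_level_eq Q_antimono by metis
qed

lemma disjoint_ch: "K \<in> cubes \<Longrightarrow> disjoint_family_on (\<lambda>J. J) (ch K)"
  unfolding disjoint_family_on_def
  by (metis same_level_disjoint ch_in_cubes level_ch)

lemma Union_ch: "K \<in> cubes \<Longrightarrow> \<Union>(ch K) = K"
proof
  assume K: "K \<in> cubes"
  show "\<Union>(ch K) \<subseteq> K" using ch_subset[OF K] by auto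
  show "K \<subseteq> \<Union>(ch K)" using in_Q by (auto simp: ch_def)
qed

lemma vol_ch: "K \<in> cubes \<Longrightarrow> J \<in> ch K \<Longrightarrow> vol J = vol K / d"
  using vol_par[of J] par_ch[of K J] ch_in_cubes[of K J] d_gt_1 by simp

text \<open>Comparison of volumes: children are disjoint subsets of \<open>K\<close> of volume
  \<open>vol K / d\<close> each, so a finite set of them has at most \<open>d\<close>
  elements.\<close>

lemma finite_ch:
  assumes K: "K \<in> cubes"
  shows "finite (ch K)"
proof -
  have "card F \<le> nat \<lceil>d\<rceil>" if F: "F \<subseteq> ch K" "finite F" for F
  proof -
  have "card F * (vol K / d) = (\<Sum>J\<in>F. vol J)"
    using F vol_ch[OF K] by (subst sum.cong[where h = "\<lambda>_. vol K / d"]) auto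
  also have "\<dots> = vol (\<Union>J\<in>F. J)"
  proof (rule measure_finite_Union[symmetric])
    show "disjoint_family_on (\<lambda>J. J) F" using disjoint_ch[OF K] F(1) disjoint_family_on_mono by blast
    show "emeasure lborel J \<noteq> \<infinity>" if "J \<in> F" for J
    proof -
      have "J \<in> cubes" using that F(1) ch_in_cubes[OF K] by auto
      then show ?thesis using emeasure_cubes by simp
    qed
    show "(\<lambda>J. J) ` F \<subseteq> sets lborel" using F(1) ch_in_cubes[OF K] cubes_borel by auto
  qed (use F in simp)
  also have "\<dots> \<le> vol K"
  proof (rule measure_mono_fmeasurable)
    show "(\<Union>J\<in>F. J) \<in> sets lborel"
      using F ch_in_cubes[OF K] cubes_borel by (intro sets.finite_UN) auto
  qed (use F K ch_subset[OF K] cubes_fin[OF K] in \<open>auto simp: fmeasurable_def\<close>)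
  finally have "card F \<le> d" using vol_pos[OF K] d_gt_1 by (simp add: field_simps)
  then show ?thesis by linarith
  qed
  then show ?thesis using finite_if_finite_subsets_card_bdd[of "ch K" "nat \<lceil>d\<rceil>"] by blast
qed

lemma set_integral_ch:
  fixes f :: "'a \<Rightarrow> 'b::{banach, second_countable_topology}"
  assumes K: "K \<in> cubes" and f: "set_integrable lborel K f"
  shows "(LINT x:K|lborel. f x) = (\<Sum>J\<in>ch K. LINT x:J|lborel. f x)"
proof -
  have "(LINT x:(\<Union>J\<in>ch K. J)|lborel. f x) = (\<Sum>J\<in>ch K. LINT x:J|lborel. f x)"
    using finite_ch[OF K] disjoint_ch[OF K] ch_in_cubes[OF K] ch_subset[OF K]
    by (intro set_integral_finite_Union set_integrable_subset[OF f]) simp_all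
  then show ?thesis using Union_ch[OF K] by simp
qed

lemma vol_eq_sum_ch:
  assumes K: "K \<in> cubes"
  shows "vol K = (\<Sum>J\<in>ch K. vol J)"
proof -
  have "set_integrable lborel K (\<lambda>_. 1::real)"
    using cubes_fin[OF K] K by (auto simp: set_integrable_def)
  from set_integral_ch[OF K this] show ?thesis
    using K ch_in_cubes[OF K] by (simp add: set_lebesgue_integral_def)
qed

section \<open>Forests of descendants and telescoping energies\<close>

primrec descend :: "'a set set \<Rightarrow> nat \<Rightarrow> 'a set set" where
  "descend T 0 = T"
| "descend T (Suc k) = (\<Union>K\<in>descend T k. ch K)"

lemma descend_props:
  assumes "finite T" "T \<subseteq> cubes" "\<And>K. K \<in> T \<Longrightarrow> level K = p"
  shows "finite (descend T k) \<and> descend T k \<subseteq> cubes \<and> (\<forall>K\<in>descend T k. level K = p + int k)"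
proof (induction k)
  case (Suc k)
  then show ?case
    using assms by (auto simp: finite_ch ch_in_cubes subset_iff level_ch)
qed (use assms in auto)

lemma ancestor_in_descend:
  assumes "x \<in> K" "K \<in> T" "K \<in> cubes"
  shows "Q (level K + int k) x \<in> descend T k"
proof (induction k)
  case 0
  then show ?case using assms Q_level_eq by simp
next
  case (Suc k)
  have "Q (level K + int (Suc k)) x \<in> ch (Q (level K + int k) x)"
    using in_Q by (auto simp: ch_def algebra_simps)
  then show ?case using Suc by auto
qed

lemma sum_descend_Suc:
  assumes "finite T" "T \<subseteq> cubes" "\<And>K. K \<in> T \<Longrightarrow> level K = p"
  shows "(\<Sum>J\<in>descend T (Suc k). e J) = (\<Sum>K\<in>descend T k. \<Sum>J\<in>ch K. e J)"
proof -
  note P = descend_props[OF assms, of k]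
  have "ch K \<inter> ch L = {}" if "K \<in> descend T k" "L \<in> descend T k" "K \<noteq> L" for K L
    using that P par_ch by (metis disjoint_iff subsetD)
  then show ?thesis
    using P by (simp, subst sum.UNION_disjoint) (auto intro: finite_ch)
qed

text \<open>Common engine of the two one-parameter theorems. The energy \<open>e\<close> already
  contains the volume, and passing from a cube to its children raises the total by at least the gain
  \<open>q\<close>. The gain is a squared oscillation in \<open>square_estimate\<close> and zero in
  \<open>doob_maximal\<close>.\<close>

lemma forest_telescope:
  fixes e q :: "'a set \<Rightarrow> real"
  assumes step: "\<And>K. K \<in> cubes \<Longrightarrow> e K + (\<Sum>J\<in>ch K. q J) \<le> (\<Sum>J\<in>ch K. e J)"
    and T: "finite T" "T \<subseteq> cubes" "\<And>K. K \<in> T \<Longrightarrow> level K = p"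
  shows "(\<Sum>K\<in>T. e K) + (\<Sum>j<k. \<Sum>J\<in>descend T (Suc j). q J) \<le> (\<Sum>K\<in>descend T k. e K)"
proof (induction k)
  case (Suc k)
  have P: "descend T k \<subseteq> cubes" using descend_props[OF T] by auto
  have "(\<Sum>K\<in>descend T k. e K) + (\<Sum>J\<in>descend T (Suc k). q J)
      = (\<Sum>K\<in>descend T k. e K + (\<Sum>J\<in>ch K. q J))"
    by (subst sum_descend_Suc[OF T]) (auto simp: sum.distrib)
  also have "\<dots> \<le> (\<Sum>K\<in>descend T k. \<Sum>J\<in>ch K. e J)"
    using P by (intro sum_mono step) auto
  also have "\<dots> = (\<Sum>K\<in>descend T (Suc k). e K)"
    by (subst sum_descend_Suc[OF T]) auto
  finally show ?case using Suc by simp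
qed simp

text \<open>The roots have one common generation, strictly coarser than all of \<open>F\<close>.
  Thus every cube of \<open>F\<close> is a proper descendant of a root and receives a gain, and no
  root lies inside a cube of \<open>F\<close>, which starts the running maximum in
  \<open>doob_maximal\<close> at zero.\<close>

lemma finite_forest:
  assumes F: "finite F" "F \<subseteq> cubes"
  obtains T p k where "finite T" "T \<subseteq> cubes" "\<And>K. K \<in> T \<Longrightarrow> level K = p"
    "\<And>K. K \<in> F \<Longrightarrow> p < level K" "\<And>K. K \<in> F \<Longrightarrow> level K \<le> p + int k"
    "\<And>K x. K \<in> F \<Longrightarrow> x \<in> K \<Longrightarrow> Q p x \<in> T"
proof -
  \<comment> \<open>The element \<open>0\<close> keeps \<open>Min\<close> and \<open>Max\<close>
    defined when \<open>F\<close> is empty.\<close>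
  define S where "S = insert 0 (level ` F)"
  have S: "finite S" "S \<noteq> {}" using F by (auto simp: S_def)
  define p where "p = Min S - 1"
  define k where "k = nat (Max S - p)"
  define T where "T = (\<lambda>K. Q p (SOME x. x \<in> K)) ` F"
  have lo: "p < level K" and hi: "level K \<le> p + int k" if "K \<in> F" for K
  proof -
    have "level K \<in> S" using that by (auto simp: S_def)
    then have "Min S \<le> level K" "level K \<le> Max S" using S by auto
    then show "p < level K" "level K \<le> p + int k" by (auto simp: p_def k_def)
  qed
  have "Q p x \<in> T" if "K \<in> F" "x \<in> K" for K x
  proof -
    have K: "K \<in> cubes" using that F by auto
    have "(SOME x. x \<in> K) \<in> K" using that by (metis someI)
    then have "Q (level K) x = Q (level K) (SOME x. x \<in> K)"
      using K Q_level_eq that by metis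
    then have "(SOME x. x \<in> K) \<in> Q p x"
      using Q_antimono[of p "level K" x] lo[OF that(1)] in_Q[of "SOME x. x \<in> K" "level K"] by auto
    then have "Q p (SOME x. x \<in> K) = Q p x" by (rule Q_eq)
    then show ?thesis using that(1) unfolding T_def by (metis imageI)
  qed
  moreover have "finite T" "T \<subseteq> cubes" "\<And>K. K \<in> T \<Longrightarrow> level K = p"
    using F by (auto simp: T_def)
  ultimately show ?thesis using that lo hi by blast
qed

text \<open>The energies of the roots are dropped, being nonnegative, and the last generation
  remains. Its cubes have one level and are therefore disjoint, which later turns the energy sum
  into a single integral.\<close>

lemma forest_bound:
  fixes e q :: "'a set \<Rightarrow> real"
  assumes step: "\<And>K. K \<in> cubes \<Longrightarrow> e K + (\<Sum>J\<in>ch K. q J) \<le> (\<Sum>J\<in>ch K. e J)"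
    and e0: "\<And>K. K \<in> cubes \<Longrightarrow> 0 \<le> e K" and q0: "\<And>K. K \<in> cubes \<Longrightarrow> 0 \<le> q K"
    and F: "finite F" "F \<subseteq> cubes"
  shows "\<exists>T. finite T \<and> T \<subseteq> cubes \<and> disjoint_family_on (\<lambda>J. J) T \<and> (\<Sum>K\<in>F. q K) \<le> (\<Sum>K\<in>T. e K)"
proof -
  obtain T p k where T: "finite T" "T \<subseteq> cubes" "\<And>K. K \<in> T \<Longrightarrow> level K = p"
    and lo: "\<And>K. K \<in> F \<Longrightarrow> p < level K" and hi: "\<And>K. K \<in> F \<Longrightarrow> level K \<le> p + int k"
    and anc: "\<And>K x. K \<in> F \<Longrightarrow> x \<in> K \<Longrightarrow> Q p x \<in> T"
    using finite_forest[OF F] by metis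
  note P = descend_props[OF T]
  define U where "U = (\<Union>j<k. descend T (Suc j))"
  have FU: "F \<subseteq> U"
  proof
    fix K assume K: "K \<in> F"
    then have Kc: "K \<in> cubes" using F by auto
    obtain x where x: "x \<in> K" using cubes_nonempty[OF Kc] by auto
    define j where "j = nat (level K - p - 1)"
    have j: "level K = p + int (Suc j)" "j < k" using lo[OF K] hi[OF K] by (auto simp: j_def)
    have "Q (level (Q p x) + int (Suc j)) x \<in> descend T (Suc j)"
      by (rule ancestor_in_descend) (use in_Q anc[OF K x] in auto)
    then have "K \<in> descend T (Suc j)" using Q_level_eq[OF Kc x] j by simp
    then show "K \<in> U" using j by (auto simp: U_def)
  qed
  have fin: "finite (descend T j)" and sub: "descend T j \<subseteq> cubes" for j using P[of j] by auto
  have "finite U" unfolding U_def by (rule finite_UN_I) (use fin in blast)+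
  have Uc: "U \<subseteq> cubes" unfolding U_def using sub by blast
  have "(\<Sum>K\<in>F. q K) \<le> (\<Sum>K\<in>U. q K)"
    using FU \<open>finite U\<close> q0 Uc by (intro sum_mono2) auto
  also have "\<dots> = (\<Sum>j<k. \<Sum>K\<in>descend T (Suc j). q K)"
    unfolding U_def
  proof (rule sum.UNION_disjoint)
    show "\<forall>i\<in>{..<k}. \<forall>j\<in>{..<k}. i \<noteq> j \<longrightarrow> descend T (Suc i) \<inter> descend T (Suc j) = {}"
    proof (intro ballI impI)
      fix i j :: nat assume "i \<noteq> j"
      then show "descend T (Suc i) \<inter> descend T (Suc j) = {}"
        using P[of "Suc i"] P[of "Suc j"] by (auto simp del: descend.simps)
    qed
  next
    show "\<forall>i\<in>{..<k}. finite (descend T (Suc i))" using fin by blast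
  qed simp
  also have "\<dots> \<le> (\<Sum>K\<in>descend T k. e K)"
  proof -
    have "0 \<le> (\<Sum>K\<in>T. e K)" using T e0 by (intro sum_nonneg) auto
    then show ?thesis using forest_telescope[OF step T, of k] by linarith
  qed
  finally show ?thesis
    using P[of k] same_level_disjoint
    by (intro exI[of _ "descend T k"]) (auto simp: disjoint_family_on_def subset_iff)
qed

end

section \<open>The adapted square function\<close>

text \<open>The squared norm takes the value infinity, and not \<open>0\<close>, when the square is
  not integrable; estimates can thus be stated for all measurable functions.\<close>

definition sq :: "('a::euclidean_space \<Rightarrow> complex) \<Rightarrow> ennreal" where
  "sq u = (\<integral>\<^sup>+x. ennreal ((cmod (u x))\<^sup>2) \<partial>lborel)"

lemma L2_measurable: "u \<in> L2 \<Longrightarrow> u \<in> borel_measurable borel"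
  by (simp add: L2_def)

lemma L2_iff_sq: "u \<in> L2 \<longleftrightarrow> u \<in> borel_measurable borel \<and> sq u < \<infinity>"
  unfolding L2_def sq_def by (auto simp: integrable_iff_bounded)

lemma sq_eq_L2_norm:
  assumes "u \<in> L2" shows "sq u = ennreal ((L2_norm u)\<^sup>2)"
  using assms unfolding sq_def L2_norm_def L2_def
  by (subst nn_integral_eq_integral) (auto intro!: integral_nonneg)

lemma set_integrable_square:
  fixes v :: "'a::euclidean_space \<Rightarrow> 'b::{banach, second_countable_topology}"
  assumes v: "v \<in> borel_measurable borel"
    and K: "K \<in> sets borel" "emeasure lborel K < \<infinity>"
    and fin: "(\<integral>\<^sup>+x. ennreal ((norm (v x))\<^sup>2) \<partial>lborel) < \<infinity>"
  shows "set_integrable lborel K v"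
proof -
  have "integrable lborel (\<lambda>x. (norm (v x))\<^sup>2)"
    using fin v by (auto simp: integrable_iff_bounded)
  moreover have "integrable lborel (indicator K :: 'a \<Rightarrow> real)"
    using K by auto
  ultimately have "integrable lborel (\<lambda>x. (norm (v x))\<^sup>2 + indicator K x :: real)" by simp
  then show ?thesis unfolding set_integrable_def
  proof (rule Bochner_Integration.integrable_bound)
    have "t \<le> t\<^sup>2 + 1" for t :: real
      using zero_le_power2[of "t - 1/2"] by (simp add: power2_eq_square algebra_simps)
    then show "AE x in lborel. norm (indicator K x *\<^sub>R v x) \<le> norm ((norm (v x))\<^sup>2 + indicator K x :: real)"
      by (auto split: split_indicator)
  qed (use v K in measurable)
qed

lemma set_integral_CS:
  fixes v :: "'a::euclidean_space \<Rightarrow> 'b::{banach, second_countable_topology}"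
  assumes v [measurable]: "v \<in> borel_measurable borel" and K [measurable]: "K \<in> sets borel"
  shows "ennreal ((norm (LINT y:K|lborel. v y))\<^sup>2)
    \<le> emeasure lborel K * (\<integral>\<^sup>+y. ennreal ((norm (v y))\<^sup>2) * indicator K y \<partial>lborel)"
proof (cases "set_integrable lborel K v")
  \<comment> \<open>A function that is not integrable on \<open>K\<close> has Bochner integral
    \<open>0\<close>, so the left side vanishes.\<close>
  case False
  then have "(LINT y:K|lborel. v y) = 0"
    by (simp add: set_lebesgue_integral_def set_integrable_def not_integrable_integral_eq)
  then show ?thesis by simp
next
  case True
  have "ennreal (norm (LINT y:K|lborel. v y)) \<le> (\<integral>\<^sup>+y. ennreal (norm (indicator K y *\<^sub>R v y)) \<partial>lborel)"
    using True unfolding set_lebesgue_integral_def set_integrable_def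
    by (rule integral_norm_bound_ennreal)
  also have "\<dots> = (\<integral>\<^sup>+y. indicator K y * (ennreal (norm (v y)) * indicator K y) \<partial>lborel)"
    by (rule nn_integral_cong) (auto split: split_indicator)
  finally have "ennreal ((norm (LINT y:K|lborel. v y))\<^sup>2)
      \<le> (\<integral>\<^sup>+y. indicator K y * (ennreal (norm (v y)) * indicator K y) \<partial>lborel)\<^sup>2"
    by (simp add: ennreal_power[symmetric] power_mono)
  also have "\<dots> \<le> (\<integral>\<^sup>+y. (indicator K y)\<^sup>2 \<partial>lborel)
      * (\<integral>\<^sup>+y. (ennreal (norm (v y)) * indicator K y)\<^sup>2 \<partial>lborel)"
    by (rule Cauchy_Schwarz_nn_integral) measurable
  also have "(\<integral>\<^sup>+y. (indicator K y)\<^sup>2 \<partial>lborel) = emeasure lborel K"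
  proof -
    have "(\<integral>\<^sup>+y. (indicator K y :: ennreal)\<^sup>2 \<partial>lborel) = (\<integral>\<^sup>+y. indicator K y \<partial>lborel)"
      by (rule nn_integral_cong) (auto split: split_indicator)
    then show ?thesis by simp
  qed
  also have "(\<integral>\<^sup>+y. (ennreal (norm (v y)) * indicator K y)\<^sup>2 \<partial>lborel)
      = (\<integral>\<^sup>+y. ennreal ((norm (v y))\<^sup>2) * indicator K y \<partial>lborel)"
    by (rule nn_integral_cong) (auto split: split_indicator simp: ennreal_power)
  finally show ?thesis .
qed

lemma sum_nn_integral_disjoint_le:
  assumes T: "finite T" "disjoint_family_on (\<lambda>J. J) T" "T \<subseteq> sets borel"
    and g [measurable]: "g \<in> borel_measurable borel"
  shows "(\<Sum>K\<in>T. \<integral>\<^sup>+y. g y * indicator K y \<partial>lborel) \<le> (\<integral>\<^sup>+y. g y \<partial>(lborel :: 'a::euclidean_space measure))"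
proof -
  have "(\<Sum>K\<in>T. \<integral>\<^sup>+y. g y * indicator K y \<partial>lborel) = (\<integral>\<^sup>+y. (\<Sum>K\<in>T. g y * indicator K y) \<partial>lborel)"
    using T by (subst nn_integral_sum) auto
  also have "\<dots> \<le> (\<integral>\<^sup>+y. g y \<partial>lborel)"
  proof (rule nn_integral_mono)
    fix y :: 'a
    have "(\<Sum>K\<in>T. g y * indicator K y) = g y * indicator (\<Union>K\<in>T. K) y"
      using T by (subst indicator_UN_disjoint) (auto simp: sum_distrib_left)
    also have "\<dots> \<le> g y" by (auto split: split_indicator)
    finally show "(\<Sum>K\<in>T. g y * indicator K y) \<le> g y" .
  qed
  finally show ?thesis .
qed

lemma
  fixes b :: "'a::euclidean_space \<Rightarrow> complex"
  assumes b [measurable]: "b \<in> borel_measurable borel" and le: "AE x in lborel. cmod (b x) \<le> \<beta>"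
    and K [measurable]: "K \<in> sets borel" and fin: "emeasure lborel K < \<infinity>"
  shows ess_bounded_set_integrable: "set_integrable lborel K b"
    and ess_bounded_set_integral_le: "cmod (LINT y:K|lborel. b y) \<le> \<beta> * measure lborel K"
proof -
  have bound: "AE x in lborel. norm (indicator K x *\<^sub>R b x) \<le> \<beta> * indicator K x"
    using le by eventually_elim (auto split: split_indicator)
  have i: "integrable lborel (\<lambda>x. \<beta> * indicator K x :: real)" using K fin by auto
  then have bi: "integrable lborel (\<lambda>x. indicator K x *\<^sub>R b x)"
  proof (rule Bochner_Integration.integrable_bound)
    show "AE x in lborel. norm (indicator K x *\<^sub>R b x) \<le> norm (\<beta> * indicator K x)"
      using bound by eventually_elim simp
  qed measurable
  then show "set_integrable lborel K b" by (simp add: set_integrable_def)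
  have "cmod (LINT y:K|lborel. b y) \<le> (LINT y|lborel. norm (indicator K y *\<^sub>R b y))"
    unfolding set_lebesgue_integral_def by (rule integral_norm_bound)
  also have "\<dots> \<le> (LINT y|lborel. \<beta> * indicator K y)"
    by (rule integral_mono_AE[OF integrable_norm[OF bi] i bound])
  finally show "cmod (LINT y:K|lborel. b y) \<le> \<beta> * measure lborel K" by simp
qed

text \<open>For \<open>\<lambda> \<ge> 9 \<beta>\<^sup>2\<close> the polynomial \<open>|w|\<^sup>2 (\<lambda> + |b|\<^sup>2)\<close> is uniformly convex on \<open>|b| \<le> \<beta>\<close>; this replaces the
  Carleson embedding theorem in the proof of the adapted square function estimate.\<close>

lemma energy_ineq:
  fixes w b w' b' :: complex
  assumes "cmod b \<le> \<beta>" "cmod b' \<le> \<beta>"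
  shows "(cmod w)\<^sup>2 * (9 * \<beta>\<^sup>2 + (cmod b)\<^sup>2) + 2 * (9 * \<beta>\<^sup>2 + (cmod b)\<^sup>2) * Re (cnj w * (w' - w))
      + 2 * (cmod w)\<^sup>2 * Re (cnj b * (b' - b))
      + (\<beta>\<^sup>2 * (cmod (w' - w))\<^sup>2 + (cmod w)\<^sup>2 * (cmod (b' - b))\<^sup>2 / 2)
    \<le> (cmod w')\<^sup>2 * (9 * \<beta>\<^sup>2 + (cmod b')\<^sup>2)"
proof -
  define D E r s where "D = w' - w" and "E = b' - b" and "r = Re (cnj w * D)" and "s = Re (cnj b * E)"
  have expand: "(cmod (u + v))\<^sup>2 = (cmod u)\<^sup>2 + 2 * Re (cnj u * v) + (cmod v)\<^sup>2" for u v :: complex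
    unfolding cmod_power2 by (simp add: power2_eq_square algebra_simps)
  have w': "(cmod w')\<^sup>2 = (cmod w)\<^sup>2 + 2 * r + (cmod D)\<^sup>2"
    using expand[of w D] by (simp add: D_def r_def)
  have b': "(cmod b')\<^sup>2 = (cmod b)\<^sup>2 + 2 * s + (cmod E)\<^sup>2"
    using expand[of b E] by (simp add: E_def s_def)
  have r: "\<bar>r\<bar> \<le> cmod w * cmod D"
    unfolding r_def by (metis abs_Re_le_cmod norm_mult complex_mod_cnj)
  have bb: "\<bar>(cmod b')\<^sup>2 - (cmod b)\<^sup>2\<bar> \<le> 2 * \<beta> * cmod E"
  proof -
    have "\<bar>(cmod b')\<^sup>2 - (cmod b)\<^sup>2\<bar> = \<bar>cmod b' - cmod b\<bar> * (cmod b' + cmod b)"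
      by (simp add: power2_eq_square square_diff_square_factored abs_mult)
    also have "\<dots> \<le> cmod E * (\<beta> + \<beta>)"
      unfolding E_def using assms by (intro mult_mono norm_triangle_ineq3 add_mono) auto
    finally show ?thesis by (simp add: mult.commute)
  qed
  have "\<bar>2 * r * ((cmod b')\<^sup>2 - (cmod b)\<^sup>2)\<bar> \<le> 2 * (cmod w * cmod D) * (2 * \<beta> * cmod E)"
    unfolding abs_mult using r bb by (intro mult_mono) auto
  then have cross: "- (4 * \<beta> * cmod w * cmod D * cmod E) \<le> 2 * r * ((cmod b')\<^sup>2 - (cmod b)\<^sup>2)"
    by (simp add: mult_ac)
  \<comment> \<open>Completing this square absorbs the cross term at the price of
    \<open>8 * \<beta>\<^sup>2\<close> times the square of \<open>cmod D\<close>. Together with the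
    gain of one more \<open>\<beta>\<^sup>2\<close> this gives the constant 9.\<close>
  have "0 \<le> (cmod w * cmod E - 4 * \<beta> * cmod D)\<^sup>2 / 2 + (cmod D)\<^sup>2 * (cmod b')\<^sup>2" by simp
  also have "\<dots> = 8 * \<beta>\<^sup>2 * (cmod D)\<^sup>2 + (cmod w)\<^sup>2 * (cmod E)\<^sup>2 / 2 + (cmod D)\<^sup>2 * (cmod b')\<^sup>2
      - 4 * \<beta> * cmod w * cmod D * cmod E"
    by (simp add: power2_eq_square algebra_simps add_divide_distrib diff_divide_distrib)
  also have "\<dots> \<le> 8 * \<beta>\<^sup>2 * (cmod D)\<^sup>2 + (cmod w)\<^sup>2 * (cmod E)\<^sup>2 / 2 + (cmod D)\<^sup>2 * (cmod b')\<^sup>2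
      + 2 * r * ((cmod b')\<^sup>2 - (cmod b)\<^sup>2)"
    using cross by linarith
  also have "\<dots> = (cmod w')\<^sup>2 * (9 * \<beta>\<^sup>2 + (cmod b')\<^sup>2)
     - ((cmod w)\<^sup>2 * (9 * \<beta>\<^sup>2 + (cmod b)\<^sup>2) + 2 * (9 * \<beta>\<^sup>2 + (cmod b)\<^sup>2) * r
      + 2 * (cmod w)\<^sup>2 * s + (\<beta>\<^sup>2 * (cmod D)\<^sup>2 + (cmod w)\<^sup>2 * (cmod E)\<^sup>2 / 2))"
    unfolding w' b' by (simp add: algebra_simps)
  finally show ?thesis by (simp add: D_def E_def r_def s_def)
qed

text \<open>A discrete quotient rule, in which \<kappa> bounds the denominators from below. The
  bracket on the right is exactly the gain of \<open>energy_ineq\<close>, so that gain pays for the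
  oscillation of the quotients.\<close>

lemma ratio_ineq:
  fixes w b w' b' :: complex
  assumes \<beta>: "0 < \<beta>" and \<kappa>: "1 \<le> \<kappa>" and b: "\<beta> \<le> \<kappa> * cmod b" and b': "\<beta> \<le> \<kappa> * cmod b'"
  shows "(cmod (w' / b' - w / b))\<^sup>2
    \<le> 4 * \<kappa> ^ 4 / \<beta> ^ 4 * (\<beta>\<^sup>2 * (cmod (w' - w))\<^sup>2 + (cmod w)\<^sup>2 * (cmod (b' - b))\<^sup>2 / 2)"
proof -
  define D E where "D = w' - w" and "E = b' - b"
  have pos: "0 < cmod b" "0 < cmod b'"
    using \<beta> b b' by auto
  have ib: "1 / cmod b \<le> \<kappa> / \<beta>" "1 / cmod b' \<le> \<kappa> / \<beta>"
    using pos b b' \<beta> by (auto simp: field_simps)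
  have eq: "w' / b' - w / b = D / b' - w * E / (b * b')"
    using pos by (simp add: D_def E_def field_simps)
  have "cmod (w' / b' - w / b) \<le> cmod D * (1 / cmod b') + cmod w * cmod E * ((1 / cmod b) * (1 / cmod b'))"
    unfolding eq by (rule order_trans[OF norm_triangle_ineq4]) (simp add: norm_divide norm_mult)
  also have "\<dots> \<le> cmod D * (\<kappa> / \<beta>) + cmod w * cmod E * ((\<kappa> / \<beta>) * (\<kappa> / \<beta>))"
    using ib pos \<kappa> \<beta> by (intro add_mono mult_left_mono mult_mono) auto
  finally have "(cmod (w' / b' - w / b))\<^sup>2 \<le> (cmod D * (\<kappa> / \<beta>) + cmod w * cmod E * ((\<kappa> / \<beta>) * (\<kappa> / \<beta>)))\<^sup>2"
    by (rule power_mono) simp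
  also have "\<dots> \<le> 2 * (cmod D * (\<kappa> / \<beta>))\<^sup>2 + 2 * (cmod w * cmod E * ((\<kappa> / \<beta>) * (\<kappa> / \<beta>)))\<^sup>2"
    using sum_squares_bound[of "cmod D * (\<kappa> / \<beta>)" "cmod w * cmod E * ((\<kappa> / \<beta>) * (\<kappa> / \<beta>))"]
    by (simp add: power2_sum)
  also have "\<dots> = 2 * \<kappa>\<^sup>2 / \<beta> ^ 4 * (\<beta>\<^sup>2 * (cmod D)\<^sup>2) + 4 * \<kappa> ^ 4 / \<beta> ^ 4 * ((cmod w)\<^sup>2 * (cmod E)\<^sup>2 / 2)"
    using \<beta> by (simp add: field_simps power2_eq_square power4_eq_xxxx)
  also have "2 * \<kappa>\<^sup>2 / \<beta> ^ 4 \<le> 4 * \<kappa> ^ 4 / \<beta> ^ 4"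
    using power_increasing[of 2 4 \<kappa>] \<kappa> by (intro divide_right_mono mult_mono) auto
  finally show ?thesis
    unfolding D_def E_def by (simp add: distrib_left mult_right_mono)
qed

section \<open>Accretive functions and the one-parameter square function\<close>

context dyadic_filtration
begin

text \<open>The parameter \<kappa> is the ratio of the essential bound \<beta> to the accretivity
  constant. Multiplying \<open>b\<close> by a nonzero constant changes \<beta> but not \<kappa>, and
  the estimates below depend on \<kappa> only.\<close>

definition accretive :: "real \<Rightarrow> real \<Rightarrow> ('a \<Rightarrow> complex) \<Rightarrow> bool" where
  "accretive \<kappa> \<beta> b \<longleftrightarrow> 0 < \<beta> \<and> 1 \<le> \<kappa> \<and> b \<in> borel_measurable borel \<and> (AE x in lborel. cmod (b x) \<le> \<beta>) \<and>
     (\<forall>K\<in>cubes. \<beta> * vol K \<le> \<kappa> * cmod (LINT y:K|lborel. b y))"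

text \<open>This is the constant value on \<open>J\<close> of the adapted difference of
  \<open>u\<close> at the parent of \<open>J\<close>, see \<open>diff_cube_eq\<close>.\<close>

definition osc :: "('a \<Rightarrow> complex) \<Rightarrow> 'a set \<Rightarrow> ('a \<Rightarrow> complex) \<Rightarrow> complex" where
  "osc b J u = (LINT y:J|lborel. u y * b y) / (LINT y:J|lborel. b y)
     - (LINT y:par J|lborel. u y * b y) / (LINT y:par J|lborel. b y)"

lemma
  assumes b: "accretive \<kappa> \<beta> b" and K: "K \<in> cubes"
  shows accretive_set_integrable: "set_integrable lborel K b"
    and accretive_integral_le: "cmod (LINT y:K|lborel. b y) \<le> \<beta> * vol K"
  using b K cubes_fin[OF K] unfolding accretive_def
  by (auto intro: ess_bounded_set_integrable ess_bounded_set_integral_le)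

lemma accretive_integral_nonzero:
  assumes b: "accretive \<kappa> \<beta> b" and K: "K \<in> cubes"
  shows "(LINT y:K|lborel. b y) \<noteq> 0"
  using b vol_pos[OF K] K unfolding accretive_def
  by (metis mult_zero_right norm_zero mult_pos_pos linorder_not_le)

lemma sq_mult_accretive:
  assumes b: "accretive \<kappa> \<beta> b" and [measurable]: "u \<in> borel_measurable borel"
  shows "(\<integral>\<^sup>+x. ennreal ((cmod (u x * b x))\<^sup>2) \<partial>lborel) \<le> ennreal (\<beta>\<^sup>2) * sq u"
proof -
  have "(\<integral>\<^sup>+x. ennreal ((cmod (u x * b x))\<^sup>2) \<partial>lborel) \<le> (\<integral>\<^sup>+x. ennreal (\<beta>\<^sup>2) * ennreal ((cmod (u x))\<^sup>2) \<partial>lborel)"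
  proof (rule nn_integral_mono_AE)
    show "AE x in lborel. ennreal ((cmod (u x * b x))\<^sup>2) \<le> ennreal (\<beta>\<^sup>2) * ennreal ((cmod (u x))\<^sup>2)"
      using b unfolding accretive_def
      by (auto elim!: eventually_mono simp: norm_mult power_mult_distrib ennreal_mult[symmetric] mult.commute
          intro!: ennreal_leI mult_right_mono power_mono)
  qed
  then show ?thesis by (simp add: sq_def nn_integral_cmult)
qed

lemma L2_set_integrable:
  assumes b: "accretive \<kappa> \<beta> b" and u: "u \<in> L2" and K: "K \<in> cubes"
  shows "set_integrable lborel K (\<lambda>x. u x * b x)"
proof (rule set_integrable_square)
  show "(\<integral>\<^sup>+x. ennreal ((norm (u x * b x))\<^sup>2) \<partial>lborel) < \<infinity>"
    using sq_mult_accretive[OF b L2_measurable[OF u]] u L2_iff_sq[of u]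
    by (metis ennreal_less_top ennreal_mult_less_top infinity_ennreal_def le_less_trans)
qed (use u b K cubes_fin in \<open>auto simp: accretive_def L2_def\<close>)

text \<open>The adapted average of \<open>u\<close> is the quotient of the means \<open>w\<close> of
  \<open>u b\<close> and \<open>a\<close> of \<open>b\<close>. By \<open>ratio_ineq\<close> its
  squared oscillation is dominated by the convexity gain of the energy \<open>e\<close>. The
  first-order terms of \<open>energy_ineq\<close> disappear on summing over the children, as
  \<open>w\<close> and \<open>a\<close> are means.\<close>

lemma square_estimate:
  assumes b: "accretive \<kappa> \<beta> b" and u: "u \<in> borel_measurable borel"
    and F: "finite F" "F \<subseteq> cubes"
  shows "(\<Sum>J\<in>F. ennreal (vol J * (cmod (osc b J u))\<^sup>2)) \<le> ennreal (40 * \<kappa> ^ 4) * sq u"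
proof (cases "sq u < \<infinity>")
  case False
  moreover have "0 < 40 * \<kappa> ^ 4" using b by (auto simp: accretive_def)
  ultimately show ?thesis by (simp add: ennreal_mult_top less_top[symmetric])
next
  case True
  then have uL: "u \<in> L2" using u by (simp add: L2_iff_sq)
  have \<beta>: "0 < \<beta>" and \<kappa>: "1 \<le> \<kappa>" using b by (auto simp: accretive_def)
  have [measurable]: "b \<in> borel_measurable borel" using b by (auto simp: accretive_def)
  note [measurable] = u
  define w where "w K = (LINT y:K|lborel. u y * b y) / vol K" for K
  define a where "a K = (LINT y:K|lborel. b y) / vol K" for K
  have a_le: "cmod (a K) \<le> \<beta>" and a_ge: "\<beta> \<le> \<kappa> * cmod (a K)" if "K \<in> cubes" for K
    using accretive_integral_le[OF b that] vol_pos[OF that] b that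
    by (auto simp: a_def norm_divide field_simps accretive_def)
  have vol_ne0: "vol K \<noteq> 0" if "K \<in> cubes" for K using vol_pos[OF that] by simp
  \<comment> \<open>The factor of \<open>ratio_ineq\<close> is built into the energy, so that its
    gain dominates the squared oscillation itself.\<close>
  define C where "C = 4 * \<kappa> ^ 4 / \<beta> ^ 4"
  have C: "0 < C" using \<kappa> \<beta> by (simp add: C_def)
  define e where "e K = vol K * (C * ((cmod (w K))\<^sup>2 * (9 * \<beta>\<^sup>2 + (cmod (a K))\<^sup>2)))" for K
  define q where "q J = vol J * (cmod (osc b J u))\<^sup>2" for J
  have step: "e K + (\<Sum>J\<in>ch K. q J) \<le> (\<Sum>J\<in>ch K. e J)" if K: "K \<in> cubes" for K
  proof -
    define A where "A = 2 * (9 * \<beta>\<^sup>2 + (cmod (a K))\<^sup>2)"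
    define B where "B = 2 * (cmod (w K))\<^sup>2"
    have one: "vol J * (C * ((cmod (w K))\<^sup>2 * (9 * \<beta>\<^sup>2 + (cmod (a K))\<^sup>2)))
        + C * (A * Re (cnj (w K) * (vol J * (w J - w K))) + B * Re (cnj (a K) * (vol J * (a J - a K)))) + q J \<le> e J"
      if J: "J \<in> ch K" for J
    proof -
      have Jc: "J \<in> cubes" and pJ: "par J = K" using ch_in_cubes par_ch K J by auto
      have osc: "osc b J u = w J / a J - w K / a K"
        using vol_pos[OF K] vol_pos[OF Jc] by (simp add: osc_def pJ w_def a_def)
      have "(cmod (osc b J u))\<^sup>2 \<le> C * (\<beta>\<^sup>2 * (cmod (w J - w K))\<^sup>2 + (cmod (w K))\<^sup>2 * (cmod (a J - a K))\<^sup>2 / 2)"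
        unfolding osc C_def by (rule ratio_ineq[OF \<beta> \<kappa> a_ge[OF K] a_ge[OF Jc]])
      moreover have "C * ((cmod (w K))\<^sup>2 * (9 * \<beta>\<^sup>2 + (cmod (a K))\<^sup>2) + A * Re (cnj (w K) * (w J - w K))
          + B * Re (cnj (a K) * (a J - a K))
          + (\<beta>\<^sup>2 * (cmod (w J - w K))\<^sup>2 + (cmod (w K))\<^sup>2 * (cmod (a J - a K))\<^sup>2 / 2))
        \<le> C * ((cmod (w J))\<^sup>2 * (9 * \<beta>\<^sup>2 + (cmod (a J))\<^sup>2))"
        unfolding A_def B_def using C by (intro mult_left_mono energy_ineq a_le K Jc) auto
      ultimately have "C * ((cmod (w K))\<^sup>2 * (9 * \<beta>\<^sup>2 + (cmod (a K))\<^sup>2)) + C * (A * Re (cnj (w K) * (w J - w K))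
          + B * Re (cnj (a K) * (a J - a K))) + (cmod (osc b J u))\<^sup>2
        \<le> C * ((cmod (w J))\<^sup>2 * (9 * \<beta>\<^sup>2 + (cmod (a J))\<^sup>2))"
        by (simp only: distrib_left)
      from mult_left_mono[OF this, of "vol J"] show ?thesis
        unfolding e_def q_def by (simp add: algebra_simps)
    qed
    \<comment> \<open>The volume-weighted means over the children return the mean over
      \<open>K\<close>, which kills the linear terms.\<close>
    have w0: "(\<Sum>J\<in>ch K. vol J * (w J - w K)) = 0"
    proof -
      have "(\<Sum>J\<in>ch K. vol J * w J) = (\<Sum>J\<in>ch K. LINT y:J|lborel. u y * b y)"
        using vol_ne0[OF ch_in_cubes[OF K]] by (intro sum.cong) (auto simp: w_def)
      also have "\<dots> = vol K * w K"
        using set_integral_ch[OF K L2_set_integrable[OF b uL K]] vol_pos[OF K] by (simp add: w_def)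
      finally show ?thesis
        using vol_eq_sum_ch[OF K] by (simp add: right_diff_distrib sum_subtractf sum_distrib_right[symmetric] flip: of_real_sum)
    qed
    have a0: "(\<Sum>J\<in>ch K. vol J * (a J - a K)) = 0"
    proof -
      have "(\<Sum>J\<in>ch K. vol J * a J) = (\<Sum>J\<in>ch K. LINT y:J|lborel. b y)"
        using vol_ne0[OF ch_in_cubes[OF K]] by (intro sum.cong) (auto simp: a_def)
      also have "\<dots> = vol K * a K"
        using set_integral_ch[OF K accretive_set_integrable[OF b K]] vol_pos[OF K] by (simp add: a_def)
      finally show ?thesis
        using vol_eq_sum_ch[OF K] by (simp add: right_diff_distrib sum_subtractf sum_distrib_right[symmetric] flip: of_real_sum)
    qed
    have "(\<Sum>J\<in>ch K. vol J * (C * ((cmod (w K))\<^sup>2 * (9 * \<beta>\<^sup>2 + (cmod (a K))\<^sup>2)))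
        + C * (A * Re (cnj (w K) * (vol J * (w J - w K))) + B * Re (cnj (a K) * (vol J * (a J - a K)))) + q J)
      = e K + C * (A * Re (cnj (w K) * (\<Sum>J\<in>ch K. vol J * (w J - w K)))
          + B * Re (cnj (a K) * (\<Sum>J\<in>ch K. vol J * (a J - a K)))) + (\<Sum>J\<in>ch K. q J)"
      unfolding e_def by (subst vol_eq_sum_ch[OF K])
        (simp only: distrib_left sum.distrib sum_distrib_left sum_distrib_right Re_sum)
    then show ?thesis using sum_mono[OF one, of "ch K" "\<lambda>J. J"] unfolding w0 a0 by simp
  qed
  have "\<exists>T. finite T \<and> T \<subseteq> cubes \<and> disjoint_family_on (\<lambda>J. J) T \<and> (\<Sum>K\<in>F. q K) \<le> (\<Sum>K\<in>T. e K)"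
  proof (rule forest_bound[OF step _ _ F])
    show "0 \<le> e K" "0 \<le> q K" for K using C by (auto simp: e_def q_def)
  qed
  then obtain T where T: "finite T" "T \<subseteq> cubes" "disjoint_family_on (\<lambda>J. J) T"
    and qe: "(\<Sum>K\<in>F. q K) \<le> (\<Sum>K\<in>T. e K)" by auto
  have eK: "ennreal (e K) \<le> ennreal (C * (10 * \<beta>\<^sup>2)) * (\<integral>\<^sup>+y. ennreal ((cmod (u y * b y))\<^sup>2) * indicator K y \<partial>lborel)"
    if K: "K \<in> cubes" for K
  proof -
    have "(cmod (a K))\<^sup>2 \<le> \<beta>\<^sup>2" using a_le[OF K] by (intro power_mono) auto
    then have "e K \<le> vol K * (C * ((cmod (w K))\<^sup>2 * (10 * \<beta>\<^sup>2)))"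
      unfolding e_def using C by (intro mult_left_mono) auto
    also have "\<dots> = (C * (10 * \<beta>\<^sup>2)) * ((1 / vol K) * (cmod (LINT y:K|lborel. u y * b y))\<^sup>2)"
      using vol_pos[OF K] by (simp add: w_def norm_divide power_divide power2_eq_square)
    finally have "ennreal (e K) \<le> ennreal (C * (10 * \<beta>\<^sup>2)) * (ennreal (1 / vol K) * ennreal ((cmod (LINT y:K|lborel. u y * b y))\<^sup>2))"
      using C by (subst ennreal_mult[symmetric] | simp)+
    also have "ennreal (1 / vol K) * ennreal ((cmod (LINT y:K|lborel. u y * b y))\<^sup>2) \<le>
      ennreal (1 / vol K) * (ennreal (vol K) * (\<integral>\<^sup>+y. ennreal ((cmod (u y * b y))\<^sup>2) * indicator K y \<partial>lborel))"
      using set_integral_CS[of "\<lambda>y. u y * b y" K] K by (intro mult_left_mono) (auto simp: emeasure_cubes)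
    also have "\<dots> = (\<integral>\<^sup>+y. ennreal ((cmod (u y * b y))\<^sup>2) * indicator K y \<partial>lborel)"
      using vol_pos[OF K] by (simp add: mult.assoc[symmetric] ennreal_mult[symmetric])
    finally show ?thesis by (simp add: mult_left_mono)
  qed
  have "(\<Sum>J\<in>F. ennreal (q J)) = ennreal (\<Sum>J\<in>F. q J)"
    by (intro sum_ennreal) (auto simp: q_def)
  also have "\<dots> \<le> ennreal (\<Sum>K\<in>T. e K)" by (rule ennreal_leI[OF qe])
  also have "\<dots> = (\<Sum>K\<in>T. ennreal (e K))"
    using C by (intro sum_ennreal[symmetric]) (auto simp: e_def)
  also have "\<dots> \<le> (\<Sum>K\<in>T. ennreal (C * (10 * \<beta>\<^sup>2)) * (\<integral>\<^sup>+y. ennreal ((cmod (u y * b y))\<^sup>2) * indicator K y \<partial>lborel))"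
    using eK T by (intro sum_mono) auto
  also have "\<dots> \<le> ennreal (C * (10 * \<beta>\<^sup>2)) * (\<integral>\<^sup>+y. ennreal ((cmod (u y * b y))\<^sup>2) \<partial>lborel)"
    unfolding sum_distrib_left[symmetric]
    using T by (intro mult_left_mono sum_nn_integral_disjoint_le) auto
  also have "\<dots> \<le> ennreal (C * (10 * \<beta>\<^sup>2)) * (ennreal (\<beta>\<^sup>2) * sq u)"
    by (intro mult_left_mono sq_mult_accretive[OF b]) auto
  also have "\<dots> = ennreal (C * (10 * \<beta>\<^sup>2) * \<beta>\<^sup>2) * sq u"
    using C by (subst ennreal_mult[of "C * (10 * \<beta>\<^sup>2)"]) (simp_all only: mult.assoc, simp_all)
  \<comment> \<open>Here \<open>4\<close> comes from \<open>C\<close> and \<open>10\<close> from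
    \<open>9 + 1\<close> in the energy. All powers of \<beta> cancel, as scale invariance
    demands.\<close>
  also have "C * (10 * \<beta>\<^sup>2) * \<beta>\<^sup>2 = 40 * \<kappa> ^ 4"
    using \<beta> by (simp add: C_def power2_eq_square power4_eq_xxxx)
  finally show ?thesis by (simp add: q_def)
qed

end

section \<open>Doob's maximal inequality\<close>

definition avg :: "'a::euclidean_space set \<Rightarrow> ('a \<Rightarrow> real) \<Rightarrow> real" where
  "avg J u = (LINT y:J|lborel. u y) / measure lborel J"

text \<open>The member \<open>{}\<close> contributes the value \<open>0\<close> outside the cubes of \<open>F\<close>.\<close>

definition dmax :: "'a::euclidean_space set set \<Rightarrow> ('a \<Rightarrow> real) \<Rightarrow> 'a \<Rightarrow> real" where
  "dmax F u x = Max ((\<lambda>J. avg J u * indicator J x) ` insert {} F)"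

lemma dmax_nonneg: "finite F \<Longrightarrow> 0 \<le> dmax F u x"
  unfolding dmax_def by (rule Max_ge) auto

lemma avg_le_dmax: "finite F \<Longrightarrow> J \<in> F \<Longrightarrow> x \<in> J \<Longrightarrow> avg J u \<le> dmax F u x"
  unfolding dmax_def by (rule Max_ge) (auto intro!: rev_image_eqI[of J])

lemma dmax_measurable:
  assumes "finite F" "F \<subseteq> sets borel"
  shows "dmax F u \<in> borel_measurable borel"
proof -
  have "(\<lambda>x. Max ((\<lambda>J. avg J u * indicator J x) ` insert {} F)) \<in> borel_measurable borel"
    using assms by (intro borel_measurable_Max) auto
  then show ?thesis unfolding dmax_def[abs_def] .
qed

context dyadic_filtration
begin

text \<open>With \<open>M\<close> the running maximum of the averages and \<open>0\<close>, the
  energy is \<open>vol K * (2 * M K * a K - (M K)\<^sup>2)\<close>. It cannot drop: with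
  \<open>M K\<close> frozen it is linear in the average, and raising the maximum happens only up to
  the current average, where the quadratic \<open>2 * m * a - m\<^sup>2\<close> in \<open>m\<close>
  is largest.\<close>

lemma doob_maximal:
  assumes u [measurable]: "u \<in> borel_measurable borel" and F: "finite F" "F \<subseteq> cubes"
  shows "(\<integral>\<^sup>+x. ennreal ((dmax F u x)\<^sup>2) \<partial>lborel) \<le> 4 * (\<integral>\<^sup>+x. ennreal ((u x)\<^sup>2) \<partial>lborel)"
proof (cases "(\<integral>\<^sup>+x. ennreal ((u x)\<^sup>2) \<partial>lborel) < \<infinity>")
  case False
  then show ?thesis by (simp add: ennreal_mult_top less_top[symmetric])
next
  case True
  have int: "set_integrable lborel K u" if "K \<in> cubes" for K
    using that cubes_fin True by (intro set_integrable_square) auto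
  define a where "a K = avg K u" for K
  \<comment> \<open>The maximum runs over the cubes of \<open>F\<close> that contain
    \<open>K\<close>; for nonempty \<open>K\<close> the member \<open>{}\<close> supplies the value
    \<open>0\<close>.\<close>
  define M where "M K = Max ((\<lambda>J. if K \<subseteq> J then a J else 0) ` insert {} F)" for K
  define e where "e K = vol K * (2 * M K * a K - (M K)\<^sup>2)" for K
  have fin: "finite ((\<lambda>J. if K \<subseteq> J then a J else 0) ` insert {} F)" for K using F by auto
  have M0: "0 \<le> M K" if "K \<noteq> {}" for K
    unfolding M_def using F that by (intro Max_ge) auto
  have step: "e K + (\<Sum>J\<in>ch K. 0) \<le> (\<Sum>J\<in>ch K. e J)" if K: "K \<in> cubes" for K
  proof -
    have one: "vol J * (2 * M K * a J - (M K)\<^sup>2) \<le> e J" if J: "J \<in> ch K" for J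
    proof -
      have Jc: "J \<in> cubes" and JK: "J \<subseteq> K" and lev: "level J = level K + 1"
        using ch_in_cubes ch_subset level_ch K J by auto
      have Jne: "J \<noteq> {}" using cubes_nonempty Jc by auto
      have Kne: "K \<noteq> {}" using cubes_nonempty K by auto
      have mono: "M K \<le> M J"
      proof -
        have "M K \<in> (\<lambda>J. if K \<subseteq> J then a J else 0) ` insert {} F"
          unfolding M_def using fin by (intro Max_in) auto
        then consider "M K = 0" | L where "L \<in> F" "K \<subseteq> L" "M K = a L"
          using Kne by (auto split: if_splits)
        then show ?thesis
        proof cases
          case 2
          then have "a L \<in> (\<lambda>L. if J \<subseteq> L then a L else 0) ` insert {} F"
            using JK by (auto intro!: rev_image_eqI[of L])
          then show ?thesis unfolding 2(3) M_def[of J] using fin by (intro Max_ge) auto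
        qed (use M0[OF Jne] in simp)
      qed
      \<comment> \<open>A maximising cube coarser than \<open>J\<close> already contains the parent
        \<open>K\<close>; any other one is \<open>J\<close> itself.\<close>
      moreover have "M J \<le> M K \<or> M J = a J"
      proof -
        have "M J \<in> (\<lambda>L. if J \<subseteq> L then a L else 0) ` insert {} F"
          unfolding M_def using fin by (intro Max_in) auto
        then consider "M J = 0" | L where "L \<in> F" "J \<subseteq> L" "M J = a L"
          using Jne by (auto split: if_splits)
        then show ?thesis
        proof cases
          case 1
          then show ?thesis using M0[OF Kne] by simp
        next
          case 2
          have Lc: "L \<in> cubes" using 2 F by auto
          show ?thesis
          proof (cases "level L \<le> level K")
            case True
            have "K \<subseteq> L" using nested[OF Lc K True] Jne JK 2 by blast
            then have "a L \<in> (\<lambda>L. if K \<subseteq> L then a L else 0) ` insert {} F"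
              using 2(1) by (auto intro!: rev_image_eqI[of L])
            then show ?thesis unfolding 2(3) M_def[of K] using fin by (intro disjI1 Max_ge) auto
          next
            case False
            have "L \<subseteq> J" using nested[OF Jc Lc] False lev Jne 2 by auto
            then show ?thesis using 2 by auto
          qed
        qed
      qed
      ultimately have "(M J)\<^sup>2 - (M K)\<^sup>2 \<le> 2 * (M J - M K) * a J"
      proof (cases "M J = M K")
        case False
        then have "M J = a J" using mono \<open>M J \<le> M K \<or> M J = a J\<close> by linarith
        moreover have "0 \<le> (M J - M K)\<^sup>2" by simp
        ultimately show ?thesis by (simp add: power2_eq_square algebra_simps)
      qed simp
      then have "2 * M K * a J - (M K)\<^sup>2 \<le> 2 * M J * a J - (M J)\<^sup>2" by (simp add: algebra_simps)
      then show ?thesis unfolding e_def by (intro mult_left_mono) auto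
    qed
    have "(\<Sum>J\<in>ch K. vol J * a J) = vol K * a K"
    proof -
      have "vol L * a L = (LINT y:L|lborel. u y)" if "L \<in> cubes" for L
        using vol_pos[OF that] by (simp add: a_def avg_def)
      then show ?thesis using set_integral_ch[OF K int[OF K]] K ch_in_cubes[OF K] by simp
    qed
    moreover have "(\<Sum>J\<in>ch K. vol J * (2 * M K * a J - (M K)\<^sup>2))
        = 2 * M K * (\<Sum>J\<in>ch K. vol J * a J) - (M K)\<^sup>2 * (\<Sum>J\<in>ch K. vol J)"
      by (simp only: right_diff_distrib sum_subtractf sum_distrib_left sum_distrib_right mult_ac)
    ultimately have "e K = (\<Sum>J\<in>ch K. vol J * (2 * M K * a J - (M K)\<^sup>2))"
      using vol_eq_sum_ch[OF K] by (simp add: e_def algebra_simps)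
    then show ?thesis using sum_mono[OF one, of "ch K" "\<lambda>J. J"] by simp
  qed
  obtain T p k where T: "finite T" "T \<subseteq> cubes" "\<And>K. K \<in> T \<Longrightarrow> level K = p"
    and lo: "\<And>K. K \<in> F \<Longrightarrow> p < level K" and hi: "\<And>K. K \<in> F \<Longrightarrow> level K \<le> p + int k"
    and anc: "\<And>K x. K \<in> F \<Longrightarrow> x \<in> K \<Longrightarrow> Q p x \<in> T"
    using finite_forest[OF F] by metis
  define U where "U = descend T k"
  have U: "finite U" "U \<subseteq> cubes" "\<And>K. K \<in> U \<Longrightarrow> level K = p + int k"
    using descend_props[OF T, of k] by (auto simp: U_def)
  \<comment> \<open>No cube of \<open>F\<close> contains a root, because the roots are strictly
    coarser; so the maximum is still \<open>0\<close> there.\<close>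
  have "e K = 0" if "K \<in> T" for K
  proof -
    have Kc: "K \<in> cubes" using that T by auto
    have no: "\<not> K \<subseteq> J" if "J \<in> insert {} F" for J
    proof
      assume KJ: "K \<subseteq> J"
      then have J: "J \<in> F" "J \<in> cubes" using that F cubes_nonempty[OF Kc] by auto
      then have "J \<subseteq> K" using nested[OF Kc J(2)] lo[OF J(1)] T(3)[OF \<open>K \<in> T\<close>] cubes_nonempty[OF Kc] KJ by auto
      then show False using KJ lo[OF J(1)] T(3)[OF \<open>K \<in> T\<close>] by auto
    qed
    have "(\<lambda>J. if K \<subseteq> J then a J else 0) ` insert {} F = (\<lambda>J. 0) ` insert {} F"
      using no by (intro image_cong) auto
    then have "M K = 0" unfolding M_def by (simp only: image_constant_conv) simp
    then show ?thesis unfolding e_def by simp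
  qed
  moreover have "(\<Sum>K\<in>T. e K) + (\<Sum>j<k. \<Sum>J\<in>descend T (Suc j). 0) \<le> (\<Sum>K\<in>descend T k. e K)"
    by (rule forest_telescope[OF step T])
  ultimately have eU: "0 \<le> (\<Sum>K\<in>U. e K)" by (simp add: U_def)
  have "(\<Sum>K\<in>U. e K) \<le> (\<Sum>K\<in>U. vol K * (2 * (a K)\<^sup>2 - (M K)\<^sup>2 / 2))"
    unfolding e_def
  proof (intro sum_mono mult_left_mono)
    fix K
    \<comment> \<open>Young's inequality with this split leaves half of the square of
      \<open>M\<close> against twice that of \<open>a\<close>, hence the constant 4.\<close>
    have "0 \<le> (2 * a K - M K)\<^sup>2 / 2" by simp
    then show "2 * M K * a K - (M K)\<^sup>2 \<le> 2 * (a K)\<^sup>2 - (M K)\<^sup>2 / 2"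
      by (simp add: power2_eq_square algebra_simps)
  qed simp
  also have "\<dots> = (4 * (\<Sum>K\<in>U. vol K * (a K)\<^sup>2) - (\<Sum>K\<in>U. vol K * (M K)\<^sup>2)) / 2"
    by (simp add: right_diff_distrib sum_subtractf sum_distrib_left sum_divide_distrib diff_divide_distrib algebra_simps)
  finally have MU: "(\<Sum>K\<in>U. vol K * (M K)\<^sup>2) \<le> 4 * (\<Sum>K\<in>U. vol K * (a K)\<^sup>2)" using eU by simp
  \<comment> \<open>No cube of \<open>F\<close> is finer than generation \<open>p + k\<close>. On a
    cube of that generation each member of \<open>F\<close> is all or nothing, and
    \<open>dmax\<close> equals \<open>M\<close>.\<close>
  have pw: "ennreal ((dmax F u x)\<^sup>2) \<le> (\<Sum>K\<in>U. ennreal ((M K)\<^sup>2) * indicator K x)" for x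
  proof (cases "\<exists>J\<in>F. x \<in> J")
    case False
    then have "(\<lambda>J. avg J u * indicator J x) ` insert {} F = (\<lambda>J. 0) ` insert {} F"
      by (intro image_cong) auto
    then have "dmax F u x = 0" unfolding dmax_def by (simp only: image_constant_conv) simp
    then show ?thesis by simp
  next
    case True
    then obtain J where J: "J \<in> F" "x \<in> J" by auto
    define K where "K = Q (p + int k) x"
    have Kc: "K \<in> cubes" and xK: "x \<in> K" and lev: "level K = p + int k" using in_Q by (auto simp: K_def)
    have "K \<in> U" unfolding U_def K_def using ancestor_in_descend[of x "Q p x" T k] in_Q anc[OF J] by simp
    have "K \<subseteq> L \<longleftrightarrow> x \<in> L" if "L \<in> insert {} F" for L
      using nested[OF _ Kc, of L] hi[of L] that F xK lev by auto
    then have "(\<lambda>J. avg J u * indicator J x) ` insert {} F = (\<lambda>J. if K \<subseteq> J then a J else 0) ` insert {} F"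
      by (intro image_cong) (auto simp: a_def)
    then have "dmax F u x = M K" unfolding dmax_def M_def by (rule arg_cong)
    then have "ennreal ((dmax F u x)\<^sup>2) = ennreal ((M K)\<^sup>2) * indicator K x" using xK by simp
    also have "\<dots> \<le> (\<Sum>K\<in>U. ennreal ((M K)\<^sup>2) * indicator K x)"
      using \<open>K \<in> U\<close> U(1) by (intro member_le_sum) auto
    finally show ?thesis .
  qed
  have va: "ennreal (vol K * (a K)\<^sup>2) \<le> (\<integral>\<^sup>+y. ennreal ((u y)\<^sup>2) * indicator K y \<partial>lborel)" if K: "K \<in> cubes" for K
  proof -
    have "vol K * (a K)\<^sup>2 = (1 / vol K) * (norm (LINT y:K|lborel. u y))\<^sup>2"
      using vol_pos[OF K] by (simp add: a_def avg_def power_divide power2_eq_square)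
    then have "ennreal (vol K * (a K)\<^sup>2) = ennreal (1 / vol K) * ennreal ((norm (LINT y:K|lborel. u y))\<^sup>2)"
      by (subst ennreal_mult[symmetric]) auto
    also have "\<dots> \<le> ennreal (1 / vol K) * (ennreal (vol K) * (\<integral>\<^sup>+y. ennreal ((norm (u y))\<^sup>2) * indicator K y \<partial>lborel))"
      using set_integral_CS[OF u, of K] K by (intro mult_left_mono) (auto simp: emeasure_cubes)
    also have "\<dots> = (\<integral>\<^sup>+y. ennreal ((norm (u y))\<^sup>2) * indicator K y \<partial>lborel)"
      using vol_pos[OF K] by (simp add: mult.assoc[symmetric] ennreal_mult[symmetric])
    finally show ?thesis by simp
  qed
  have "(\<integral>\<^sup>+x. ennreal ((dmax F u x)\<^sup>2) \<partial>lborel) \<le> (\<integral>\<^sup>+x. (\<Sum>K\<in>U. ennreal ((M K)\<^sup>2) * indicator K x) \<partial>lborel)"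
    by (intro nn_integral_mono pw)
  also have "\<dots> = (\<Sum>K\<in>U. \<integral>\<^sup>+x. ennreal ((M K)\<^sup>2) * indicator K x \<partial>lborel)"
    using U by (intro nn_integral_sum) auto
  also have "\<dots> = (\<Sum>K\<in>U. ennreal (vol K * (M K)\<^sup>2))"
  proof (intro sum.cong refl)
    fix K assume "K \<in> U"
    then have "K \<in> cubes" using U by auto
    then have "(\<integral>\<^sup>+x. ennreal ((M K)\<^sup>2) * indicator K x \<partial>lborel) = ennreal ((M K)\<^sup>2) * ennreal (vol K)"
      by (subst nn_integral_cmult_indicator) (auto simp: emeasure_cubes)
    then show "(\<integral>\<^sup>+x. ennreal ((M K)\<^sup>2) * indicator K x \<partial>lborel) = ennreal (vol K * (M K)\<^sup>2)"
      by (simp add: ennreal_mult mult.commute)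
  qed
  also have "\<dots> = ennreal (\<Sum>K\<in>U. vol K * (M K)\<^sup>2)" by (intro sum_ennreal) auto
  also have "\<dots> \<le> ennreal (4 * (\<Sum>K\<in>U. vol K * (a K)\<^sup>2))" by (rule ennreal_leI[OF MU])
  also have "\<dots> = 4 * (\<Sum>K\<in>U. ennreal (vol K * (a K)\<^sup>2))"
    by (subst sum_ennreal) (auto simp: ennreal_mult[of 4] sum_nonneg)
  also have "\<dots> \<le> 4 * (\<Sum>K\<in>U. \<integral>\<^sup>+y. ennreal ((u y)\<^sup>2) * indicator K y \<partial>lborel)"
    using va U by (intro mult_left_mono sum_mono) auto
  also have "\<dots> \<le> 4 * (\<integral>\<^sup>+y. ennreal ((u y)\<^sup>2) \<partial>lborel)"
  proof (intro mult_left_mono sum_nn_integral_disjoint_le)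
    show "disjoint_family_on (\<lambda>J. J) U"
      using U same_level_disjoint by (auto simp: disjoint_family_on_def subset_iff)
  qed (use U in auto)
  finally show ?thesis .
qed

end

section \<open>The space \<open>L\<^sup>2\<close>\<close>

lemma L2_square_integrable: "f \<in> L2 \<Longrightarrow> integrable lborel (\<lambda>x. (cmod (f x))\<^sup>2)"
  by (simp add: L2_def)

lemma L2_zero [simp]: "(\<lambda>x. 0) \<in> L2"
  by (simp add: L2_def)

lemma L2_add:
  assumes "f \<in> L2" "g \<in> L2" shows "(\<lambda>x. f x + g x) \<in> L2"
proof -
  have "integrable lborel (\<lambda>x. (cmod (f x + g x))\<^sup>2)"
  proof (rule Bochner_Integration.integrable_bound)
    show "integrable lborel (\<lambda>x. 2 * ((cmod (f x))\<^sup>2 + (cmod (g x))\<^sup>2))"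
      using assms by (auto simp: L2_def)
    have "(cmod (u + v))\<^sup>2 \<le> 2 * ((cmod u)\<^sup>2 + (cmod v)\<^sup>2)" for u v
    proof -
      have "(cmod (u + v))\<^sup>2 \<le> (cmod u + cmod v)\<^sup>2" by (intro power_mono norm_triangle_ineq) auto
      also have "\<dots> \<le> 2 * ((cmod u)\<^sup>2 + (cmod v)\<^sup>2)"
        using sum_squares_bound[of "cmod u" "cmod v"] by (simp add: power2_sum)
      finally show ?thesis .
    qed
    then show "AE x in lborel. norm ((cmod (f x + g x))\<^sup>2) \<le> norm (2 * ((cmod (f x))\<^sup>2 + (cmod (g x))\<^sup>2))"
      by auto
  qed (use assms in \<open>auto simp: L2_def\<close>)
  then show ?thesis using assms by (auto simp: L2_def)
qed

lemma L2_cmult: "f \<in> L2 \<Longrightarrow> (\<lambda>x. z * f x) \<in> L2"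
  by (auto simp: L2_def norm_mult power_mult_distrib)

lemma L2_diff: "f \<in> L2 \<Longrightarrow> g \<in> L2 \<Longrightarrow> (\<lambda>x. f x - g x) \<in> L2"
  using L2_add[of f "\<lambda>x. (-1) * g x"] L2_cmult[of g "-1"] by simp

lemma L2_cnj: "f \<in> L2 \<Longrightarrow> (\<lambda>x. cnj (f x)) \<in> L2"
proof -
  have "cnj \<in> borel_measurable borel" by (intro borel_measurable_continuous_onI continuous_intros)
  then show "f \<in> L2 \<Longrightarrow> (\<lambda>x. cnj (f x)) \<in> L2"
    unfolding L2_def by (auto intro: measurable_compose)
qed

lemma L2_sum: "finite F \<Longrightarrow> (\<And>i. i \<in> F \<Longrightarrow> t i \<in> L2) \<Longrightarrow> (\<lambda>x. \<Sum>i\<in>F. t i x) \<in> L2"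
  by (induction F rule: finite_induct) (auto intro: L2_add)

lemma L2_bounded_mult:
  assumes f: "f \<in> L2" and g: "g \<in> borel_measurable borel" "AE x in lborel. cmod (g x) \<le> C * cmod (f x)"
  shows "g \<in> L2"
proof -
  have "integrable lborel (\<lambda>x. (cmod (g x))\<^sup>2)"
  proof (rule Bochner_Integration.integrable_bound)
    show "integrable lborel (\<lambda>x. C\<^sup>2 * (cmod (f x))\<^sup>2)" using f by (auto simp: L2_def)
    show "AE x in lborel. norm ((cmod (g x))\<^sup>2) \<le> norm (C\<^sup>2 * (cmod (f x))\<^sup>2)"
      using g(2)
    proof eventually_elim
      case (elim x)
      then have "(cmod (g x))\<^sup>2 \<le> (C * cmod (f x))\<^sup>2" by (intro power_mono) auto
      then show ?case by (simp add: power_mult_distrib)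
    qed
  qed (use g in auto)
  then show ?thesis using g by (simp add: L2_def)
qed

lemma L2_mult_integrable:
  assumes "f \<in> L2" "g \<in> L2" shows "integrable lborel (\<lambda>x. f x * g x)"
proof (rule Bochner_Integration.integrable_bound)
  show "integrable lborel (\<lambda>x. (cmod (f x))\<^sup>2 + (cmod (g x))\<^sup>2)"
    using assms by (auto simp: L2_def)
  have "u * v \<le> u\<^sup>2 + v\<^sup>2" if "0 \<le> u" "0 \<le> v" for u v :: real
    using sum_squares_bound[of u v] mult_nonneg_nonneg[OF that] by (simp add: mult.assoc)
  then show "AE x in lborel. norm (f x * g x) \<le> norm ((cmod (f x))\<^sup>2 + (cmod (g x))\<^sup>2)"
    by (auto simp: norm_mult)
qed (use assms in \<open>auto simp: L2_def\<close>)

lemma L2_norm_nonneg [simp]: "0 \<le> L2_norm f"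
  unfolding L2_norm_def by (auto intro!: integral_nonneg)

lemma L2_norm_power2: "(L2_norm f)\<^sup>2 = (LINT x|lborel. (cmod (f x))\<^sup>2)"
  unfolding L2_norm_def by (intro real_sqrt_pow2 integral_nonneg) auto

lemma pairing_CS:
  assumes [measurable]: "f \<in> borel_measurable borel" "g \<in> borel_measurable borel"
  shows "ennreal ((cmod (pairing f g))\<^sup>2) \<le> sq f * sq g"
proof -
  have "ennreal (cmod (pairing f g)) \<le> (\<integral>\<^sup>+x. ennreal (cmod (f x * g x)) \<partial>lborel)"
    unfolding pairing_def
    by (cases "integrable lborel (\<lambda>x. f x * g x)")
       (auto intro: integral_norm_bound_ennreal simp: not_integrable_integral_eq)
  also have "\<dots> = (\<integral>\<^sup>+x. ennreal (cmod (f x)) * ennreal (cmod (g x)) \<partial>lborel)"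
    by (simp add: norm_mult ennreal_mult)
  finally have "(ennreal (cmod (pairing f g)))\<^sup>2 \<le> (\<integral>\<^sup>+x. ennreal (cmod (f x)) * ennreal (cmod (g x)) \<partial>lborel)\<^sup>2"
    by (rule power_mono) simp
  also have "\<dots> \<le> (\<integral>\<^sup>+x. (ennreal (cmod (f x)))\<^sup>2 \<partial>lborel) * (\<integral>\<^sup>+x. (ennreal (cmod (g x)))\<^sup>2 \<partial>lborel)"
    by (rule Cauchy_Schwarz_nn_integral) measurable
  finally show ?thesis by (simp add: sq_def ennreal_power)
qed

lemma pairing_bound:
  assumes "f \<in> L2" "g \<in> L2"
  shows "cmod (pairing f g) \<le> L2_norm f * L2_norm g"
proof -
  have "ennreal ((cmod (pairing f g))\<^sup>2) \<le> sq f * sq g"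
    using assms by (intro pairing_CS) (auto simp: L2_def)
  also have "\<dots> = ennreal ((L2_norm f * L2_norm g)\<^sup>2)"
    using assms by (simp add: sq_eq_L2_norm ennreal_mult power_mult_distrib)
  finally have "(cmod (pairing f g))\<^sup>2 \<le> (L2_norm f * L2_norm g)\<^sup>2"
    by (simp add: ennreal_power)
  then show ?thesis by (rule power2_le_imp_le) simp
qed

lemma pairing_add_left:
  "f \<in> L2 \<Longrightarrow> g \<in> L2 \<Longrightarrow> h \<in> L2 \<Longrightarrow> pairing (\<lambda>x. f x + g x) h = pairing f h + pairing g h"
  unfolding pairing_def by (simp add: distrib_right L2_mult_integrable)

lemma pairing_diff_left:
  "f \<in> L2 \<Longrightarrow> g \<in> L2 \<Longrightarrow> h \<in> L2 \<Longrightarrow> pairing (\<lambda>x. f x - g x) h = pairing f h - pairing g h"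
  unfolding pairing_def by (simp add: left_diff_distrib L2_mult_integrable)

lemma pairing_cmult_left: "pairing (\<lambda>x. z * f x) h = z * pairing f h"
  unfolding pairing_def by (simp add: mult.assoc)

lemma pairing_commute: "pairing f g = pairing g f"
  unfolding pairing_def by (simp add: mult.commute)

lemma pairing_sum_left:
  assumes "finite F" "\<And>i. i \<in> F \<Longrightarrow> t i \<in> L2" "h \<in> L2"
  shows "pairing (\<lambda>x. \<Sum>i\<in>F. t i x) h = (\<Sum>i\<in>F. pairing (t i) h)"
  using assms unfolding pairing_def by (simp add: sum_distrib_right L2_mult_integrable)

lemma pairing_cnj: "pairing f (\<lambda>x. cnj (f x)) = of_real ((L2_norm f)\<^sup>2)"
  unfolding pairing_def L2_norm_power2
  by (simp add: complex_norm_square[symmetric] flip: of_real_power)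

lemma L2_norm_cnj: "L2_norm (\<lambda>x. cnj (f x)) = L2_norm f"
  unfolding L2_norm_def by simp

lemma pairing_cong_AE:
  assumes "f \<in> L2" "g \<in> L2" "h \<in> L2" "AE x in lborel. f x = g x"
  shows "pairing f h = pairing g h"
proof -
  have [measurable]: "f \<in> borel_measurable borel" "g \<in> borel_measurable borel" "h \<in> borel_measurable borel"
    using assms by (auto simp: L2_def)
  show ?thesis unfolding pairing_def
    using assms(4) by (intro integral_cong_AE) (auto elim!: eventually_mono)
qed

lemma L2_norm_zero_AE:
  assumes "f \<in> L2" "L2_norm f = 0" shows "AE x in lborel. f x = 0"
proof -
  have "(LINT x|lborel. (cmod (f x))\<^sup>2) = 0" using assms(2) L2_norm_power2[of f] by simp
  then have "AE x in lborel. (cmod (f x))\<^sup>2 = 0"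
    using assms(1) by (subst (asm) integral_nonneg_eq_0_iff_AE) (auto simp: L2_def)
  then show ?thesis by (auto elim!: eventually_mono)
qed

lemma pairing_eq_AE:
  assumes f: "f \<in> L2" and g: "g \<in> L2" and eq: "\<And>h. h \<in> L2 \<Longrightarrow> pairing f h = pairing g h"
  shows "AE x in lborel. f x = g x"
proof -
  define h where "h x = cnj (f x - g x)" for x
  have d: "(\<lambda>x. f x - g x) \<in> L2" by (rule L2_diff[OF f g])
  then have h: "h \<in> L2" unfolding h_def by (rule L2_cnj)
  have "pairing (\<lambda>x. f x - g x) h = 0"
    using pairing_diff_left[OF f g h] eq[OF h] by simp
  then have "L2_norm (\<lambda>x. f x - g x) = 0"
    unfolding h_def by (subst (asm) pairing_cnj) simp
  from L2_norm_zero_AE[OF d this] show ?thesis by simp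
qed

lemma L2_norm_le_by_duality:
  assumes f: "f \<in> L2" and le: "\<And>g. g \<in> L2 \<Longrightarrow> cmod (pairing f g) \<le> M * L2_norm g" and M: "0 \<le> M"
  shows "L2_norm f \<le> M"
proof -
  have "(L2_norm f)\<^sup>2 = cmod (pairing f (\<lambda>x. cnj (f x)))"
    unfolding pairing_cnj by (simp add: norm_power)
  also have "\<dots> \<le> M * L2_norm f" using le[OF L2_cnj[OF f]] by (simp add: L2_norm_cnj)
  finally have *: "L2_norm f * L2_norm f \<le> M * L2_norm f" by (simp add: power2_eq_square)
  show ?thesis
  proof (cases "L2_norm f = 0")
    case False
    then have "0 < L2_norm f" using L2_norm_nonneg[of f] by linarith
    then show ?thesis using * by simp
  qed (use M in simp)
qed

section \<open>Convergence of series in \<open>L2\<close>\<close>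

lemma L2_parallelogram:
  assumes "f \<in> L2" "g \<in> L2"
  shows "(L2_norm (\<lambda>x. f x + g x))\<^sup>2 + (L2_norm (\<lambda>x. f x - g x))\<^sup>2 = 2 * (L2_norm f)\<^sup>2 + 2 * (L2_norm g)\<^sup>2"
proof -
  have "(LINT x|lborel. (cmod (f x + g x))\<^sup>2) + (LINT x|lborel. (cmod (f x - g x))\<^sup>2)
      = (LINT x|lborel. (cmod (f x + g x))\<^sup>2 + (cmod (f x - g x))\<^sup>2)"
    using L2_square_integrable[OF L2_add[OF assms]] L2_square_integrable[OF L2_diff[OF assms]] by simp
  also have "\<dots> = (LINT x|lborel. 2 * (cmod (f x))\<^sup>2 + 2 * (cmod (g x))\<^sup>2)"
    unfolding cmod_power2 by (intro Bochner_Integration.integral_cong) (auto simp: power2_eq_square algebra_simps)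
  also have "\<dots> = 2 * (LINT x|lborel. (cmod (f x))\<^sup>2) + 2 * (LINT x|lborel. (cmod (g x))\<^sup>2)"
    using L2_square_integrable[OF assms(1)] L2_square_integrable[OF assms(2)] by simp
  finally show ?thesis by (simp add: L2_norm_power2)
qed

text \<open>The rate \<open>(1 / 4) ^ j\<close> leaves room for the weights \<open>2 ^ j\<close>:
  the weighted squares of the increments have finite integral, so the sequence converges almost
  everywhere. Fatou's lemma then carries the same rate over to the limit.\<close>

lemma L2_complete:
  fixes S :: "nat \<Rightarrow> 'a::euclidean_space \<Rightarrow> complex"
  assumes S: "\<And>j. S j \<in> L2"
    and cauchy: "\<And>i j. j \<le> i \<Longrightarrow> (L2_norm (\<lambda>x. S i x - S j x))\<^sup>2 \<le> (1 / 4) ^ j"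
  shows "\<exists>T\<in>L2. \<forall>j. (L2_norm (\<lambda>x. T x - S j x))\<^sup>2 \<le> (1 / 4) ^ j"
proof -
  have [measurable]: "S j \<in> borel_measurable borel" for j using S by (simp add: L2_def)
  have sqS: "(\<integral>\<^sup>+x. ennreal ((cmod (S i x - S j x))\<^sup>2) \<partial>lborel) \<le> ennreal ((1 / 4) ^ j)" if "j \<le> i" for i j
    using sq_eq_L2_norm[OF L2_diff[OF S S], of i j] cauchy[OF that] by (simp add: sq_def ennreal_leI)
  define a where "a j x = cmod (S (Suc j) x - S j x)" for j x
  have [measurable]: "a j \<in> borel_measurable borel" for j unfolding a_def by measurable
  have "(\<integral>\<^sup>+x. (\<Sum>j. ennreal (2 ^ j * (a j x)\<^sup>2)) \<partial>lborel) = (\<Sum>j. \<integral>\<^sup>+x. ennreal (2 ^ j * (a j x)\<^sup>2) \<partial>lborel)"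
    by (rule nn_integral_suminf) measurable
  also have "\<dots> \<le> (\<Sum>j. ennreal ((1 / 2) ^ j))"
  proof (intro suminf_le)
    fix j
    have "(\<integral>\<^sup>+x. ennreal (2 ^ j * (a j x)\<^sup>2) \<partial>lborel) = ennreal (2 ^ j) * (\<integral>\<^sup>+x. ennreal ((a j x)\<^sup>2) \<partial>lborel)"
      by (simp add: ennreal_mult nn_integral_cmult)
    also have "\<dots> \<le> ennreal (2 ^ j) * ennreal ((1 / 4) ^ j)"
      unfolding a_def by (intro mult_left_mono sqS) auto
    also have "\<dots> = ennreal ((1 / 2) ^ j)"
    proof (subst ennreal_mult[symmetric])
      have "(2 :: real) ^ j * (1 / 4) ^ j = (2 * (1 / 4)) ^ j" by (simp only: power_mult_distrib)
      then show "ennreal (2 ^ j * (1 / 4) ^ j) = ennreal ((1 / 2) ^ j)" by simp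
    qed auto
    finally show "(\<integral>\<^sup>+x. ennreal (2 ^ j * (a j x)\<^sup>2) \<partial>lborel) \<le> ennreal ((1 / 2) ^ j)" .
  qed auto
  also have "\<dots> < \<infinity>"
  proof -
    have "(\<lambda>j. (1 / 2 :: real) ^ j) sums 2" using geometric_sums[of "1 / 2 :: real"] by simp
    then have "(\<Sum>j. ennreal ((1 / 2) ^ j)) = ennreal 2" by (intro suminf_ennreal_eq) auto
    then show ?thesis by simp
  qed
  finally have "AE x in lborel. (\<Sum>j. ennreal (2 ^ j * (a j x)\<^sup>2)) \<noteq> \<infinity>"
    by (intro nn_integral_PInf_AE less_imp_neq) simp_all
  then have conv: "AE x in lborel. convergent (\<lambda>j. S j x)"
  proof eventually_elim
    case (elim x)
    then have s1: "summable (\<lambda>j. 2 ^ j * (a j x)\<^sup>2)"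
      by (intro summable_suminf_not_top) simp_all
    have s2: "summable (\<lambda>j. (1 / 2 :: real) ^ j)" by simp
    have "summable (\<lambda>j. a j x)"
    proof (rule summable_comparison_test'[OF summable_add[OF s1 s2], of 0])
      fix j
      \<comment> \<open>With \<open>p = 2 ^ j\<close> this converts summability of the weighted
        squares into summability of the increments.\<close>
      have "t \<le> p * t\<^sup>2 + 1 / p" if "0 < p" "0 \<le> t" for p t :: real
      proof -
        have "0 \<le> (p * t - 1)\<^sup>2 + p * t" using that by simp
        then have "p * t \<le> p * (p * t\<^sup>2 + 1 / p)"
          using that by (simp add: power2_eq_square algebra_simps)
        then show ?thesis using that by (simp only: mult_le_cancel_left_pos)
      qed
      from this[of "2 ^ j" "a j x"] show "norm (a j x) \<le> 2 ^ j * (a j x)\<^sup>2 + (1 / 2) ^ j"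
        by (simp add: a_def power_one_over)
    qed
    then have "summable (\<lambda>j. S (Suc j) x - S j x)"
      unfolding a_def by (rule summable_norm_cancel)
    then have "convergent (\<lambda>n. \<Sum>j<n. S (Suc j) x - S j x)" by (simp add: summable_iff_convergent)
    then have "convergent (\<lambda>n. S n x - S 0 x)" by (simp only: sum_lessThan_telescope[of "\<lambda>j. S j x"])
    from convergent_add[OF this convergent_const[of "S 0 x"]] show ?case by simp
  qed
  define T where "T x = lim (\<lambda>j. S j x)" for x
  have [measurable]: "T \<in> borel_measurable borel" unfolding T_def by measurable
  have TS: "(\<integral>\<^sup>+x. ennreal ((cmod (T x - S j x))\<^sup>2) \<partial>lborel) \<le> ennreal ((1 / 4) ^ j)" for j
  proof -
    have "(\<integral>\<^sup>+x. ennreal ((cmod (T x - S j x))\<^sup>2) \<partial>lborel)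
        = (\<integral>\<^sup>+x. liminf (\<lambda>i. ennreal ((cmod (S i x - S j x))\<^sup>2)) \<partial>lborel)"
    proof (rule nn_integral_cong_AE)
      show "AE x in lborel. ennreal ((cmod (T x - S j x))\<^sup>2) = liminf (\<lambda>i. ennreal ((cmod (S i x - S j x))\<^sup>2))"
        using conv
      proof eventually_elim
        case (elim x)
        then have "(\<lambda>i. S i x) \<longlonglongrightarrow> T x" unfolding T_def by (simp add: convergent_LIMSEQ_iff)
        then have "(\<lambda>i. ennreal ((cmod (S i x - S j x))\<^sup>2)) \<longlonglongrightarrow> ennreal ((cmod (T x - S j x))\<^sup>2)"
          by (intro tendsto_intros)
        then show ?case by (intro lim_imp_Liminf[symmetric]) auto
      qed
    qed
    also have "\<dots> \<le> liminf (\<lambda>i. \<integral>\<^sup>+x. ennreal ((cmod (S i x - S j x))\<^sup>2) \<partial>lborel)"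
      by (rule nn_integral_liminf) measurable
    also have "\<dots> \<le> liminf (\<lambda>i. ennreal ((1 / 4) ^ j))"
      using sqS by (intro Liminf_mono eventually_sequentiallyI[of j]) auto
    also have "\<dots> = ennreal ((1 / 4) ^ j)" by (simp add: Liminf_const)
    finally show ?thesis .
  qed
  have TSL: "(\<lambda>x. T x - S j x) \<in> L2" for j
    unfolding L2_iff_sq sq_def
  proof
    show "(\<integral>\<^sup>+x. ennreal ((cmod (T x - S j x))\<^sup>2) \<partial>lborel) < \<infinity>"
      by (rule le_less_trans[OF TS]) simp
  qed measurable
  have "T \<in> L2" using L2_add[OF TSL[of 0] S[of 0]] by simp
  moreover have "(L2_norm (\<lambda>x. T x - S j x))\<^sup>2 \<le> (1 / 4) ^ j" for j
    using TS[of j] sq_eq_L2_norm[OF TSL[of j]] by (simp add: sq_def)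
  ultimately show ?thesis by blast
qed

text \<open>A Hilbert space contains no copy of \<open>c\<^sub>0\<close>: choosing signs by the parallelogram law, infinitely many
  disjoint blocks of norm bounded below would make the signed partial sums unbounded.\<close>

lemma weakly_unconditional_tail:
  fixes t :: "'i \<Rightarrow> 'a::euclidean_space \<Rightarrow> complex"
  assumes t: "\<And>i. i \<in> A \<Longrightarrow> t i \<in> L2"
    and bound: "\<And>g F. g \<in> L2 \<Longrightarrow> finite F \<Longrightarrow> F \<subseteq> A \<Longrightarrow> (\<Sum>i\<in>F. cmod (pairing (t i) g)) \<le> M * L2_norm g"
    and M: "0 \<le> M" and \<epsilon>: "0 < \<epsilon>"
  shows "\<exists>G. finite G \<and> G \<subseteq> A \<and> (\<forall>F. finite F \<and> F \<subseteq> A - G \<longrightarrow> (L2_norm (\<lambda>x. \<Sum>i\<in>F. t i x))\<^sup>2 \<le> \<epsilon>)"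
proof (rule ccontr)
  assume "\<not> ?thesis"
  then have no: "\<exists>F. finite F \<and> F \<subseteq> A - G \<and> \<epsilon> < (L2_norm (\<lambda>x. \<Sum>i\<in>F. t i x))\<^sup>2" if "finite G" "G \<subseteq> A" for G
    using that by (meson not_le)
  define v where "v s F = (\<lambda>x. \<Sum>i\<in>F. s i * t i x)" for s :: "'i \<Rightarrow> complex" and F
  have vL: "v s F \<in> L2" if "finite F" "F \<subseteq> A" for s F
    unfolding v_def using that t by (intro L2_sum L2_cmult) auto
  have vM: "L2_norm (v s F) \<le> M" if F: "finite F" "F \<subseteq> A" and s: "\<And>i. cmod (s i) = 1" for s F
  proof (rule L2_norm_le_by_duality[OF vL[OF F] _ M])
    fix g :: "'a \<Rightarrow> complex" assume g: "g \<in> L2"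
    have "pairing (v s F) g = (\<Sum>i\<in>F. s i * pairing (t i) g)"
      unfolding v_def using F t g
      by (subst pairing_sum_left) (auto simp: pairing_cmult_left intro: L2_cmult)
    then have "cmod (pairing (v s F) g) \<le> (\<Sum>i\<in>F. cmod (s i * pairing (t i) g))"
      by (simp add: norm_sum)
    also have "\<dots> \<le> M * L2_norm g" using bound[OF g F] by (simp add: norm_mult s)
    finally show "cmod (pairing (v s F) g) \<le> M * L2_norm g" .
  qed
  have "\<exists>F s. finite F \<and> F \<subseteq> A \<and> (\<forall>i. cmod (s i) = 1) \<and> real k * \<epsilon> \<le> (L2_norm (v s F))\<^sup>2" for k
  proof (induction k)
    case 0
    show ?case by (rule exI[of _ "{}"], rule exI[of _ "\<lambda>_. 1"]) simp
  next
    case (Suc k)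
    then obtain F s where F: "finite F" "F \<subseteq> A" and s: "\<And>i. cmod (s i) = 1"
      and le: "real k * \<epsilon> \<le> (L2_norm (v s F))\<^sup>2" by blast
    obtain H where H: "finite H" "H \<subseteq> A - F" and big: "\<epsilon> < (L2_norm (\<lambda>x. \<Sum>i\<in>H. t i x))\<^sup>2"
      using no[OF F] by blast
    define w where "w x = (\<Sum>i\<in>H. t i x)" for x
    have w: "w \<in> L2" unfolding w_def using H t by (intro L2_sum) auto
    have ext: "v (\<lambda>i. if i \<in> F then s i else z) (F \<union> H) = (\<lambda>x. v s F x + z * w x)" for z
    proof
      fix x
      have "(\<Sum>i\<in>F \<union> H. (if i \<in> F then s i else z) * t i x)
          = (\<Sum>i\<in>F. (if i \<in> F then s i else z) * t i x) + (\<Sum>i\<in>H. (if i \<in> F then s i else z) * t i x)"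
        using F H by (intro sum.union_disjoint) auto
      also have "(\<Sum>i\<in>H. (if i \<in> F then s i else z) * t i x) = (\<Sum>i\<in>H. z * t i x)"
        using H by (intro sum.cong) auto
      finally show "v (\<lambda>i. if i \<in> F then s i else z) (F \<union> H) x = v s F x + z * w x"
        by (simp add: v_def w_def sum_distrib_left)
    qed
    \<comment> \<open>The two squared norms have the sum of the two single squares as their mean, so
      one of the signs gains at least \<epsilon>.\<close>
    have "real (Suc k) * \<epsilon> \<le> (L2_norm (\<lambda>x. v s F x + 1 * w x))\<^sup>2 \<or>
        real (Suc k) * \<epsilon> \<le> (L2_norm (\<lambda>x. v s F x + (-1) * w x))\<^sup>2"
    proof -
      have "(L2_norm (\<lambda>x. v s F x + w x))\<^sup>2 + (L2_norm (\<lambda>x. v s F x - w x))\<^sup>2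
          = 2 * (L2_norm (v s F))\<^sup>2 + 2 * (L2_norm w)\<^sup>2"
        by (rule L2_parallelogram[OF vL[OF F] w])
      moreover have "\<epsilon> < (L2_norm w)\<^sup>2" using big by (simp add: w_def[abs_def])
      ultimately show ?thesis using le by (simp add: algebra_simps) linarith
    qed
    then obtain z :: complex where z: "cmod z = 1" "real (Suc k) * \<epsilon> \<le> (L2_norm (\<lambda>x. v s F x + z * w x))\<^sup>2"
      by (metis norm_minus_cancel norm_one)
    show ?case
    proof (intro exI conjI)
      show "real (Suc k) * \<epsilon> \<le> (L2_norm (v (\<lambda>i. if i \<in> F then s i else z) (F \<union> H)))\<^sup>2"
        using z(2) by (simp add: ext)
      show "\<forall>i. cmod (if i \<in> F then s i else z) = 1" using s z by auto
    qed (use F H in auto)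
  qed
  moreover obtain k where "M\<^sup>2 < real k * \<epsilon>"
    using reals_Archimedean3[OF \<epsilon>] by blast
  ultimately obtain F s where F: "finite F" "F \<subseteq> A" "\<And>i. cmod (s i) = 1" "M\<^sup>2 < (L2_norm (v s F))\<^sup>2"
    by (meson less_le_trans)
  have "(L2_norm (v s F))\<^sup>2 \<le> M\<^sup>2" using vM[OF F(1-3)] by (intro power_mono) auto
  then show False using F(4) by simp
qed

text \<open>A uniform bound on absolute pairings makes blocks far out small in norm. The partial
  sums along a suitable sequence of finite sets are then norm Cauchy, so completeness yields the
  limit as an actual function.\<close>

lemma weakly_unconditional_sums:
  fixes t :: "'i \<Rightarrow> 'a::euclidean_space \<Rightarrow> complex"
  assumes t: "\<And>i. i \<in> A \<Longrightarrow> t i \<in> L2"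
    and bound: "\<And>g F. g \<in> L2 \<Longrightarrow> finite F \<Longrightarrow> F \<subseteq> A \<Longrightarrow> (\<Sum>i\<in>F. cmod (pairing (t i) g)) \<le> M * L2_norm g"
    and M: "0 \<le> M"
  shows "\<exists>T. weakly_sums t A T"
proof -
  have "\<forall>j. \<exists>G. finite G \<and> G \<subseteq> A \<and> (\<forall>F. finite F \<and> F \<subseteq> A - G \<longrightarrow> (L2_norm (\<lambda>x. \<Sum>i\<in>F. t i x))\<^sup>2 \<le> (1 / 4) ^ j)"
    by (intro allI weakly_unconditional_tail[OF t bound M]) auto
  then obtain H where H: "\<And>j. finite (H j)" "\<And>j. H j \<subseteq> A"
    "\<And>j F. finite F \<Longrightarrow> F \<subseteq> A - H j \<Longrightarrow> (L2_norm (\<lambda>x. \<Sum>i\<in>F. t i x))\<^sup>2 \<le> (1 / 4) ^ j" by metis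
  \<comment> \<open>Unions make the sets increase, so a difference of partial sums is a block
    outside the earlier set.\<close>
  define G where "G j = (\<Union>i\<le>j. H i)" for j
  have G: "finite (G j)" "G j \<subseteq> A" "H j \<subseteq> G j" for j using H by (auto simp: G_def)
  have tail: "(L2_norm (\<lambda>x. \<Sum>i\<in>F. t i x))\<^sup>2 \<le> (1 / 4) ^ j" if "finite F" "F \<subseteq> A - G j" for F j
    using H(3)[of F j] that G(3)[of j] by auto
  define S where "S j x = (\<Sum>i\<in>G j. t i x)" for j x
  have S: "S j \<in> L2" for j unfolding S_def using G(1,2)[of j] t by (intro L2_sum) auto
  have "\<exists>T\<in>L2. \<forall>j. (L2_norm (\<lambda>x. T x - S j x))\<^sup>2 \<le> (1 / 4) ^ j"
  proof (rule L2_complete[OF S])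
    fix i j :: nat assume "j \<le> i"
    then have "G j \<subseteq> G i" by (force simp: G_def)
    then have "S i x - S j x = (\<Sum>k\<in>G i - G j. t k x)" for x
      unfolding S_def using G by (simp add: sum_diff)
    then show "(L2_norm (\<lambda>x. S i x - S j x))\<^sup>2 \<le> (1 / 4) ^ j"
      using tail[of "G i - G j" j] G by auto
  qed
  then obtain T where T: "T \<in> L2" and TS: "\<And>j. (L2_norm (\<lambda>x. T x - S j x))\<^sup>2 \<le> (1 / 4) ^ j" by blast
  have root: "r \<le> (1 / 2) ^ j" if "r\<^sup>2 \<le> (1 / 4) ^ j" for r :: real and j
  proof (rule power2_le_imp_le)
    have "((1 / 2 :: real) ^ j)\<^sup>2 = ((1 / 2)\<^sup>2) ^ j" by (simp only: power_mult[symmetric] mult.commute)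
    then have "((1 / 2 :: real) ^ j)\<^sup>2 = (1 / 4) ^ j" by (simp add: power2_eq_square)
    then show "r\<^sup>2 \<le> ((1 / 2) ^ j)\<^sup>2" using that by simp
  qed simp
  have "((\<lambda>i. pairing (t i) g) has_sum pairing T g) A" if g: "g \<in> L2" for g
    unfolding has_sum_def tendsto_iff
  proof (intro allI impI)
    fix e :: real assume e: "0 < e"
    \<comment> \<open>Two errors arise below, a block and the distance from \<open>S j\<close> to
      \<open>T\<close>, hence the factor 2; the summand \<open>1\<close> covers a zero norm.\<close>
    obtain j where j: "(1 / 2 :: real) ^ j < e / (2 * L2_norm g + 1)"
      using e real_arch_pow_inv[of "e / (2 * L2_norm g + 1)" "1 / 2"] L2_norm_nonneg[of g]
      by (auto simp: add_nonneg_pos)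
    have small: "2 * ((1 / 2) ^ j * L2_norm g) < e"
    proof -
      define r :: real where "r = (1 / 2) ^ j"
      have "r * (2 * L2_norm g + 1) < e"
        using j L2_norm_nonneg[of g] by (simp add: r_def[symmetric] pos_less_divide_eq add_nonneg_pos)
      moreover have "0 < r" by (simp add: r_def)
      ultimately show ?thesis unfolding r_def[symmetric] by (simp add: algebra_simps)
    qed
    show "\<forall>\<^sub>F F in finite_subsets_at_top A. dist (\<Sum>i\<in>F. pairing (t i) g) (pairing T g) < e"
      unfolding eventually_finite_subsets_at_top
    proof (intro exI[of _ "G j"] conjI allI impI)
      fix F assume F: "finite F \<and> G j \<subseteq> F \<and> F \<subseteq> A"
      define R where "R x = (\<Sum>i\<in>F - G j. t i x)" for x
      have R: "R \<in> L2" unfolding R_def using F t by (intro L2_sum) auto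
      have "(\<Sum>i\<in>F. pairing (t i) g) = pairing (\<lambda>x. \<Sum>i\<in>F. t i x) g"
        using F t g by (subst pairing_sum_left) auto
      also have "(\<lambda>x. \<Sum>i\<in>F. t i x) = (\<lambda>x. R x + S j x)"
        unfolding R_def S_def using F G by (simp add: sum_diff)
      also have "pairing \<dots> g = pairing R g + pairing (S j) g"
        by (rule pairing_add_left[OF R S g])
      finally have "(\<Sum>i\<in>F. pairing (t i) g) - pairing T g = pairing R g - pairing (\<lambda>x. T x - S j x) g"
        by (simp add: pairing_diff_left[OF T S g])
      then have "dist (\<Sum>i\<in>F. pairing (t i) g) (pairing T g) \<le> cmod (pairing R g) + cmod (pairing (\<lambda>x. T x - S j x) g)"
        by (simp add: dist_norm norm_triangle_ineq4)
      also have "\<dots> \<le> (1 / 2) ^ j * L2_norm g + (1 / 2) ^ j * L2_norm g"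
      proof (intro add_mono)
        have "L2_norm R \<le> (1 / 2) ^ j"
          unfolding R_def using F by (intro root tail) auto
        then show "cmod (pairing R g) \<le> (1 / 2) ^ j * L2_norm g"
          using pairing_bound[OF R g] by (meson L2_norm_nonneg mult_right_mono order_trans)
        have "L2_norm (\<lambda>x. T x - S j x) \<le> (1 / 2) ^ j" by (rule root[OF TS])
        then show "cmod (pairing (\<lambda>x. T x - S j x) g) \<le> (1 / 2) ^ j * L2_norm g"
          using pairing_bound[OF L2_diff[OF T S] g] by (meson L2_norm_nonneg mult_right_mono order_trans)
      qed
      finally show "dist (\<Sum>i\<in>F. pairing (t i) g) (pairing T g) < e" using small by (simp add: mult.commute)
    qed (use G in auto)
  qed
  then show ?thesis using T t unfolding weakly_sums_def by blast
qed

lemma weakly_sums_norm_le: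
  assumes F: "weakly_sums t A T" and M: "0 \<le> M"
    and bound: "\<And>g F. g \<in> L2 \<Longrightarrow> finite F \<Longrightarrow> F \<subseteq> A \<Longrightarrow> (\<Sum>i\<in>F. cmod (pairing (t i) g)) \<le> M * L2_norm g"
  shows "L2_norm T \<le> M"
proof (rule L2_norm_le_by_duality[OF _ _ M])
  show "T \<in> L2" using F by (simp add: weakly_sums_def)
  fix g :: "'b \<Rightarrow> complex" assume g: "g \<in> L2"
  have "((\<lambda>F. \<Sum>i\<in>F. pairing (t i) g) \<longlongrightarrow> pairing T g) (finite_subsets_at_top A)"
    using F g unfolding weakly_sums_def has_sum_def by blast
  then have "((\<lambda>F. cmod (\<Sum>i\<in>F. pairing (t i) g)) \<longlongrightarrow> cmod (pairing T g)) (finite_subsets_at_top A)"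
    by (rule tendsto_norm)
  then show "cmod (pairing T g) \<le> M * L2_norm g"
  proof (rule tendsto_upperbound)
    show "\<forall>\<^sub>F F in finite_subsets_at_top A. cmod (\<Sum>i\<in>F. pairing (t i) g) \<le> M * L2_norm g"
      unfolding eventually_finite_subsets_at_top
      using bound[OF g] by (intro exI[of _ "{}"]) (auto intro: order_trans[OF norm_sum])
  qed simp
qed

section \<open>Two parameters\<close>

lemma measurable_pair_borel:
  fixes f :: "'a::euclidean_space \<times> 'b::euclidean_space \<Rightarrow> 'c::topological_space"
  shows "f \<in> borel_measurable borel \<Longrightarrow> f \<in> borel_measurable (borel \<Otimes>\<^sub>M borel)"
  by (simp add: borel_prod)

lemma nn_integral_lborel_fst:
  fixes g :: "'a::euclidean_space \<times> 'b::euclidean_space \<Rightarrow> ennreal"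
  assumes "g \<in> borel_measurable borel"
  shows "(\<integral>\<^sup>+x. g x \<partial>lborel) = (\<integral>\<^sup>+y. \<integral>\<^sup>+z. g (y, z) \<partial>lborel \<partial>lborel)"
  using lborel.nn_integral_fst[of g "lborel :: 'a measure"] assms
  by (simp add: lborel_prod)

lemma nn_integral_lborel_snd:
  fixes g :: "'a::euclidean_space \<times> 'b::euclidean_space \<Rightarrow> ennreal"
  assumes "g \<in> borel_measurable borel"
  shows "(\<integral>\<^sup>+x. g x \<partial>lborel) = (\<integral>\<^sup>+z. \<integral>\<^sup>+y. g (y, z) \<partial>lborel \<partial>lborel)"
  using lborel_pair.nn_integral_snd[of g] assms
  by (simp add: lborel_prod)

text \<open>Integrating out one variable reduces a coefficient against a tensor product to a
  one-parameter coefficient of the slice, see \<open>pairing_tensor1\<close>.\<close>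

definition slice1 :: "('a::euclidean_space \<times> 'b::euclidean_space \<Rightarrow> complex) \<Rightarrow> ('a \<Rightarrow> complex) \<Rightarrow> 'b \<Rightarrow> complex" where
  "slice1 f \<phi> z = pairing (\<lambda>y. f (y, z)) \<phi>"

definition slice2 :: "('a::euclidean_space \<times> 'b::euclidean_space \<Rightarrow> complex) \<Rightarrow> ('b \<Rightarrow> complex) \<Rightarrow> 'a \<Rightarrow> complex" where
  "slice2 f \<psi> y = pairing (\<lambda>z. f (y, z)) \<psi>"

lemma sq_slices1:
  assumes "f \<in> borel_measurable borel"
  shows "sq f = (\<integral>\<^sup>+z. sq (\<lambda>y. f (y, z)) \<partial>lborel)"
  using assms unfolding sq_def by (subst nn_integral_lborel_snd) auto

lemma sq_slices2:
  assumes "f \<in> borel_measurable borel"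
  shows "sq f = (\<integral>\<^sup>+y. sq (\<lambda>z. f (y, z)) \<partial>lborel)"
  using assms unfolding sq_def by (subst nn_integral_lborel_fst) auto

lemma slice_measurable:
  fixes f :: "'a::euclidean_space \<times> 'b::euclidean_space \<Rightarrow> 'c::topological_space"
  assumes "f \<in> borel_measurable borel"
  shows "(\<lambda>y. f (y, z)) \<in> borel_measurable borel" "(\<lambda>z. f (y, z)) \<in> borel_measurable borel"
proof -
  note [measurable] = measurable_pair_borel[OF assms]
  show "(\<lambda>y. f (y, z)) \<in> borel_measurable borel" "(\<lambda>z. f (y, z)) \<in> borel_measurable borel"
    by measurable
qed

lemma slice1_measurable:
  assumes f: "f \<in> borel_measurable borel" and [measurable]: "\<phi> \<in> borel_measurable borel"
  shows "slice1 f \<phi> \<in> borel_measurable borel"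
proof -
  note [measurable] = measurable_pair_borel[OF f]
  show ?thesis unfolding slice1_def[abs_def] pairing_def by measurable
qed

lemma slice2_measurable:
  assumes f: "f \<in> borel_measurable borel" and [measurable]: "\<psi> \<in> borel_measurable borel"
  shows "slice2 f \<psi> \<in> borel_measurable borel"
proof -
  note [measurable] = measurable_pair_borel[OF f]
  show ?thesis unfolding slice2_def[abs_def] pairing_def by measurable
qed

lemma AE_slice1_L2:
  assumes f: "f \<in> L2" shows "AE z in lborel. (\<lambda>y. f (y, z)) \<in> L2"
proof -
  note [measurable] = measurable_pair_borel[OF L2_measurable[OF f]]
  have "(\<integral>\<^sup>+z. sq (\<lambda>y. f (y, z)) \<partial>lborel) < \<infinity>"
    using f sq_slices1[of f] by (simp add: L2_iff_sq)
  then have "AE z in lborel. sq (\<lambda>y. f (y, z)) \<noteq> \<infinity>"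
    by (intro nn_integral_PInf_AE) (auto simp: sq_def)
  then show ?thesis
    using slice_measurable(1)[OF L2_measurable[OF f]] by (auto simp: L2_iff_sq less_top elim!: eventually_mono)
qed

lemma AE_slice2_L2:
  assumes f: "f \<in> L2" shows "AE y in lborel. (\<lambda>z. f (y, z)) \<in> L2"
proof -
  note [measurable] = measurable_pair_borel[OF L2_measurable[OF f]]
  have "(\<integral>\<^sup>+y. sq (\<lambda>z. f (y, z)) \<partial>lborel) < \<infinity>"
    using f sq_slices2[of f] by (simp add: L2_iff_sq)
  then have "AE y in lborel. sq (\<lambda>z. f (y, z)) \<noteq> \<infinity>"
    by (intro nn_integral_PInf_AE) (auto simp: sq_def)
  then show ?thesis
    using slice_measurable(2)[OF L2_measurable[OF f]] by (auto simp: L2_iff_sq less_top elim!: eventually_mono)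
qed

lemma slice1_L2:
  assumes f: "f \<in> L2" and \<phi>: "\<phi> \<in> L2" shows "slice1 f \<phi> \<in> L2"
proof -
  note fm = L2_measurable[OF f] and \<phi>m = L2_measurable[OF \<phi>]
  note [measurable] = measurable_pair_borel[OF fm]
  have "sq (slice1 f \<phi>) \<le> (\<integral>\<^sup>+z. sq (\<lambda>y. f (y, z)) * sq \<phi> \<partial>lborel)"
    unfolding sq_def[of "slice1 f \<phi>"] slice1_def
    by (intro nn_integral_mono pairing_CS slice_measurable fm \<phi>m)
  also have "\<dots> = sq f * sq \<phi>"
    unfolding sq_slices1[OF fm] by (rule nn_integral_multc) (simp add: sq_def)
  also have "\<dots> < \<infinity>" using f \<phi> by (simp add: L2_iff_sq ennreal_mult_less_top)
  finally show ?thesis using slice1_measurable[OF fm \<phi>m] by (simp add: L2_iff_sq)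
qed

lemma slice2_L2:
  assumes f: "f \<in> L2" and \<psi>: "\<psi> \<in> L2" shows "slice2 f \<psi> \<in> L2"
proof -
  note fm = L2_measurable[OF f] and \<psi>m = L2_measurable[OF \<psi>]
  note [measurable] = measurable_pair_borel[OF fm]
  have "sq (slice2 f \<psi>) \<le> (\<integral>\<^sup>+y. sq (\<lambda>z. f (y, z)) * sq \<psi> \<partial>lborel)"
    unfolding sq_def[of "slice2 f \<psi>"] slice2_def
    by (intro nn_integral_mono pairing_CS slice_measurable fm \<psi>m)
  also have "\<dots> = sq f * sq \<psi>"
    unfolding sq_slices2[OF fm] by (rule nn_integral_multc) (simp add: sq_def)
  also have "\<dots> < \<infinity>" using f \<psi> by (simp add: L2_iff_sq ennreal_mult_less_top)
  finally show ?thesis using slice2_measurable[OF fm \<psi>m] by (simp add: L2_iff_sq)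
qed

lemma tensor_apply [simp]: "tensor \<phi> \<psi> (y, z) = \<phi> y * \<psi> z"
  by (simp add: tensor_def)

lemma tensor_measurable:
  fixes \<phi> :: "'a::euclidean_space \<Rightarrow> complex" and \<psi> :: "'b::euclidean_space \<Rightarrow> complex"
  assumes [measurable]: "\<phi> \<in> borel_measurable borel" "\<psi> \<in> borel_measurable borel"
  shows "tensor \<phi> \<psi> \<in> borel_measurable borel"
proof -
  have "tensor \<phi> \<psi> \<in> borel_measurable (borel \<Otimes>\<^sub>M borel)" unfolding tensor_def by measurable
  then show ?thesis by (simp add: borel_prod)
qed

lemma tensor_L2:
  fixes \<phi> :: "'a::euclidean_space \<Rightarrow> complex" and \<psi> :: "'b::euclidean_space \<Rightarrow> complex"
  assumes \<phi>: "\<phi> \<in> L2" and \<psi>: "\<psi> \<in> L2"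
  shows "tensor \<phi> \<psi> \<in> L2"
proof -
  have [measurable]: "\<phi> \<in> borel_measurable borel" "\<psi> \<in> borel_measurable borel"
    using assms by (auto simp: L2_def)
  have m: "tensor \<phi> \<psi> \<in> borel_measurable borel" by (rule tensor_measurable) auto
  have "sq (tensor \<phi> \<psi>) = (\<integral>\<^sup>+y. \<integral>\<^sup>+z. ennreal ((cmod (\<phi> y))\<^sup>2) * ennreal ((cmod (\<psi> z))\<^sup>2) \<partial>lborel \<partial>lborel)"
    unfolding sq_slices2[OF m] by (simp add: sq_def norm_mult power_mult_distrib ennreal_mult)
  also have "\<dots> = sq \<phi> * sq \<psi>" by (simp add: sq_def nn_integral_cmult nn_integral_multc)
  finally show ?thesis using m assms by (simp add: L2_iff_sq ennreal_mult_less_top)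
qed

lemma
  fixes f :: "'a::euclidean_space \<times> 'b::euclidean_space \<Rightarrow> complex"
  assumes f: "f \<in> L2" and \<phi>: "\<phi> \<in> L2" and \<psi>: "\<psi> \<in> L2"
  shows pairing_tensor1: "pairing f (tensor \<phi> \<psi>) = pairing (slice1 f \<phi>) \<psi>"
    and pairing_tensor2: "pairing f (tensor \<phi> \<psi>) = pairing (slice2 f \<psi>) \<phi>"
proof -
  define h where "h y z = f (y, z) * (\<phi> y * \<psi> z)" for y z
  have h: "case_prod h = (\<lambda>x. f x * tensor \<phi> \<psi> x)" by (auto simp: h_def fun_eq_iff)
  have int: "integrable (lborel \<Otimes>\<^sub>M lborel) (case_prod h)"
    unfolding h lborel_prod by (rule L2_mult_integrable[OF f tensor_L2[OF \<phi> \<psi>]])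
  have eq: "pairing f (tensor \<phi> \<psi>) = integral\<^sup>L (lborel \<Otimes>\<^sub>M lborel) (case_prod h)"
    unfolding h lborel_prod pairing_def ..
  have "(LINT z|lborel. LINT y|lborel. h y z) = pairing (slice1 f \<phi>) \<psi>"
    unfolding pairing_def slice1_def h_def by (simp add: mult.assoc[symmetric])
  then show "pairing f (tensor \<phi> \<psi>) = pairing (slice1 f \<phi>) \<psi>"
    using lborel_pair.integral_snd[OF int] eq by simp
  have "(LINT y|lborel. LINT z|lborel. h y z) = pairing (slice2 f \<psi>) \<phi>"
    unfolding pairing_def slice2_def h_def by (simp add: mult_ac)
  then show "pairing f (tensor \<phi> \<psi>) = pairing (slice2 f \<psi>) \<phi>"
    using lborel_pair.integral_fst[OF int] eq by simp
qed

text \<open>Exchanging the variables makes the estimates proved for wavelets in the first variable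
  available in the second.\<close>

definition flip :: "('a \<times> 'b \<Rightarrow> complex) \<Rightarrow> 'b \<times> 'a \<Rightarrow> complex" where
  "flip f = (\<lambda>(z, y). f (y, z))"

lemma
  fixes f :: "'a::euclidean_space \<times> 'b::euclidean_space \<Rightarrow> complex"
  assumes f: "f \<in> L2"
  shows flip_L2: "flip f \<in> L2" and sq_flip: "sq (flip f) = sq f"
proof -
  note fm = L2_measurable[OF f]
  note [measurable] = measurable_pair_borel[OF fm]
  have "flip f \<in> borel_measurable (borel \<Otimes>\<^sub>M borel)" unfolding flip_def by measurable
  then have m: "flip f \<in> borel_measurable borel" by (simp add: borel_prod)
  show "sq (flip f) = sq f" unfolding sq_slices2[OF m] sq_slices1[OF fm] by (simp add: flip_def)
  then show "flip f \<in> L2" using m f by (simp add: L2_iff_sq)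
qed

lemma pairing_flip_tensor:
  assumes f: "f \<in> L2" and \<phi>: "\<phi> \<in> L2" and \<psi>: "\<psi> \<in> L2"
  shows "pairing (flip f) (tensor \<psi> \<phi>) = pairing f (tensor \<phi> \<psi>)"
  unfolding pairing_tensor1[OF flip_L2[OF f] \<psi> \<phi>] pairing_tensor2[OF f \<phi> \<psi>]
  by (simp add: slice1_def[abs_def] slice2_def[abs_def] flip_def)

text \<open>Iterating maximal functions by Fubini needs joint measurability, which is stronger than
  measurability of each slice.\<close>

lemma dmax_measurable_pair:
  fixes w :: "'c::euclidean_space \<times> 'a::euclidean_space \<Rightarrow> real"
  assumes w: "w \<in> borel_measurable borel" and F: "finite F" "F \<subseteq> sets borel"
  shows "(\<lambda>(y, z). dmax F (\<lambda>z'. w (y, z')) z) \<in> borel_measurable borel"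
proof -
  note [measurable] = measurable_pair_borel[OF w]
  have "(\<lambda>x. Max ((\<lambda>J. avg J (\<lambda>z'. w (fst x, z')) * indicator J (snd x)) ` insert {} F))
      \<in> borel_measurable (borel \<Otimes>\<^sub>M borel)"
  proof (intro borel_measurable_Max)
    fix J assume "J \<in> insert {} F"
    then have [measurable]: "J \<in> sets borel" using F by auto
    show "(\<lambda>x. avg J (\<lambda>z'. w (fst x, z')) * indicator J (snd x)) \<in> borel_measurable (borel \<Otimes>\<^sub>M borel)"
      unfolding avg_def set_lebesgue_integral_def by measurable
  qed (use F in auto)
  then show ?thesis by (simp add: dmax_def case_prod_beta' borel_prod)
qed

section \<open>Wavelets and bumps in one variable\<close>

context dyadic_filtration
begin

definition wav :: "('a \<Rightarrow> complex) \<Rightarrow> 'a set \<Rightarrow> 'a \<Rightarrow> complex" where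
  "wav b J x = b x * (indicator J x / (LINT y:J|lborel. b y) - indicator (par J) x / (LINT y:par J|lborel. b y))"

text \<open>Pairing with it is the adapted average over \<open>J\<close>, and it is also the
  function that \<open>E_J\<close> transposed multiplies by an integral over \<open>J\<close>. Both
  averaging operators of the paraproduct are expressed through it.\<close>

definition bump :: "('a \<Rightarrow> complex) \<Rightarrow> 'a set \<Rightarrow> 'a \<Rightarrow> complex" where
  "bump b J x = b x * indicator J x / (LINT y:J|lborel. b y)"

lemma bump_L2:
  assumes b: "accretive \<kappa> \<beta> b" and J: "J \<in> cubes" shows "bump b J \<in> L2"
proof -
  have [measurable]: "b \<in> borel_measurable borel" using b by (simp add: accretive_def)
  have ind: "(\<lambda>x. indicator J x :: complex) \<in> L2"
    using J cubes_fin[OF J]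
    by (auto simp: L2_iff_sq sq_def indicator_def if_distrib cong: if_cong
        intro!: le_less_trans[OF eq_refl[OF trans[OF nn_integral_cong nn_integral_indicator[of J]]]])
  show ?thesis
  proof (rule L2_bounded_mult[OF ind, where C = "\<beta> / cmod (LINT y:J|lborel. b y)"])
    show "bump b J \<in> borel_measurable borel" unfolding bump_def[abs_def] using J by measurable
    show "AE x in lborel. cmod (bump b J x) \<le> \<beta> / cmod (LINT y:J|lborel. b y) * cmod (indicator J x)"
      using b unfolding accretive_def bump_def
      by (auto elim!: eventually_mono split: split_indicator simp: norm_divide divide_right_mono)
  qed
qed

lemma wav_bump: "wav b J x = bump b J x - bump b (par J) x"
  by (simp add: wav_def bump_def right_diff_distrib)

lemma wav_L2: "accretive \<kappa> \<beta> b \<Longrightarrow> J \<in> cubes \<Longrightarrow> wav b J \<in> L2"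
  unfolding wav_bump[abs_def] by (intro L2_diff bump_L2) auto

lemma pairing_bump: "pairing u (bump b J) = (LINT y:J|lborel. u y * b y) / (LINT y:J|lborel. b y)"
proof -
  have "(\<lambda>x. u x * bump b J x) = (\<lambda>x. (indicator J x *\<^sub>R (u x * b x)) / (LINT y:J|lborel. b y))"
    by (auto simp: bump_def split: split_indicator)
  then show ?thesis unfolding pairing_def set_lebesgue_integral_def by simp
qed

lemma osc_eq_pairing:
  assumes b: "accretive \<kappa> \<beta> b" and u: "u \<in> L2" and J: "J \<in> cubes"
  shows "osc b J u = pairing u (wav b J)"
  using pairing_diff_left[OF bump_L2[OF b J] bump_L2[OF b par_in_cubes[OF J]] u]
  unfolding wav_bump[abs_def] osc_def pairing_commute[of u] pairing_bump[symmetric] by simp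

text \<open>The one-parameter estimate holds on almost every slice and is integrated over the other
  variable.\<close>

lemma slice_square:
  fixes f :: "'a \<times> 'b::euclidean_space \<Rightarrow> complex"
  assumes b: "accretive \<kappa> \<beta> b" and f: "f \<in> L2" and F: "finite F" "F \<subseteq> cubes"
  shows "(\<Sum>J\<in>F. ennreal (vol J) * sq (slice1 f (wav b J))) \<le> ennreal (40 * \<kappa> ^ 4) * sq f"
proof -
  note fm = L2_measurable[OF f]
  note [measurable] = measurable_pair_borel[OF fm]
  have [measurable]: "slice1 f (wav b J) \<in> borel_measurable borel" if "J \<in> F" for J
    using slice1_L2[OF f wav_L2[OF b]] F that by (auto simp: L2_def)
  have "(\<Sum>J\<in>F. ennreal (vol J) * sq (slice1 f (wav b J)))
      = (\<integral>\<^sup>+z. (\<Sum>J\<in>F. ennreal (vol J * (cmod (slice1 f (wav b J) z))\<^sup>2)) \<partial>lborel)"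
    unfolding sq_def by (subst nn_integral_sum) (auto simp: nn_integral_cmult ennreal_mult)
  also have "\<dots> \<le> (\<integral>\<^sup>+z. ennreal (40 * \<kappa> ^ 4) * sq (\<lambda>y. f (y, z)) \<partial>lborel)"
  proof (rule nn_integral_mono_AE)
    show "AE z in lborel. (\<Sum>J\<in>F. ennreal (vol J * (cmod (slice1 f (wav b J) z))\<^sup>2))
      \<le> ennreal (40 * \<kappa> ^ 4) * sq (\<lambda>y. f (y, z))"
      using AE_slice1_L2[OF f]
    proof eventually_elim
      case (elim z)
      have "slice1 f (wav b J) z = osc b J (\<lambda>y. f (y, z))" if "J \<in> F" for J
        using osc_eq_pairing[OF b elim] F that by (auto simp: slice1_def)
      then show ?case
        using square_estimate[OF b slice_measurable(1)[OF fm] F, of z] by simp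
    qed
  qed
  also have "\<dots> = ennreal (40 * \<kappa> ^ 4) * sq f"
    unfolding sq_slices1[OF fm] by (rule nn_integral_cmult) (simp add: sq_def)
  finally show ?thesis .
qed

text \<open>The essential bound of \<open>b\<close> in the numerator and its accretivity in the
  denominator combine into the single factor \<kappa>. This is what lets ordinary maximal functions
  control adapted averages.\<close>

lemma pairing_bump_le_avg:
  assumes b: "accretive \<kappa> \<beta> b" and u: "u \<in> L2" and J: "J \<in> cubes"
  shows "cmod (pairing u (bump b J)) \<le> \<kappa> * avg J (\<lambda>y. cmod (u y))"
proof -
  have \<beta>: "0 < \<beta>" and \<kappa>: "1 \<le> \<kappa>" using b by (auto simp: accretive_def)
  have "set_integrable lborel J u"
    using u cubes_fin[OF J] J by (intro set_integrable_square) (auto simp: L2_iff_sq sq_def)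
  then have ui: "integrable lborel (\<lambda>y. indicator J y *\<^sub>R cmod (u y))"
    using integrable_norm by (fastforce simp: set_integrable_def)
  have "cmod (LINT y:J|lborel. u y * b y) \<le> (LINT y|lborel. norm (indicator J y *\<^sub>R (u y * b y)))"
    unfolding set_lebesgue_integral_def by (rule integral_norm_bound)
  also have "\<dots> \<le> (LINT y|lborel. \<beta> * (indicator J y *\<^sub>R cmod (u y)))"
  proof (rule integral_mono_AE)
    show "integrable lborel (\<lambda>y. norm (indicator J y *\<^sub>R (u y * b y)))"
      using L2_set_integrable[OF b u J] unfolding set_integrable_def by (rule integrable_norm)
    show "AE y in lborel. norm (indicator J y *\<^sub>R (u y * b y)) \<le> \<beta> * (indicator J y *\<^sub>R cmod (u y))"
      using b unfolding accretive_def
      by (auto elim!: eventually_mono split: split_indicator simp: norm_mult mult.commute[of "cmod (u _)"] intro!: mult_right_mono)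
  qed (use ui in simp)
  also have "\<dots> = \<beta> * (avg J (\<lambda>y. cmod (u y)) * vol J)"
    using vol_pos[OF J] by (simp add: avg_def set_lebesgue_integral_def)
  finally have n: "cmod (LINT y:J|lborel. u y * b y) \<le> (\<beta> * vol J) * avg J (\<lambda>y. cmod (u y))"
    by (simp add: mult_ac)
  have pos: "0 < cmod (LINT y:J|lborel. b y)" using accretive_integral_nonzero[OF b J] by simp
  have "0 \<le> avg J (\<lambda>y. cmod (u y))"
    unfolding avg_def set_lebesgue_integral_def by (auto intro!: divide_nonneg_nonneg integral_nonneg)
  then have "cmod (LINT y:J|lborel. u y * b y) \<le> (\<kappa> * cmod (LINT y:J|lborel. b y)) * avg J (\<lambda>y. cmod (u y))"
    using b J by (intro order_trans[OF n] mult_right_mono) (auto simp: accretive_def)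
  then show ?thesis unfolding pairing_bump norm_divide using pos by (simp add: field_simps)
qed

end

section \<open>Two-parameter square, hybrid and maximal estimates\<close>

locale dyadic_pair = A: dyadic_filtration Q\<^sub>1 \<mu>\<^sub>1 d\<^sub>1 + B: dyadic_filtration Q\<^sub>2 \<mu>\<^sub>2 d\<^sub>2
  for Q\<^sub>1 :: "int \<Rightarrow> 'a::euclidean_space \<Rightarrow> 'a set" and \<mu>\<^sub>1 d\<^sub>1
    and Q\<^sub>2 :: "int \<Rightarrow> 'b::euclidean_space \<Rightarrow> 'b set" and \<mu>\<^sub>2 d\<^sub>2
begin

text \<open>Iteration: the estimate in the second variable is applied to the slice of
  \<open>f\<close> against each first wavelet, then \<open>slice_square\<close> sums over the
  first.\<close>

lemma square_estimate2:
  assumes b1: "A.accretive \<kappa>\<^sub>1 \<beta>\<^sub>1 b1" and b2: "B.accretive \<kappa>\<^sub>2 \<beta>\<^sub>2 b2" and f: "f \<in> L2"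
    and F: "finite F" "F \<subseteq> A.cubes \<times> B.cubes"
  shows "(\<Sum>(J, L)\<in>F. A.vol J * B.vol L * (cmod (pairing f (tensor (A.wav b1 J) (B.wav b2 L))))\<^sup>2)
    \<le> 40 * \<kappa>\<^sub>1 ^ 4 * (40 * \<kappa>\<^sub>2 ^ 4) * (L2_norm f)\<^sup>2"
proof -
  define F1 where "F1 = fst ` F"
  define F2 where "F2 = snd ` F"
  have F1: "finite F1" "F1 \<subseteq> A.cubes" and F2: "finite F2" "F2 \<subseteq> B.cubes"
    using F by (auto simp: F1_def F2_def)
  have \<kappa>: "1 \<le> \<kappa>\<^sub>1" "1 \<le> \<kappa>\<^sub>2" using b1 b2 by (auto simp: A.accretive_def B.accretive_def)
  define p where "p J L = pairing f (tensor (A.wav b1 J) (B.wav b2 L))" for J L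
  have p: "p J L = B.osc b2 L (slice1 f (A.wav b1 J))" if "J \<in> F1" "L \<in> F2" for J L
  proof -
    have J: "J \<in> A.cubes" and L: "L \<in> B.cubes" using that F1 F2 by auto
    show ?thesis unfolding p_def
      using pairing_tensor1[OF f A.wav_L2[OF b1 J] B.wav_L2[OF b2 L]]
        B.osc_eq_pairing[OF b2 slice1_L2[OF f A.wav_L2[OF b1 J]] L] by simp
  qed
  \<comment> \<open>Enlarging \<open>F\<close> to the product of its projections separates the two
    summations.\<close>
  have "(\<Sum>(J, L)\<in>F. A.vol J * B.vol L * (cmod (p J L))\<^sup>2)
      \<le> (\<Sum>(J, L)\<in>F1 \<times> F2. A.vol J * B.vol L * (cmod (p J L))\<^sup>2)"
    using F1 F2 by (intro sum_mono2) (auto simp: F1_def F2_def image_iff Bex_def)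
  also have "\<dots> = (\<Sum>J\<in>F1. A.vol J * (\<Sum>L\<in>F2. B.vol L * (cmod (p J L))\<^sup>2))"
    by (simp add: sum.cartesian_product[symmetric] sum_distrib_left mult.assoc)
  finally have "ennreal (\<Sum>(J, L)\<in>F. A.vol J * B.vol L * (cmod (p J L))\<^sup>2)
      \<le> ennreal (\<Sum>J\<in>F1. A.vol J * (\<Sum>L\<in>F2. B.vol L * (cmod (p J L))\<^sup>2))"
    by (rule ennreal_leI)
  also have "\<dots> = (\<Sum>J\<in>F1. ennreal (A.vol J) * (\<Sum>L\<in>F2. ennreal (B.vol L * (cmod (p J L))\<^sup>2)))"
    by (subst sum_ennreal[symmetric]) (auto simp: ennreal_mult sum_nonneg sum_ennreal[symmetric] intro!: mult_nonneg_nonneg sum_nonneg)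
  also have "\<dots> \<le> (\<Sum>J\<in>F1. ennreal (A.vol J) * (ennreal (40 * \<kappa>\<^sub>2 ^ 4) * sq (slice1 f (A.wav b1 J))))"
  proof (intro sum_mono mult_left_mono)
    fix J assume J: "J \<in> F1"
    have "slice1 f (A.wav b1 J) \<in> borel_measurable borel"
      using slice1_L2[OF f A.wav_L2[OF b1]] F1 J by (auto simp: L2_def)
    from B.square_estimate[OF b2 this F2]
    show "(\<Sum>L\<in>F2. ennreal (B.vol L * (cmod (p J L))\<^sup>2)) \<le> ennreal (40 * \<kappa>\<^sub>2 ^ 4) * sq (slice1 f (A.wav b1 J))"
      using p[OF J] by simp
  qed simp
  also have "\<dots> = ennreal (40 * \<kappa>\<^sub>2 ^ 4) * (\<Sum>J\<in>F1. ennreal (A.vol J) * sq (slice1 f (A.wav b1 J)))"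
    by (simp add: sum_distrib_left mult_ac)
  also have "\<dots> \<le> ennreal (40 * \<kappa>\<^sub>2 ^ 4) * (ennreal (40 * \<kappa>\<^sub>1 ^ 4) * sq f)"
    by (intro mult_left_mono A.slice_square[OF b1 f F1]) simp
  also have "\<dots> = ennreal (40 * \<kappa>\<^sub>1 ^ 4 * (40 * \<kappa>\<^sub>2 ^ 4) * (L2_norm f)\<^sup>2)"
    using \<kappa> by (simp only: sq_eq_L2_norm[OF f]) (subst ennreal_mult[symmetric] | simp add: mult_ac)+
  finally show ?thesis unfolding p_def using \<kappa> by (subst (asm) ennreal_le_iff) auto
qed

text \<open>For fixed \<open>J\<close> the integrand is a product of a function of \<open>y\<close>
  and one of \<open>z\<close>. The integral in \<open>y\<close> gives the volume of the parent,
  hence \<open>d\<^sub>1\<close>; Doob's inequality in \<open>z\<close> gives 4;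
  \<open>slice_square\<close> sums over \<open>J\<close> with the constant 40.\<close>

lemma hybrid_estimate:
  assumes b1: "A.accretive \<kappa> \<beta> b1" and f: "f \<in> L2"
    and F1: "finite F1" "F1 \<subseteq> A.cubes" and F2: "finite F2" "F2 \<subseteq> B.cubes"
  shows "(\<integral>\<^sup>+(y, z). (\<Sum>J\<in>F1. ennreal (indicator (A.par J) y *
        (dmax F2 (\<lambda>z. cmod (slice1 f (A.wav b1 J) z)) z)\<^sup>2)) \<partial>lborel)
    \<le> ennreal (160 * d\<^sub>1 * \<kappa> ^ 4) * sq f"
proof -
  define v where "v J z = cmod (slice1 f (A.wav b1 J) z)" for J z
  have [measurable]: "v J \<in> borel_measurable borel" if "J \<in> F1" for J
  proof -
    have [measurable]: "slice1 f (A.wav b1 J) \<in> borel_measurable borel"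
      using slice1_L2[OF f A.wav_L2[OF b1]] F1 that by (auto simp: L2_def)
    show ?thesis unfolding v_def[abs_def] by measurable
  qed
  have [measurable]: "dmax F2 (v J) \<in> borel_measurable borel" for J
    using F2 by (intro dmax_measurable) auto
  have ei: "ennreal (indicator S y * t) = indicator S y * ennreal t" for S :: "'a set" and y t
    by (auto split: split_indicator)
  have d: "1 < d\<^sub>1" and \<kappa>: "1 \<le> \<kappa>" using A.d_gt_1 b1 by (auto simp: A.accretive_def)
  have "(\<integral>\<^sup>+(y, z). (\<Sum>J\<in>F1. ennreal (indicator (A.par J) y * (dmax F2 (v J) z)\<^sup>2)) \<partial>lborel)
    = (\<integral>\<^sup>+y. \<integral>\<^sup>+z. (\<Sum>J\<in>F1. indicator (A.par J) y * ennreal ((dmax F2 (v J) z)\<^sup>2)) \<partial>lborel \<partial>lborel)"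
  proof (subst nn_integral_lborel_fst)
    have "(\<lambda>(y, z). (\<Sum>J\<in>F1. ennreal (indicator (A.par J) y * (dmax F2 (v J) z)\<^sup>2))) \<in> borel_measurable (borel \<Otimes>\<^sub>M borel)"
      unfolding case_prod_beta'
    proof (intro borel_measurable_sum)
      fix J assume "J \<in> F1"
      then have [measurable]: "A.par J \<in> sets borel" using F1 by auto
      show "(\<lambda>x. ennreal (indicator (A.par J) (fst x) * (dmax F2 (v J) (snd x))\<^sup>2)) \<in> borel_measurable (borel \<Otimes>\<^sub>M borel)"
        by measurable
    qed
    then show "(\<lambda>(y, z). (\<Sum>J\<in>F1. ennreal (indicator (A.par J) y * (dmax F2 (v J) z)\<^sup>2))) \<in> borel_measurable borel"
      by (simp add: borel_prod)
  qed (simp only: prod.case ei)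
  also have "\<dots> = (\<Sum>J\<in>F1. ennreal (A.vol (A.par J)) * (\<integral>\<^sup>+z. ennreal ((dmax F2 (v J) z)\<^sup>2) \<partial>lborel))"
  proof -
    have pb: "A.par J \<in> sets borel" if "J \<in> F1" for J using that F1 by auto
    have "(\<integral>\<^sup>+z. (\<Sum>J\<in>F1. indicator (A.par J) y * ennreal ((dmax F2 (v J) z)\<^sup>2)) \<partial>lborel)
        = (\<Sum>J\<in>F1. indicator (A.par J) y * (\<integral>\<^sup>+z. ennreal ((dmax F2 (v J) z)\<^sup>2) \<partial>lborel))" for y
    proof (subst nn_integral_sum)
      show "(\<Sum>J\<in>F1. \<integral>\<^sup>+z. indicator (A.par J) y * ennreal ((dmax F2 (v J) z)\<^sup>2) \<partial>lborel)
        = (\<Sum>J\<in>F1. indicator (A.par J) y * (\<integral>\<^sup>+z. ennreal ((dmax F2 (v J) z)\<^sup>2) \<partial>lborel))"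
        by (intro sum.cong refl nn_integral_cmult) measurable
    qed measurable
    moreover have "(\<integral>\<^sup>+y. (\<Sum>J\<in>F1. indicator (A.par J) y * (\<integral>\<^sup>+z. ennreal ((dmax F2 (v J) z)\<^sup>2) \<partial>lborel)) \<partial>lborel)
        = (\<Sum>J\<in>F1. ennreal (A.vol (A.par J)) * (\<integral>\<^sup>+z. ennreal ((dmax F2 (v J) z)\<^sup>2) \<partial>lborel))"
    proof (subst nn_integral_sum)
      show "(\<Sum>J\<in>F1. \<integral>\<^sup>+y. indicator (A.par J) y * (\<integral>\<^sup>+z. ennreal ((dmax F2 (v J) z)\<^sup>2) \<partial>lborel) \<partial>lborel)
        = (\<Sum>J\<in>F1. ennreal (A.vol (A.par J)) * (\<integral>\<^sup>+z. ennreal ((dmax F2 (v J) z)\<^sup>2) \<partial>lborel))"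
        using pb F1 by (intro sum.cong refl) (subst nn_integral_multc, auto simp: A.emeasure_cubes subset_iff)
    qed (use pb in simp)
    ultimately show ?thesis by simp
  qed
  also have "\<dots> \<le> (\<Sum>J\<in>F1. ennreal (d\<^sub>1 * A.vol J) * (4 * (\<integral>\<^sup>+z. ennreal ((v J z)\<^sup>2) \<partial>lborel)))"
    using F1 F2 by (intro sum_mono mult_mono B.doob_maximal) (auto simp: A.vol_par subset_iff)
  also have "\<dots> = ennreal (4 * d\<^sub>1) * (\<Sum>J\<in>F1. ennreal (A.vol J) * sq (slice1 f (A.wav b1 J)))"
    using d by (simp add: sum_distrib_left sq_def v_def ennreal_mult mult_ac)
  also have "\<dots> \<le> ennreal (4 * d\<^sub>1) * (ennreal (40 * \<kappa> ^ 4) * sq f)"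
    by (intro mult_left_mono A.slice_square[OF b1 f F1]) simp
  also have "\<dots> = ennreal (160 * d\<^sub>1 * \<kappa> ^ 4) * sq f"
    using d \<kappa> by (subst mult.assoc[symmetric]) (simp add: ennreal_mult[symmetric] mult_ac)
  finally show ?thesis by (simp add: v_def[abs_def])
qed

text \<open>Doob's inequality in each variable in turn; each application costs a factor 4.\<close>

lemma strong_maximal:
  assumes w: "w \<in> borel_measurable borel" and F1: "finite F1" "F1 \<subseteq> A.cubes" and F2: "finite F2" "F2 \<subseteq> B.cubes"
  shows "(\<lambda>(y, z). dmax F1 (\<lambda>y'. dmax F2 (\<lambda>z'. w (y', z')) z) y) \<in> borel_measurable borel"
    and "(\<integral>\<^sup>+(y, z). ennreal ((dmax F1 (\<lambda>y'. dmax F2 (\<lambda>z'. w (y', z')) z) y)\<^sup>2) \<partial>lborel)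
      \<le> 16 * (\<integral>\<^sup>+x. ennreal ((w x)\<^sup>2) \<partial>lborel)"
proof -
  note wm = measurable_pair_borel[OF w]
  note [measurable] = wm
  define g where "g y z = dmax F2 (\<lambda>z'. w (y, z')) z" for y z
  have gb: "(\<lambda>(y, z). g y z) \<in> borel_measurable borel"
    unfolding g_def using F2 by (intro dmax_measurable_pair w) auto
  have gm [measurable]: "(\<lambda>(y, z). g y z) \<in> borel_measurable (borel \<Otimes>\<^sub>M borel)"
    by (rule measurable_pair_borel[OF gb])
  have "(\<lambda>(z, y). g y z) \<in> borel_measurable (borel \<Otimes>\<^sub>M borel)" by measurable
  then have gs: "(\<lambda>(z, y). g y z) \<in> borel_measurable borel" by (simp add: borel_prod)
  have "(\<lambda>(z, y). dmax F1 (\<lambda>y'. (\<lambda>(z, y). g y z) (z, y')) y) \<in> borel_measurable borel"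
    using F1 by (intro dmax_measurable_pair gs) auto
  then have hm [measurable]: "(\<lambda>(z, y). dmax F1 (\<lambda>y'. g y' z) y) \<in> borel_measurable (borel \<Otimes>\<^sub>M borel)"
    by (intro measurable_pair_borel) simp
  have "(\<lambda>(y, z). dmax F1 (\<lambda>y'. g y' z) y) \<in> borel_measurable (borel \<Otimes>\<^sub>M borel)" by measurable
  then have hb: "(\<lambda>(y, z). dmax F1 (\<lambda>y'. g y' z) y) \<in> borel_measurable borel" by (simp add: borel_prod)
  then show "(\<lambda>(y, z). dmax F1 (\<lambda>y'. dmax F2 (\<lambda>z'. w (y', z')) z) y) \<in> borel_measurable borel"
    by (simp add: g_def)
  have "(\<lambda>x. ennreal (((\<lambda>(y, z). dmax F1 (\<lambda>y'. g y' z) y) x)\<^sup>2)) \<in> borel_measurable borel"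
    using hb by measurable
  then have hb2: "(\<lambda>(y, z). ennreal ((dmax F1 (\<lambda>y'. g y' z) y)\<^sup>2)) \<in> borel_measurable borel"
    by (simp add: case_prod_beta')
  have "(\<integral>\<^sup>+(y, z). ennreal ((dmax F1 (\<lambda>y'. g y' z) y)\<^sup>2) \<partial>lborel)
      = (\<integral>\<^sup>+z. \<integral>\<^sup>+y. ennreal ((dmax F1 (\<lambda>y'. g y' z) y)\<^sup>2) \<partial>lborel \<partial>lborel)"
    by (subst nn_integral_lborel_snd[OF hb2]) simp
  also have "\<dots> \<le> (\<integral>\<^sup>+z. 4 * (\<integral>\<^sup>+y. ennreal ((g y z)\<^sup>2) \<partial>lborel) \<partial>lborel)"
    using F1 by (intro nn_integral_mono A.doob_maximal) auto
  also have "\<dots> = 4 * (\<integral>\<^sup>+z. \<integral>\<^sup>+y. ennreal ((g y z)\<^sup>2) \<partial>lborel \<partial>lborel)"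
    by (rule nn_integral_cmult) measurable
  also have "(\<integral>\<^sup>+z. \<integral>\<^sup>+y. ennreal ((g y z)\<^sup>2) \<partial>lborel \<partial>lborel) = (\<integral>\<^sup>+y. \<integral>\<^sup>+z. ennreal ((g y z)\<^sup>2) \<partial>lborel \<partial>lborel)"
    by (rule lborel_pair.Fubini') measurable
  also have "\<dots> \<le> (\<integral>\<^sup>+y. 4 * (\<integral>\<^sup>+z. ennreal ((w (y, z))\<^sup>2) \<partial>lborel) \<partial>lborel)"
    unfolding g_def using F2 by (intro nn_integral_mono B.doob_maximal) auto
  also have "\<dots> = 4 * (\<integral>\<^sup>+y. \<integral>\<^sup>+z. ennreal ((w (y, z))\<^sup>2) \<partial>lborel \<partial>lborel)"
    by (rule nn_integral_cmult) measurable
  also have "(\<integral>\<^sup>+y. \<integral>\<^sup>+z. ennreal ((w (y, z))\<^sup>2) \<partial>lborel \<partial>lborel) = (\<integral>\<^sup>+x. ennreal ((w x)\<^sup>2) \<partial>lborel)"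
    using w by (subst nn_integral_lborel_fst) auto
  finally show "(\<integral>\<^sup>+(y, z). ennreal ((dmax F1 (\<lambda>y'. dmax F2 (\<lambda>z'. w (y', z')) z) y)\<^sup>2) \<partial>lborel)
      \<le> 16 * (\<integral>\<^sup>+x. ennreal ((w x)\<^sup>2) \<partial>lborel)"
    by (simp add: g_def mult.assoc[symmetric] mult_left_mono)
qed

end

section \<open>Carleson embedding\<close>

text \<open>A discrete layer-cake formula: the smallest value \<open>t\<close> is removed from all
  \<open>m i\<close> at once, the packing bound on the whole union pays for this layer, and an index
  with value \<open>t\<close> drops out. Each further layer needs the packing bound for a smaller
  subfamily, which is why it is assumed for all of them.\<close>

lemma sum_le_nn_integral_of_packing:
  fixes P :: "'i \<Rightarrow> 'a::euclidean_space set" and c m :: "'i \<Rightarrow> real"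
  assumes "finite F" and "0 \<le> A"
    and "\<And>i. i \<in> F \<Longrightarrow> P i \<in> sets borel" "\<And>i. i \<in> F \<Longrightarrow> emeasure lborel (P i) < \<infinity>"
    and "\<And>i. i \<in> F \<Longrightarrow> 0 \<le> c i" "\<And>i. i \<in> F \<Longrightarrow> 0 \<le> m i"
    and "\<And>G. G \<subseteq> F \<Longrightarrow> (\<Sum>i\<in>G. c i) \<le> A * measure lborel (\<Union>i\<in>G. P i)"
    and "N \<in> borel_measurable borel" "\<And>i x. i \<in> F \<Longrightarrow> x \<in> P i \<Longrightarrow> ennreal (m i) \<le> N x"
  shows "ennreal (\<Sum>i\<in>F. c i * m i) \<le> ennreal A * (\<integral>\<^sup>+x. N x \<partial>lborel)"
  using assms
proof (induction "card F" arbitrary: F m N)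
  case 0
  then show ?case by simp
next
  case (Suc n)
  note [measurable] = Suc.prems(8)
  have ne: "F \<noteq> {}" using Suc.hyps(2) by auto
  define t where "t = Min (m ` F)"
  have t: "t \<le> m i" if "i \<in> F" for i unfolding t_def using that Suc.prems(1) by auto
  have "t \<in> m ` F" unfolding t_def using ne Suc.prems(1) by (intro Min_in) auto
  then obtain k where k: "k \<in> F" "m k = t" by auto
  have t0: "0 \<le> t" using k Suc.prems(6) by auto
  define U where "U = (\<Union>i\<in>F. P i)"
  have Um [measurable]: "U \<in> sets borel" unfolding U_def using Suc.prems(1,3) by (intro sets.finite_UN) auto
  have "emeasure lborel U \<le> (\<Sum>i\<in>F. emeasure lborel (P i))"
    unfolding U_def using Suc.prems(1,3) by (intro emeasure_subadditive_finite) auto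
  also have "\<dots> < \<infinity>" using Suc.prems(1,4) by (auto intro!: ennreal_sum_less_top[THEN iffD2])
  finally have Ufin: "emeasure lborel U = ennreal (measure lborel U)"
    by (intro emeasure_eq_ennreal_measure) auto
  \<comment> \<open>The majorant left after removing the layer. The subtraction loses nothing on
    \<open>U\<close>, where \<open>N\<close> is at least \<open>t\<close>.\<close>
  define N' where "N' x = (N x - ennreal t) * indicator U x" for x
  have N'm [measurable]: "N' \<in> borel_measurable borel" unfolding N'_def[abs_def] by measurable
  have IH: "ennreal (\<Sum>i\<in>F - {k}. c i * (m i - t)) \<le> ennreal A * (\<integral>\<^sup>+x. N' x \<partial>lborel)"
  proof (rule Suc.hyps(1))
    show "n = card (F - {k})" using Suc.hyps(2) k Suc.prems(1) by simp
    fix i x assume i: "i \<in> F - {k}" and x: "x \<in> P i"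
    then have "x \<in> U" by (auto simp: U_def)
    moreover have "ennreal (m i - t) = ennreal (m i) - ennreal t" using t0 by (simp add: ennreal_minus)
    moreover have "ennreal (m i) - ennreal t \<le> N x - ennreal t"
      using i x by (intro ennreal_minus_mono Suc.prems(9)) auto
    ultimately show "ennreal (m i - t) \<le> N' x" by (simp add: N'_def)
  next
    show "(\<Sum>i\<in>G. c i) \<le> A * measure lborel (\<Union>i\<in>G. P i)" if "G \<subseteq> F - {k}" for G
      using that by (intro Suc.prems(7)) auto
  qed (use Suc.prems t in auto)
  have "(\<Sum>i\<in>F. c i * m i) = t * (\<Sum>i\<in>F. c i) + (\<Sum>i\<in>F. c i * (m i - t))"
    by (simp add: sum_distrib_left sum.distrib[symmetric] algebra_simps)
  also have "(\<Sum>i\<in>F. c i * (m i - t)) = (\<Sum>i\<in>F - {k}. c i * (m i - t))"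
    using k Suc.prems(1) by (subst sum.remove[of F k]) auto
  finally have "ennreal (\<Sum>i\<in>F. c i * m i) = ennreal (t * (\<Sum>i\<in>F. c i)) + ennreal (\<Sum>i\<in>F - {k}. c i * (m i - t))"
    using t0 t Suc.prems(5) by (simp only:) (intro ennreal_plus mult_nonneg_nonneg sum_nonneg, auto)
  also have "\<dots> \<le> ennreal (t * (A * measure lborel U)) + ennreal A * (\<integral>\<^sup>+x. N' x \<partial>lborel)"
    using t0 Suc.prems(7)[of F] by (intro add_mono IH ennreal_leI mult_left_mono) (auto simp: U_def)
  also have "\<dots> = ennreal A * ((\<integral>\<^sup>+x. ennreal t * indicator U x \<partial>lborel) + (\<integral>\<^sup>+x. N' x \<partial>lborel))"
    using t0 Suc.prems(2) by (simp add: nn_integral_cmult_indicator Ufin ennreal_mult distrib_left mult_ac)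
  also have "\<dots> = ennreal A * (\<integral>\<^sup>+x. (ennreal t * indicator U x + N' x) \<partial>lborel)"
    by (subst nn_integral_add) auto
  also have "\<dots> \<le> ennreal A * (\<integral>\<^sup>+x. N x \<partial>lborel)"
  proof (intro mult_left_mono nn_integral_mono)
    fix x
    show "ennreal t * indicator U x + N' x \<le> N x"
    proof (cases "x \<in> U")
      case True
      then obtain i where i: "i \<in> F" "x \<in> P i" by (auto simp: U_def)
      have "ennreal t \<le> N x" using t[OF i(1)] Suc.prems(9)[OF i] by (metis ennreal_leI order_trans)
      then show ?thesis using True by (simp add: N'_def add_diff_inverse_ennreal)
    qed (simp add: N'_def)
  qed simp
  finally show ?case .
qed

text \<open>Keeps inner maximal functions bounded, hence integrable over cubes, when maximal
  functions are iterated.\<close>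

lemma dmax_le:
  assumes F: "finite F" and c: "0 \<le> c" and u: "\<And>x. \<bar>u x\<bar> \<le> c" "u \<in> borel_measurable borel"
    and Fb: "\<And>J. J \<in> F \<Longrightarrow> J \<in> sets borel \<and> 0 < measure lborel J \<and> emeasure lborel J < \<infinity>"
  shows "dmax F u x \<le> c"
  unfolding dmax_def
proof (rule Max.boundedI)
  fix t assume "t \<in> (\<lambda>J. avg J u * indicator J x) ` insert {} F"
  then obtain J where "J \<in> insert {} F" "t = avg J u * indicator J x" by blast
  then consider "t = 0" | J where "J \<in> F" "t = avg J u" by (cases "x \<in> J") auto
  then show "t \<le> c"
  proof cases
    case 2
    have J: "J \<in> sets borel" "0 < measure lborel J" "emeasure lborel J < \<infinity>" using Fb[OF 2(1)] by auto
    have "integrable lborel (\<lambda>x. c * indicator J x :: real)" using J by auto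
    moreover from this have "integrable lborel (\<lambda>x. indicator J x * u x)"
    proof (rule Bochner_Integration.integrable_bound)
      have "norm (indicator J x * u x) \<le> norm (c * indicator J x)" for x
        using u(1)[of x] c by (auto split: split_indicator)
      then show "AE x in lborel. norm (indicator J x * u x) \<le> norm (c * indicator J x)" by simp
    qed (use u(2) J in measurable)
    moreover have "indicator J y * u y \<le> c * indicator J y" for y
      using u(1)[of y] c by (auto split: split_indicator)
    ultimately have "(LINT y|lborel. indicator J y * u y) \<le> (LINT y|lborel. c * indicator J y)"
      by (intro integral_mono)
    then have "(LINT y:J|lborel. u y) \<le> (LINT y|lborel. c * indicator J y)"
      by (simp add: set_lebesgue_integral_def)
    then show ?thesis using 2 J by (simp add: avg_def pos_divide_le_eq)
  qed (use c in simp)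
qed (use F in auto)

lemma ennreal_sum_mult:
  assumes "\<And>i. i \<in> G \<Longrightarrow> 0 \<le> x i" "\<And>i. i \<in> G \<Longrightarrow> 0 \<le> y i"
  shows "ennreal (\<Sum>i\<in>G. x i * y i) = (\<Sum>i\<in>G. ennreal (x i) * ennreal (y i))"
proof -
  have "(\<Sum>i\<in>G. ennreal (x i) * ennreal (y i)) = (\<Sum>i\<in>G. ennreal (x i * y i))"
    using assms by (intro sum.cong refl ennreal_mult[symmetric])
  also have "\<dots> = ennreal (\<Sum>i\<in>G. x i * y i)" using assms by (intro sum_ennreal) auto
  finally show ?thesis by simp
qed

text \<open>The left side is the tangent line at \<open>l\<close> of the convex function
  \<open>1 / w\<^sup>2\<close>. Cleared of denominators, the gap is
  \<open>(w - l)\<^sup>2 * (2 * w + l)\<close>.\<close>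

lemma inverse_square_tangent:
  assumes "0 < w" "0 < (l::real)"
  shows "3 / l\<^sup>2 - 2 * w / l ^ 3 \<le> 1 / w\<^sup>2"
proof -
  have "0 \<le> (w - l)\<^sup>2 * (2 * w + l)" using assms by simp
  then have "3 * l * w\<^sup>2 - 2 * w ^ 3 \<le> l ^ 3" by (simp add: power2_eq_square power3_eq_cube algebra_simps)
  then have "(3 * l * w\<^sup>2 - 2 * w ^ 3) / (l ^ 3 * w\<^sup>2) \<le> l ^ 3 / (l ^ 3 * w\<^sup>2)"
    using assms by (intro divide_right_mono) auto
  moreover have "(3 * l * w\<^sup>2 - 2 * w ^ 3) / (l ^ 3 * w\<^sup>2) = 3 / l\<^sup>2 - 2 * w / l ^ 3"
    using assms by (simp add: field_simps power2_eq_square power3_eq_cube)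
  ultimately show ?thesis using assms by simp
qed

text \<open>Integrating the tangent line taken at the mean \<open>l\<close> gives
  \<open>measure lborel R / l\<^sup>2\<close>. The lower bound \<delta> makes
  \<open>1 / w\<^sup>2\<close> integrable on \<open>R\<close> and \<open>l\<close> positive.\<close>

lemma jensen_inverse_square:
  fixes w :: "'a::euclidean_space \<Rightarrow> real"
  assumes R [measurable]: "R \<in> sets borel" and Rfin: "emeasure lborel R < \<infinity>" "0 < measure lborel R"
    and w [measurable]: "w \<in> borel_measurable borel"
    and wint: "set_integrable lborel R w" and \<delta>: "0 < \<delta>" and low: "\<And>x. x \<in> R \<Longrightarrow> \<delta> \<le> w x"
  defines "l \<equiv> (LINT x:R|lborel. w x) / measure lborel R"
  shows "0 < l" and "ennreal (measure lborel R / l\<^sup>2) \<le> (\<integral>\<^sup>+x. ennreal (indicator R x / (w x)\<^sup>2) \<partial>lborel)"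
proof -
  have ri: "integrable lborel (indicator R :: _ \<Rightarrow> real)" using R Rfin by auto
  have wi: "integrable lborel (\<lambda>x. indicator R x * w x)" using wint by (simp add: set_integrable_def)
  have W: "(LINT x|lborel. indicator R x * w x) = l * measure lborel R"
    using Rfin by (simp add: l_def set_lebesgue_integral_def)
  have "(LINT x|lborel. \<delta> * indicator R x) \<le> (LINT x|lborel. indicator R x * w x)"
  proof (rule integral_mono)
    show "\<delta> * indicator R x \<le> indicator R x * w x" for x
      using low[of x] by (auto split: split_indicator)
  qed (use ri wi in simp_all)
  then have "\<delta> * measure lborel R \<le> l * measure lborel R" using W by simp
  then have "\<delta> \<le> l" using Rfin by simp
  then show l: "0 < l" using \<delta> by linarith
  have ii: "integrable lborel (\<lambda>x. indicator R x / (w x)\<^sup>2)"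
  proof (rule Bochner_Integration.integrable_bound)
    show "integrable lborel (\<lambda>x. (1 / \<delta>\<^sup>2) * indicator R x)" using ri by simp
    have "norm (indicator R x / (w x)\<^sup>2) \<le> norm ((1 / \<delta>\<^sup>2) * indicator R x)" for x
    proof (cases "x \<in> R")
      case True
      have "\<delta>\<^sup>2 \<le> (w x)\<^sup>2" using low[OF True] \<delta> by (intro power_mono) auto
      then have "1 / (w x)\<^sup>2 \<le> 1 / \<delta>\<^sup>2" using \<delta> by (intro frac_le) auto
      then show ?thesis using True by simp
    qed simp
    then show "AE x in lborel. norm (indicator R x / (w x)\<^sup>2) \<le> norm ((1 / \<delta>\<^sup>2) * indicator R x)" by simp
  qed measurable
  have "(LINT x|lborel. (3 / l\<^sup>2) * indicator R x - (2 / l ^ 3) * (indicator R x * w x))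
      \<le> (LINT x|lborel. indicator R x / (w x)\<^sup>2)"
  proof (rule integral_mono)
    show "integrable lborel (\<lambda>x. (3 / l\<^sup>2) * indicator R x - (2 / l ^ 3) * (indicator R x * w x))"
      using ri wi by simp
    show "integrable lborel (\<lambda>x. indicator R x / (w x)\<^sup>2)" by (rule ii)
    fix x
    show "(3 / l\<^sup>2) * indicator R x - (2 / l ^ 3) * (indicator R x * w x) \<le> indicator R x / (w x)\<^sup>2"
    proof (cases "x \<in> R")
      case True
      have "0 < w x" using low[OF True] \<delta> by linarith
      from inverse_square_tangent[OF this l] show ?thesis using True by simp
    qed simp
  qed
  also have "(LINT x|lborel. (3 / l\<^sup>2) * indicator R x - (2 / l ^ 3) * (indicator R x * w x))
      = (3 / l\<^sup>2) * measure lborel R - (2 / l ^ 3) * (l * measure lborel R)"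
    using ri wi W by (subst Bochner_Integration.integral_diff) simp_all
  also have "\<dots> = measure lborel R / l\<^sup>2"
    using l by (simp add: power2_eq_square power3_eq_cube)
  finally have "ennreal (measure lborel R / l\<^sup>2) \<le> ennreal (LINT x|lborel. indicator R x / (w x)\<^sup>2)"
    by (rule ennreal_leI)
  also have "\<dots> = (\<integral>\<^sup>+x. ennreal (indicator R x / (w x)\<^sup>2) \<partial>lborel)"
    by (rule nn_integral_eq_integral[OF ii, symmetric]) simp
  finally show "ennreal (measure lborel R / l\<^sup>2) \<le> (\<integral>\<^sup>+x. ennreal (indicator R x / (w x)\<^sup>2) \<partial>lborel)" .
qed

section \<open>Carleson embedding on rectangles and the bilinear form\<close>

context dyadic_pair
begin

abbreviation vol2 :: "'a set \<times> 'b set \<Rightarrow> real" where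
  "vol2 i \<equiv> A.vol (fst i) * B.vol (snd i)"

text \<open>Indices are pairs of children, but the wavelets live on the parents; packing conditions
  and square functions therefore refer to the parent rectangle.\<close>

definition rect :: "'a set \<times> 'b set \<Rightarrow> ('a \<times> 'b) set" where
  "rect i = A.par (fst i) \<times> B.par (snd i)"

lemma
  assumes "i \<in> A.cubes \<times> B.cubes"
  shows rect_borel: "rect i \<in> sets borel"
    and rect_fin: "emeasure lborel (rect i) < \<infinity>"
    and vol_rect: "measure lborel (rect i) = A.vol (A.par (fst i)) * B.vol (B.par (snd i))"
proof -
  have c: "A.par (fst i) \<in> A.cubes" "B.par (snd i) \<in> B.cubes" using assms by auto
  then have s: "A.par (fst i) \<in> sets borel" "B.par (snd i) \<in> sets borel" by auto
  have "rect i \<in> sets (borel \<Otimes>\<^sub>M borel)" unfolding rect_def using s by (rule pair_measureI)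
  then show "rect i \<in> sets borel" by (simp only: borel_prod)
  have "emeasure lborel (rect i) = ennreal (A.vol (A.par (fst i)) * B.vol (B.par (snd i)))"
    unfolding rect_def lborel_prod[symmetric] using s c
    by (subst lborel.emeasure_pair_measure_Times) (auto simp: A.emeasure_cubes B.emeasure_cubes ennreal_mult)
  then show "emeasure lborel (rect i) < \<infinity>" "measure lborel (rect i) = A.vol (A.par (fst i)) * B.vol (B.par (snd i))"
    by (auto simp: measure_def)
qed

text \<open>By Fubini, the inner average over \<open>V\<close> is below the inner maximal function
  at \<open>z\<close>, and the average of that over \<open>K\<close> is below the outer one at
  \<open>y\<close>. The bound \<open>c\<close> supplies the integrability.\<close>

lemma avg_rect_le_strong_maximal:
  assumes w: "w \<in> borel_measurable borel" "\<And>x. 0 \<le> w x" "\<And>x. w x \<le> c"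
    and F1: "finite F1" "F1 \<subseteq> A.cubes" and F2: "finite F2" "F2 \<subseteq> B.cubes"
    and K: "K \<in> F1" and V: "V \<in> F2" and y: "y \<in> K" and z: "z \<in> V"
  shows "(LINT x:K \<times> V|lborel. w x) / (A.vol K * B.vol V)
    \<le> dmax F1 (\<lambda>y'. dmax F2 (\<lambda>z'. w (y', z')) z) y"
proof -
  have c: "0 \<le> c" using w(2)[of undefined] w(3)[of undefined] by linarith
  have Kc: "K \<in> A.cubes" and Vc: "V \<in> B.cubes" using K V F1 F2 by auto
  note wm = measurable_pair_borel[OF w(1)]
  note [measurable] = wm
  have [measurable]: "K \<in> sets borel" "V \<in> sets borel" using Kc Vc by auto
  define g where "g y' = dmax F2 (\<lambda>z'. w (y', z')) z" for y'
  have "(\<lambda>(y, z). dmax F2 (\<lambda>z'. w (y, z')) z) \<in> borel_measurable borel"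
    using F2 by (intro dmax_measurable_pair w(1)) auto
  then have gm [measurable]: "g \<in> borel_measurable borel"
    unfolding g_def[abs_def] using slice_measurable(1)[of "\<lambda>(y, z). dmax F2 (\<lambda>z'. w (y, z')) z" z] by simp
  have g0: "0 \<le> g y'" for y' unfolding g_def using F2 by (intro dmax_nonneg) auto
  have gc: "g y' \<le> c" for y'
    unfolding g_def
  proof (rule dmax_le[OF F2(1) c])
    show "\<bar>w (y', x)\<bar> \<le> c" for x using w(2,3) by simp
    show "J \<in> sets borel \<and> 0 < measure lborel J \<and> emeasure lborel J < \<infinity>" if "J \<in> F2" for J
      using that F2 B.vol_pos B.cubes_fin by auto
  qed (simp add: slice_measurable(2)[OF w(1)])
  have indK: "integrable lborel (\<lambda>y'. c * indicator K y' :: real)" using Kc A.cubes_fin[OF Kc] by auto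
  have gi: "integrable lborel (\<lambda>y'. indicator K y' * g y')"
  proof (rule Bochner_Integration.integrable_bound[OF indK])
    have "norm (indicator K y' * g y') \<le> norm (c * indicator K y')" for y'
      using g0[of y'] gc[of y'] c by (auto split: split_indicator)
    then show "AE y' in lborel. norm (indicator K y' * g y') \<le> norm (c * indicator K y')" by simp
  qed measurable
  have KV: "K \<times> V \<in> sets borel"
  proof -
    have "K \<times> V \<in> sets (borel \<Otimes>\<^sub>M borel)" by (rule pair_measureI) auto
    then show ?thesis by (simp only: borel_prod)
  qed
  have KVfin: "emeasure lborel (K \<times> V) < \<infinity>"
    unfolding lborel_prod[symmetric] using Kc Vc
    by (subst lborel.emeasure_pair_measure_Times) (auto simp: A.emeasure_cubes B.emeasure_cubes ennreal_mult_less_top)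
  have "integrable lborel (\<lambda>x. c * indicator (K \<times> V) x :: real)" using KV KVfin by auto
  then have "integrable lborel (\<lambda>x. indicator (K \<times> V) x * w x)"
  proof (rule Bochner_Integration.integrable_bound)
    have "norm (indicator (K \<times> V) x * w x) \<le> norm (c * indicator (K \<times> V) x)" for x
      using w(2)[of x] w(3)[of x] c by (auto split: split_indicator)
    then show "AE x in lborel. norm (indicator (K \<times> V) x * w x) \<le> norm (c * indicator (K \<times> V) x)" by simp
  qed (use w(1) KV in simp)
  then have int: "integrable (lborel \<Otimes>\<^sub>M lborel) (\<lambda>x. indicator (K \<times> V) x * w x)" by (simp add: lborel_prod)
  have "(LINT x:K \<times> V|lborel. w x) = (LINT y'|lborel. LINT z'|lborel. indicator (K \<times> V) (y', z') * w (y', z'))"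
    using lborel_pair.integral_fst'[OF int] by (simp add: set_lebesgue_integral_def lborel_prod)
  also have "\<dots> = (LINT y'|lborel. indicator K y' * (B.vol V * avg V (\<lambda>z'. w (y', z'))))"
    using B.vol_pos[OF Vc]
    by (intro Bochner_Integration.integral_cong refl)
       (auto simp: avg_def set_lebesgue_integral_def indicator_times mult.assoc)
  also have "\<dots> \<le> (LINT y'|lborel. B.vol V * (indicator K y' * g y'))"
  proof (rule integral_mono')
    fix y'
    have "avg V (\<lambda>z'. w (y', z')) \<le> g y'" unfolding g_def by (rule avg_le_dmax[OF F2(1) V z])
    then show "indicator K y' * (B.vol V * avg V (\<lambda>z'. w (y', z'))) \<le> B.vol V * (indicator K y' * g y')"
      by (auto split: split_indicator intro!: mult_left_mono)
    show "0 \<le> B.vol V * (indicator K y' * g y')" using g0 by simp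
  qed (use gi in simp)
  also have "\<dots> = B.vol V * (A.vol K * avg K g)"
    using A.vol_pos[OF Kc] by (simp add: avg_def set_lebesgue_integral_def)
  also have "\<dots> \<le> B.vol V * (A.vol K * dmax F1 g y)"
    using avg_le_dmax[OF F1(1) K y, of g] by (intro mult_left_mono) auto
  finally have "(LINT x:K \<times> V|lborel. w x) \<le> B.vol V * (A.vol K * dmax F1 g y)" .
  then have "(LINT x:K \<times> V|lborel. w x) / (A.vol K * B.vol V) \<le> dmax F1 g y"
    using A.vol_pos[OF Kc] B.vol_pos[OF Vc] by (simp add: pos_divide_le_eq mult_ac)
  then show ?thesis unfolding g_def[abs_def] .
qed

text \<open>Carleson embedding without stopping times: Cauchy--Schwarz with the weights \<open>m\<^sub>R\<close>, where \<open>m\<^sub>R\<close> is the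
  squared mean of \<open>\<surd>s\<close> over \<open>R\<close>.  Jensen's inequality bounds \<open>|R|/m\<^sub>R\<close> by \<open>\<integral>\<^sub>R 1/s\<close>, while \<open>m\<^sub>R\<close> is below the squared
  strong maximal function of \<open>\<surd>s\<close>, whose integral is controlled by that of \<open>s\<close>.\<close>

lemma carleson_embedding:
  fixes \<alpha> \<beta> :: "'a set \<times> 'b set \<Rightarrow> real"
  assumes F: "finite F" "F \<subseteq> A.cubes \<times> B.cubes"
    and \<alpha>: "\<And>i. 0 \<le> \<alpha> i" and \<beta>: "\<And>i. 0 \<le> \<beta> i" and C: "0 \<le> C"
    and carl: "\<And>G. G \<subseteq> F \<Longrightarrow> (\<Sum>i\<in>G. vol2 i * (\<alpha> i)\<^sup>2) \<le> C\<^sup>2 * measure lborel (\<Union>i\<in>G. rect i)"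
    and S: "0 \<le> S" "(\<integral>\<^sup>+x. ennreal (sqrt (\<Sum>i\<in>F. (\<beta> i)\<^sup>2 * indicator (rect i) x)) \<partial>lborel) \<le> ennreal S"
  shows "(\<Sum>i\<in>F. vol2 i * (\<alpha> i * \<beta> i)) \<le> 4 * C * S"
proof -
  define s where "s x = sqrt (\<Sum>i\<in>F. (\<beta> i)\<^sup>2 * indicator (rect i) x)" for x
  \<comment> \<open>The maximal theorem is applied to the square root of \<open>s\<close>: its
    \<open>L2\<close> bound then costs only the integral of \<open>s\<close>, which an
    \<open>L1\<close> maximal theorem could not give.\<close>
  define w where "w x = sqrt (s x)" for x
  have rb: "rect i \<in> sets borel" if "i \<in> F" for i using rect_borel F that by blast
  have sm [measurable]: "s \<in> borel_measurable borel"
  proof -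
    have "(\<lambda>x. \<Sum>i\<in>F. (\<beta> i)\<^sup>2 * indicator (rect i) x) \<in> borel_measurable borel"
    proof (rule borel_measurable_sum)
      fix i assume "i \<in> F"
      then have [measurable]: "rect i \<in> sets borel" by (rule rb)
      show "(\<lambda>x. (\<beta> i)\<^sup>2 * indicator (rect i) x) \<in> borel_measurable borel" by measurable
    qed
    then show ?thesis unfolding s_def[abs_def] by (intro measurable_compose[OF _ borel_measurable_sqrt])
  qed
  have wm [measurable]: "w \<in> borel_measurable borel" unfolding w_def[abs_def] by measurable
  have sum0: "0 \<le> (\<Sum>i\<in>F. (\<beta> i)\<^sup>2 * indicator (rect i) x)" for x by (intro sum_nonneg) auto
  have s0: "0 \<le> s x" for x unfolding s_def using sum0 by simp
  have s2: "(s x)\<^sup>2 = (\<Sum>i\<in>F. (\<beta> i)\<^sup>2 * indicator (rect i) x)" for x unfolding s_def using sum0 by simp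
  have w0: "0 \<le> w x" and w2: "(w x)\<^sup>2 = s x" for x unfolding w_def using s0 by auto
  define c where "c = sqrt (sqrt (\<Sum>i\<in>F. (\<beta> i)\<^sup>2))"
  have wc: "w x \<le> c" for x
    unfolding w_def s_def c_def by (intro real_sqrt_le_mono sum_mono) (auto split: split_indicator)
  have c0: "0 \<le> c" using w0[of undefined] wc[of undefined] by linarith
  \<comment> \<open>Zero coefficients contribute nothing. For the others \<open>s\<close> is at
    least \<open>\<beta> i > 0\<close> on the rectangle, as Jensen's inequality requires.\<close>
  define G where "G = {i \<in> F. 0 < \<beta> i}"
  have G: "finite G" "G \<subseteq> F" using F by (auto simp: G_def)
  have pos: "0 < A.vol (fst i)" "0 < B.vol (snd i)" "0 < measure lborel (rect i)"
    "vol2 i \<le> measure lborel (rect i)" if "i \<in> F" for i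
  proof -
    have i: "fst i \<in> A.cubes" "snd i \<in> B.cubes" "i \<in> A.cubes \<times> B.cubes" using that F by auto
    show p: "0 < A.vol (fst i)" "0 < B.vol (snd i)" using A.vol_pos B.vol_pos i by auto
    show "0 < measure lborel (rect i)" using i by (simp add: vol_rect A.vol_pos B.vol_pos)
    have "1 * A.vol (fst i) \<le> d\<^sub>1 * A.vol (fst i)" "1 * B.vol (snd i) \<le> d\<^sub>2 * B.vol (snd i)"
      using p A.d_gt_1 B.d_gt_1 by (auto intro!: mult_right_mono)
    then show "vol2 i \<le> measure lborel (rect i)"
      using mult_mono[of "A.vol (fst i)" "d\<^sub>1 * A.vol (fst i)" "B.vol (snd i)" "d\<^sub>2 * B.vol (snd i)"] p i
      by (simp add: vol_rect A.vol_par B.vol_par)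
  qed
  have ws: "\<beta> i \<le> s x" if "i \<in> F" "x \<in> rect i" for i x
  proof (rule power2_le_imp_le)
    have "(\<beta> i)\<^sup>2 * indicator (rect i) x \<le> (\<Sum>i\<in>F. (\<beta> i)\<^sup>2 * indicator (rect i) x)"
      using F that by (intro member_le_sum) auto
    then show "(\<beta> i)\<^sup>2 \<le> (s x)\<^sup>2" using that by (simp add: s2)
  qed (rule s0)
  have wint: "set_integrable lborel (rect i) w" if "i \<in> F" for i
  proof -
    have "integrable lborel (\<lambda>x. c * indicator (rect i) x :: real)"
      using rect_fin[of i] rb[OF that] F that by auto
    then show ?thesis unfolding set_integrable_def
    proof (rule Bochner_Integration.integrable_bound)
      have "norm (indicator (rect i) x *\<^sub>R w x) \<le> norm (c * indicator (rect i) x)" for x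
        using w0[of x] wc[of x] c0 by (auto split: split_indicator)
      then show "AE x in lborel. norm (indicator (rect i) x *\<^sub>R w x) \<le> norm (c * indicator (rect i) x)" by simp
    next
      have [measurable]: "rect i \<in> sets borel" by (rule rb[OF that])
      show "(\<lambda>x. indicator (rect i) x *\<^sub>R w x) \<in> borel_measurable lborel" by measurable
    qed
  qed
  define l where "l i = (LINT x:rect i|lborel. w x) / measure lborel (rect i)" for i
  have lpos: "0 < l i" and lbound: "ennreal (measure lborel (rect i) / (l i)\<^sup>2)
      \<le> (\<integral>\<^sup>+x. ennreal (indicator (rect i) x / s x) \<partial>lborel)" if "i \<in> G" for i
  proof -
    have iF: "i \<in> F" and bi: "0 < \<beta> i" using that by (auto simp: G_def)
    have ic: "i \<in> A.cubes \<times> B.cubes" using iF F by auto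
    have sb: "0 < sqrt (\<beta> i)" using bi by simp
    have low: "sqrt (\<beta> i) \<le> w x" if "x \<in> rect i" for x
      using ws[OF iF that] unfolding w_def by (rule real_sqrt_le_mono)
    note J = jensen_inverse_square[OF rb[OF iF] rect_fin[OF ic] pos(3)[OF iF] wm wint[OF iF] sb low, folded l_def]
    show "0 < l i" by (rule J(1))
    show "ennreal (measure lborel (rect i) / (l i)\<^sup>2) \<le> (\<integral>\<^sup>+x. ennreal (indicator (rect i) x / s x) \<partial>lborel)"
      using J(2) by (simp only: w2)
  qed
  \<comment> \<open>Jensen replaces each quotient by an integral of \<open>1 / s\<close>; the sum of
    the squares of \<beta> over the rectangles through \<open>x\<close> restores
    \<open>(s x)\<^sup>2\<close>, leaving the integral of \<open>s\<close>.\<close>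
  have second: "(\<Sum>i\<in>G. measure lborel (rect i) * (\<beta> i)\<^sup>2 / (l i)\<^sup>2) \<le> S"
  proof -
    have "ennreal (\<Sum>i\<in>G. (\<beta> i)\<^sup>2 * (measure lborel (rect i) / (l i)\<^sup>2))
        = (\<Sum>i\<in>G. ennreal ((\<beta> i)\<^sup>2) * ennreal (measure lborel (rect i) / (l i)\<^sup>2))"
      by (rule ennreal_sum_mult) auto
    also have "\<dots> \<le> (\<Sum>i\<in>G. ennreal ((\<beta> i)\<^sup>2) * (\<integral>\<^sup>+x. ennreal (indicator (rect i) x / s x) \<partial>lborel))"
      by (intro sum_mono mult_left_mono lbound) auto
    also have "\<dots> = (\<integral>\<^sup>+x. (\<Sum>i\<in>G. ennreal ((\<beta> i)\<^sup>2) * ennreal (indicator (rect i) x / s x)) \<partial>lborel)"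
    proof -
      have m: "(\<lambda>x. ennreal (indicator (rect i) x / s x)) \<in> borel_measurable lborel" if "i \<in> G" for i
      proof -
        have [measurable]: "rect i \<in> sets borel" using that G rb by blast
        show ?thesis by measurable
      qed
      have "(\<integral>\<^sup>+x. (\<Sum>i\<in>G. ennreal ((\<beta> i)\<^sup>2) * ennreal (indicator (rect i) x / s x)) \<partial>lborel)
          = (\<Sum>i\<in>G. \<integral>\<^sup>+x. ennreal ((\<beta> i)\<^sup>2) * ennreal (indicator (rect i) x / s x) \<partial>lborel)"
      proof (rule nn_integral_sum)
        fix i assume "i \<in> G"
        then have [measurable]: "rect i \<in> sets borel" using G rb by blast
        show "(\<lambda>x. ennreal ((\<beta> i)\<^sup>2) * ennreal (indicator (rect i) x / s x)) \<in> borel_measurable lborel"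
          by measurable
      qed
      also have "\<dots> = (\<Sum>i\<in>G. ennreal ((\<beta> i)\<^sup>2) * (\<integral>\<^sup>+x. ennreal (indicator (rect i) x / s x) \<partial>lborel))"
        by (intro sum.cong refl nn_integral_cmult m)
      finally show ?thesis by simp
    qed
    also have "\<dots> \<le> (\<integral>\<^sup>+x. ennreal (s x) \<partial>lborel)"
    proof (rule nn_integral_mono)
      fix x
      have "(\<Sum>i\<in>G. ennreal ((\<beta> i)\<^sup>2) * ennreal (indicator (rect i) x / s x))
          = ennreal (\<Sum>i\<in>G. (\<beta> i)\<^sup>2 * (indicator (rect i) x / s x))"
        using s0 by (intro ennreal_sum_mult[symmetric]) auto
      also have "(\<Sum>i\<in>G. (\<beta> i)\<^sup>2 * (indicator (rect i) x / s x)) \<le> (\<Sum>i\<in>F. (\<beta> i)\<^sup>2 * (indicator (rect i) x / s x))"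
        using F G s0 by (intro sum_mono2) auto
      also have "\<dots> = (s x)\<^sup>2 / s x" by (simp add: s2 sum_divide_distrib)
      \<comment> \<open>This includes \<open>s x = 0\<close>, where the quotient is \<open>0\<close>
        by the convention for division.\<close>
      also have "\<dots> = s x" by (simp add: power2_eq_square)
      finally show "(\<Sum>i\<in>G. ennreal ((\<beta> i)\<^sup>2) * ennreal (indicator (rect i) x / s x)) \<le> ennreal (s x)"
        by (simp add: ennreal_leI)
    qed
    also have "\<dots> \<le> ennreal S" using S(2) by (simp add: s_def)
    finally show ?thesis using S(1) by (simp add: mult.commute)
  qed
  define F1 where "F1 = A.par ` fst ` F"
  define F2 where "F2 = B.par ` snd ` F"
  have F1: "finite F1" "F1 \<subseteq> A.cubes" and F2: "finite F2" "F2 \<subseteq> B.cubes"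
    using F by (auto simp: F1_def F2_def)
  define N where "N = (\<lambda>(y, z). dmax F1 (\<lambda>y'. dmax F2 (\<lambda>z'. w (y', z')) z) y)"
  have Nm [measurable]: "N \<in> borel_measurable borel" unfolding N_def by (rule strong_maximal(1)[OF wm F1 F2])
  have lN: "l i \<le> N x" if i: "i \<in> F" and x: "x \<in> rect i" for i x
  proof -
    have P: "A.par (fst i) \<in> F1" "B.par (snd i) \<in> F2" using i by (auto simp: F1_def F2_def)
    have ic: "i \<in> A.cubes \<times> B.cubes" using i F by auto
    have yz: "fst x \<in> A.par (fst i)" "snd x \<in> B.par (snd i)" using x by (auto simp: rect_def)
    have "l i = (LINT x:A.par (fst i) \<times> B.par (snd i)|lborel. w x) / (A.vol (A.par (fst i)) * B.vol (B.par (snd i)))"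
      unfolding l_def vol_rect[OF ic] unfolding rect_def ..
    also have "\<dots> \<le> dmax F1 (\<lambda>y'. dmax F2 (\<lambda>z'. w (y', z')) (snd x)) (fst x)"
      by (rule avg_rect_le_strong_maximal[OF wm w0 wc F1 F2 P yz])
    also have "\<dots> = N x" unfolding N_def case_prod_beta' ..
    finally show ?thesis .
  qed
  \<comment> \<open>The packing lemma with the majorant \<open>N\<^sup>2\<close>, where
    \<open>N\<close> is the strong maximal function of \<open>w\<close>; the factor 16 is that of
    \<open>strong_maximal\<close>.\<close>
  have first: "(\<Sum>i\<in>G. vol2 i * (\<alpha> i)\<^sup>2 * (l i)\<^sup>2) \<le> 16 * C\<^sup>2 * S"
  proof -
    have "ennreal (\<Sum>i\<in>G. vol2 i * (\<alpha> i)\<^sup>2 * (l i)\<^sup>2)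
        \<le> ennreal (C\<^sup>2) * (\<integral>\<^sup>+x. ennreal ((N x)\<^sup>2) \<partial>lborel)"
    proof (rule sum_le_nn_integral_of_packing[where P = rect])
      show "emeasure lborel (rect i) < \<infinity>" if "i \<in> G" for i using rect_fin F G that by blast
      show "(\<Sum>i\<in>H. vol2 i * (\<alpha> i)\<^sup>2) \<le> C\<^sup>2 * measure lborel (\<Union>i\<in>H. rect i)" if "H \<subseteq> G" for H
        using carl[of H] that G by auto
      show "ennreal ((l i)\<^sup>2) \<le> ennreal ((N x)\<^sup>2)" if "i \<in> G" "x \<in> rect i" for i x
        using lN[of i x] lpos[of i] that G by (intro ennreal_leI power_mono) auto
    next
      show "finite G" by (rule G)
      show "rect i \<in> sets borel" if "i \<in> G" for i using that G rb by blast
      show "(\<lambda>x. ennreal ((N x)\<^sup>2)) \<in> borel_measurable borel" by measurable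
    qed simp_all
    also have "(\<integral>\<^sup>+x. ennreal ((N x)\<^sup>2) \<partial>lborel) \<le> 16 * (\<integral>\<^sup>+x. ennreal ((w x)\<^sup>2) \<partial>lborel)"
      using strong_maximal(2)[OF wm F1 F2] by (simp add: N_def case_prod_beta')
    also have "(\<integral>\<^sup>+x. ennreal ((w x)\<^sup>2) \<partial>lborel) \<le> ennreal S" using S(2) by (simp add: w2 s_def)
    finally have "ennreal (\<Sum>i\<in>G. vol2 i * (\<alpha> i)\<^sup>2 * (l i)\<^sup>2) \<le> ennreal (C\<^sup>2) * (16 * ennreal S)"
      by (simp add: mult_left_mono)
    also have "\<dots> = ennreal (16 * C\<^sup>2 * S)" using S(1) by (simp add: ennreal_mult mult_ac)
    finally show ?thesis using S(1) by simp
  qed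
  define v where "v i = vol2 i" for i
  define r where "r i = sqrt (v i)" for i
  have v0: "0 \<le> v i" for i by (simp add: v_def)
  have r2: "(r i)\<^sup>2 = v i" for i unfolding r_def using v0 by simp
  \<comment> \<open>The weight \<open>l i\<close> is moved to one factor and its inverse to the
    other before Cauchy-Schwarz, so the root of \<open>16 * C\<^sup>2 * S * S\<close> gives
    \<open>4 * C * S\<close>.\<close>
  define x1 where "x1 i = r i * \<alpha> i * l i" for i
  define x2 where "x2 i = r i * \<beta> i / l i" for i
  have "(\<Sum>i\<in>F. v i * (\<alpha> i * \<beta> i)) = (\<Sum>i\<in>G. v i * (\<alpha> i * \<beta> i))"
  proof (rule sum.mono_neutral_right[OF F(1) G(2)])
    have "\<beta> i = 0" if "i \<in> F - G" for i using that \<beta>[of i] by (auto simp: G_def)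
    then show "\<forall>i\<in>F - G. v i * (\<alpha> i * \<beta> i) = 0" by simp
  qed
  also have "\<dots> = (\<Sum>i\<in>G. x1 i * x2 i)"
  proof (rule sum.cong[OF refl])
    fix i assume i: "i \<in> G"
    then have "l i \<noteq> 0" using lpos[of i] by auto
    then have "x1 i * x2 i = (r i)\<^sup>2 * (\<alpha> i * \<beta> i)"
      unfolding x1_def x2_def by (simp add: power2_eq_square)
    then show "v i * (\<alpha> i * \<beta> i) = x1 i * x2 i" by (simp only: r2)
  qed
  finally have eq: "(\<Sum>i\<in>F. v i * (\<alpha> i * \<beta> i)) = (\<Sum>i\<in>G. x1 i * x2 i)" .
  have a1: "(\<Sum>i\<in>G. (x1 i)\<^sup>2) \<le> 16 * C\<^sup>2 * S"
    using first by (simp only: x1_def power_mult_distrib r2 v_def)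
  have a2: "(\<Sum>i\<in>G. (x2 i)\<^sup>2) \<le> S"
  proof -
    have "(\<Sum>i\<in>G. (x2 i)\<^sup>2) \<le> (\<Sum>i\<in>G. measure lborel (rect i) * (\<beta> i)\<^sup>2 / (l i)\<^sup>2)"
    proof (rule sum_mono)
      fix i assume "i \<in> G"
      then have "v i \<le> measure lborel (rect i)" using pos(4)[of i] G unfolding v_def by blast
      then have "v i * (\<beta> i)\<^sup>2 / (l i)\<^sup>2 \<le> measure lborel (rect i) * (\<beta> i)\<^sup>2 / (l i)\<^sup>2"
        by (intro divide_right_mono mult_right_mono) simp_all
      then show "(x2 i)\<^sup>2 \<le> measure lborel (rect i) * (\<beta> i)\<^sup>2 / (l i)\<^sup>2"
        by (simp only: x2_def power_mult_distrib power_divide r2)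
    qed
    then show ?thesis using second by linarith
  qed
  have "(\<Sum>i\<in>G. x1 i * x2 i)\<^sup>2 \<le> (\<Sum>i\<in>G. (x1 i)\<^sup>2) * (\<Sum>i\<in>G. (x2 i)\<^sup>2)" by (rule Cauchy_Schwarz_ineq_sum)
  also have "\<dots> \<le> (16 * C\<^sup>2 * S) * S"
  proof (rule mult_mono[OF a1 a2])
    show "0 \<le> 16 * C\<^sup>2 * S" using S(1) by simp
    show "0 \<le> (\<Sum>i\<in>G. (x2 i)\<^sup>2)" by (rule sum_nonneg) simp
  qed
  also have "\<dots> = (4 * C * S)\<^sup>2" by (simp add: power2_eq_square)
  finally have "(\<Sum>i\<in>G. x1 i * x2 i) \<le> 4 * C * S"
    by (rule power2_le_imp_le) (use C S(1) in simp)
  then show ?thesis using eq by (simp only: v_def)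
qed

text \<open>The mixed form is what makes this work: \<open>f\<close> meets a wavelet in the first
  variable and an average in the second, \<open>g\<close> the reverse. The averages are dominated by
  maximal functions, after which the double square sum factors into one sum over \<open>J\<close>
  and one over \<open>L\<close>, and Cauchy-Schwarz meets two hybrid estimates.\<close>

lemma bilinear_estimate:
  fixes \<alpha> :: "'a set \<times> 'b set \<Rightarrow> real"
  assumes b1: "A.accretive \<kappa>\<^sub>1 \<beta>\<^sub>1 b1" and b2: "B.accretive \<kappa>\<^sub>2 \<beta>\<^sub>2 b2"
    and b1': "A.accretive \<kappa>\<^sub>1' \<beta>\<^sub>1' b1'" and b2': "B.accretive \<kappa>\<^sub>2' \<beta>\<^sub>2' b2'"
    and f: "f \<in> L2" and g: "g \<in> L2"
    and F: "finite F" "F \<subseteq> A.cubes \<times> B.cubes"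
    and \<alpha>: "\<And>i. 0 \<le> \<alpha> i" and C: "0 \<le> C"
    and carl: "\<And>G. G \<subseteq> F \<Longrightarrow> (\<Sum>i\<in>G. vol2 i * (\<alpha> i)\<^sup>2) \<le> C\<^sup>2 * measure lborel (\<Union>i\<in>G. rect i)"
  shows "(\<Sum>(J, L)\<in>F. A.vol J * B.vol L * (\<alpha> (J, L) *
      (cmod (pairing f (tensor (A.wav b1 J) (B.bump b2' (B.par L)))) *
       cmod (pairing g (tensor (A.bump b1' (A.par J)) (B.wav b2 L))))))
    \<le> 4 * C * (640 * d\<^sub>1 * d\<^sub>2 * \<kappa>\<^sub>1\<^sup>2 * \<kappa>\<^sub>2\<^sup>2 * \<kappa>\<^sub>1' * \<kappa>\<^sub>2' * L2_norm f * L2_norm g)"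
proof -
  \<comment> \<open>The same estimates with the variables exchanged, for use with
    \<open>flip g\<close>.\<close>
  interpret BA: dyadic_pair Q\<^sub>2 \<mu>\<^sub>2 d\<^sub>2 Q\<^sub>1 \<mu>\<^sub>1 d\<^sub>1 ..
  have \<kappa>: "1 \<le> \<kappa>\<^sub>1" "1 \<le> \<kappa>\<^sub>2" "1 \<le> \<kappa>\<^sub>1'" "1 \<le> \<kappa>\<^sub>2'"
    using b1 b2 b1' b2' by (auto simp: A.accretive_def B.accretive_def)
  have d: "1 < d\<^sub>1" "1 < d\<^sub>2" using A.d_gt_1 B.d_gt_1 by auto
  define p where "p J L = cmod (pairing f (tensor (A.wav b1 J) (B.bump b2' (B.par L))))" for J L
  define q where "q J L = cmod (pairing g (tensor (A.bump b1' (A.par J)) (B.wav b2 L)))" for J L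
  define F1 where "F1 = fst ` F"
  define F2 where "F2 = snd ` F"
  have F1: "finite F1" "F1 \<subseteq> A.cubes" and F2: "finite F2" "F2 \<subseteq> B.cubes"
    using F by (auto simp: F1_def F2_def)
  have P1: "finite (A.par ` F1)" "A.par ` F1 \<subseteq> A.cubes" and P2: "finite (B.par ` F2)" "B.par ` F2 \<subseteq> B.cubes"
    using F1 F2 by auto
  define D where "D J z = dmax (B.par ` F2) (\<lambda>z. cmod (slice1 f (A.wav b1 J) z)) z" for J z
  define E where "E L y = dmax (A.par ` F1) (\<lambda>y. cmod (slice1 (flip g) (B.wav b2 L) y)) y" for L y
  have [measurable]: "D J \<in> borel_measurable borel" "E L \<in> borel_measurable borel" for J L
    unfolding D_def[abs_def] E_def[abs_def] using P1 P2 by (auto intro!: dmax_measurable)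
  \<comment> \<open>The bound holds at every point \<open>z\<close> of the parent, and its right
    side no longer depends on \<open>L\<close>.\<close>
  have pD: "p J L \<le> \<kappa>\<^sub>2' * D J z" if J: "J \<in> F1" and L: "L \<in> F2" and z: "z \<in> B.par L" for J L z
  proof -
    have Jc: "J \<in> A.cubes" and Lc: "B.par L \<in> B.cubes" using J L F1 F2 by auto
    have "p J L \<le> \<kappa>\<^sub>2' * avg (B.par L) (\<lambda>z. cmod (slice1 f (A.wav b1 J) z))"
      unfolding p_def pairing_tensor1[OF f A.wav_L2[OF b1 Jc] B.bump_L2[OF b2' Lc]]
      by (rule B.pairing_bump_le_avg[OF b2' slice1_L2[OF f A.wav_L2[OF b1 Jc]] Lc])
    also have "\<dots> \<le> \<kappa>\<^sub>2' * D J z"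
      unfolding D_def using \<kappa> L P2 z by (intro mult_left_mono avg_le_dmax) auto
    finally show ?thesis .
  qed
  have qE: "q J L \<le> \<kappa>\<^sub>1' * E L y" if J: "J \<in> F1" and L: "L \<in> F2" and y: "y \<in> A.par J" for J L y
  proof -
    have Jc: "A.par J \<in> A.cubes" and Lc: "L \<in> B.cubes" using J L F1 F2 by auto
    have "q J L \<le> \<kappa>\<^sub>1' * avg (A.par J) (\<lambda>y. cmod (slice1 (flip g) (B.wav b2 L) y))"
      unfolding q_def pairing_flip_tensor[OF g A.bump_L2[OF b1' Jc] B.wav_L2[OF b2 Lc], symmetric]
        pairing_tensor1[OF flip_L2[OF g] B.wav_L2[OF b2 Lc] A.bump_L2[OF b1' Jc]]
      by (rule A.pairing_bump_le_avg[OF b1' slice1_L2[OF flip_L2[OF g] B.wav_L2[OF b2 Lc]] Jc])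
    also have "\<dots> \<le> \<kappa>\<^sub>1' * E L y"
      unfolding E_def using \<kappa> J P1 y by (intro mult_left_mono avg_le_dmax) auto
    finally show ?thesis .
  qed
  define X where "X = (\<lambda>(y, z). \<Sum>J\<in>F1. indicator (A.par J) y * (D J z)\<^sup>2)"
  define Y where "Y = (\<lambda>(z, y). \<Sum>L\<in>F2. indicator (B.par L) z * (E L y)\<^sup>2)"
  have X0: "0 \<le> X x" and Y0: "0 \<le> Y x'" for x x'
    unfolding X_def Y_def by (auto simp: case_prod_beta' intro!: sum_nonneg)
  have pm: "A.par J \<in> sets borel" if "J \<in> F1" for J using that F1 by auto
  have "X \<in> borel_measurable (borel \<Otimes>\<^sub>M borel)"
    unfolding X_def case_prod_beta'
  proof (intro borel_measurable_sum)
    fix J assume "J \<in> F1"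
    then have [measurable]: "A.par J \<in> sets borel" by (rule pm)
    show "(\<lambda>x. indicator (A.par J) (fst x) * (D J (snd x))\<^sup>2) \<in> borel_measurable (borel \<Otimes>\<^sub>M borel)" by measurable
  qed
  then have Xm [measurable]: "X \<in> borel_measurable borel" by (simp add: borel_prod)
  have pm2: "B.par L \<in> sets borel" if "L \<in> F2" for L using that F2 by auto
  have Ypm [measurable]: "Y \<in> borel_measurable (borel \<Otimes>\<^sub>M borel)"
    unfolding Y_def case_prod_beta'
  proof (intro borel_measurable_sum)
    fix L assume "L \<in> F2"
    then have [measurable]: "B.par L \<in> sets borel" by (rule pm2)
    show "(\<lambda>x. indicator (B.par L) (fst x) * (E L (snd x))\<^sup>2) \<in> borel_measurable (borel \<Otimes>\<^sub>M borel)" by measurable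
  qed
  then have Ym: "Y \<in> borel_measurable borel" by (simp add: borel_prod)
  \<comment> \<open>\<open>Y\<close> was built for the exchanged variables; this returns it to the
    order of \<open>X\<close>.\<close>
  define Y' where "Y' = (\<lambda>(y, z). Y (z, y))"
  have "Y' \<in> borel_measurable (borel \<Otimes>\<^sub>M borel)" unfolding Y'_def by measurable
  then have Y'm [measurable]: "Y' \<in> borel_measurable borel" by (simp add: borel_prod)
  have IX: "(\<integral>\<^sup>+x. ennreal (X x) \<partial>lborel) \<le> ennreal (160 * d\<^sub>1 * \<kappa>\<^sub>1 ^ 4) * sq f"
    using hybrid_estimate[OF b1 f F1 P2] by (simp add: X_def D_def case_prod_beta')
  have "(\<integral>\<^sup>+x. ennreal (Y' x) \<partial>lborel) = (\<integral>\<^sup>+x. ennreal (Y x) \<partial>lborel)"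
    using Ym Y'm by (subst nn_integral_lborel_snd, simp, subst nn_integral_lborel_fst, simp, simp add: Y'_def)
  also have "\<dots> \<le> ennreal (160 * d\<^sub>2 * \<kappa>\<^sub>2 ^ 4) * sq (flip g)"
    using BA.hybrid_estimate[OF b2 flip_L2[OF g] F2 P1] by (simp add: Y_def E_def case_prod_beta')
  finally have IY: "(\<integral>\<^sup>+x. ennreal (Y' x) \<partial>lborel) \<le> ennreal (160 * d\<^sub>2 * \<kappa>\<^sub>2 ^ 4) * sq g"
    by (simp add: sq_flip[OF g])
  \<comment> \<open>Cauchy-Schwarz gives 160 times the root of \<open>d\<^sub>1 * d\<^sub>2\<close>;
    the larger constant avoids that root.\<close>
  define S where "S = 640 * d\<^sub>1 * d\<^sub>2 * \<kappa>\<^sub>1\<^sup>2 * \<kappa>\<^sub>2\<^sup>2 * \<kappa>\<^sub>1' * \<kappa>\<^sub>2' * L2_norm f * L2_norm g"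
  have S0: "0 \<le> S" unfolding S_def using \<kappa> d by simp
  define s where "s x = sqrt (\<Sum>i\<in>F. (p (fst i) (snd i) * q (fst i) (snd i))\<^sup>2 * indicator (rect i) x)" for x
  have sXY: "s x \<le> \<kappa>\<^sub>1' * \<kappa>\<^sub>2' * (sqrt (X x) * sqrt (Y' x))" for x
  proof -
    obtain y z where x: "x = (y, z)" by fastforce
    have "(\<Sum>i\<in>F. (p (fst i) (snd i) * q (fst i) (snd i))\<^sup>2 * indicator (rect i) x)
        \<le> (\<Sum>i\<in>F1 \<times> F2. (p (fst i) (snd i) * q (fst i) (snd i))\<^sup>2 * indicator (rect i) x)"
      using F1 F2 by (intro sum_mono2) (auto simp: F1_def F2_def image_iff Bex_def)
    also have "\<dots> \<le> (\<Sum>i\<in>F1 \<times> F2. (\<kappa>\<^sub>1' * \<kappa>\<^sub>2')\<^sup>2 * ((indicator (A.par (fst i)) y * (D (fst i) z)\<^sup>2) *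
        (indicator (B.par (snd i)) z * (E (snd i) y)\<^sup>2)))"
    proof (rule sum_mono)
      fix i assume i: "i \<in> F1 \<times> F2"
      show "(p (fst i) (snd i) * q (fst i) (snd i))\<^sup>2 * indicator (rect i) x \<le>
        (\<kappa>\<^sub>1' * \<kappa>\<^sub>2')\<^sup>2 * ((indicator (A.par (fst i)) y * (D (fst i) z)\<^sup>2) * (indicator (B.par (snd i)) z * (E (snd i) y)\<^sup>2))"
      proof (cases "x \<in> rect i")
        case True
        then have yz: "y \<in> A.par (fst i)" "z \<in> B.par (snd i)" by (auto simp: rect_def x)
        have "p (fst i) (snd i) * q (fst i) (snd i) \<le> (\<kappa>\<^sub>2' * D (fst i) z) * (\<kappa>\<^sub>1' * E (snd i) y)"
          using pD[of "fst i" "snd i" z] qE[of "fst i" "snd i" y] i yz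
          by (intro mult_mono) (auto simp: p_def q_def intro: order_trans[OF norm_ge_zero])
        then have "(p (fst i) (snd i) * q (fst i) (snd i))\<^sup>2 \<le> ((\<kappa>\<^sub>2' * D (fst i) z) * (\<kappa>\<^sub>1' * E (snd i) y))\<^sup>2"
          by (rule power_mono) (simp add: p_def q_def)
        then show ?thesis using True yz by (simp add: power_mult_distrib mult_ac)
      qed simp
    qed
    \<comment> \<open>A sum over \<open>F1 \<times> F2\<close> of a function of \<open>J\<close>
      times a function of \<open>L\<close> is a product of two sums.\<close>
    also have "\<dots> = (\<kappa>\<^sub>1' * \<kappa>\<^sub>2')\<^sup>2 * (X x * Y' x)"
    proof -
      have "(\<Sum>i\<in>F1 \<times> F2. a (fst i) * e (snd i)) = (\<Sum>J\<in>F1. a J) * (\<Sum>L\<in>F2. e L)"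
        for a :: "'a set \<Rightarrow> real" and e :: "'b set \<Rightarrow> real"
        unfolding sum_product sum.cartesian_product by (simp add: case_prod_beta')
      from this[of "\<lambda>J. indicator (A.par J) y * (D J z)\<^sup>2" "\<lambda>L. indicator (B.par L) z * (E L y)\<^sup>2"]
      show ?thesis by (simp add: x X_def Y'_def Y_def sum_distrib_left[symmetric])
    qed
    finally have "s x \<le> sqrt ((\<kappa>\<^sub>1' * \<kappa>\<^sub>2')\<^sup>2 * (X x * Y' x))" unfolding s_def by simp
    then show ?thesis using \<kappa> by (simp add: real_sqrt_mult abs_of_nonneg)
  qed
  have sS: "(\<integral>\<^sup>+x. ennreal (s x) \<partial>lborel) \<le> ennreal S"
  proof -
    have Y'0: "0 \<le> Y' x" for x using Y0 by (simp add: Y'_def case_prod_beta')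
    have "(\<integral>\<^sup>+x. ennreal (s x) \<partial>lborel) \<le> (\<integral>\<^sup>+x. ennreal (\<kappa>\<^sub>1' * \<kappa>\<^sub>2') * (ennreal (sqrt (X x)) * ennreal (sqrt (Y' x))) \<partial>lborel)"
      using sXY \<kappa> X0 Y'0 by (intro nn_integral_mono) (simp add: ennreal_mult[symmetric] ennreal_leI)
    also have "\<dots> = ennreal (\<kappa>\<^sub>1' * \<kappa>\<^sub>2') * (\<integral>\<^sup>+x. ennreal (sqrt (X x)) * ennreal (sqrt (Y' x)) \<partial>lborel)"
      by (rule nn_integral_cmult) measurable
    finally have "(\<integral>\<^sup>+x. ennreal (s x) \<partial>lborel)\<^sup>2
        \<le> (ennreal (\<kappa>\<^sub>1' * \<kappa>\<^sub>2') * (\<integral>\<^sup>+x. ennreal (sqrt (X x)) * ennreal (sqrt (Y' x)) \<partial>lborel))\<^sup>2"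
      by (rule power_mono) simp
    also have "\<dots> \<le> (ennreal (\<kappa>\<^sub>1' * \<kappa>\<^sub>2'))\<^sup>2 * ((\<integral>\<^sup>+x. (ennreal (sqrt (X x)))\<^sup>2 \<partial>lborel) * (\<integral>\<^sup>+x. (ennreal (sqrt (Y' x)))\<^sup>2 \<partial>lborel))"
      unfolding power_mult_distrib by (intro mult_left_mono Cauchy_Schwarz_nn_integral) auto
    also have "\<dots> = (ennreal (\<kappa>\<^sub>1' * \<kappa>\<^sub>2'))\<^sup>2 * ((\<integral>\<^sup>+x. ennreal (X x) \<partial>lborel) * (\<integral>\<^sup>+x. ennreal (Y' x) \<partial>lborel))"
      using X0 Y'0 by (simp add: ennreal_power)
    also have "\<dots> \<le> (ennreal (\<kappa>\<^sub>1' * \<kappa>\<^sub>2'))\<^sup>2 * ((ennreal (160 * d\<^sub>1 * \<kappa>\<^sub>1 ^ 4) * sq f) * (ennreal (160 * d\<^sub>2 * \<kappa>\<^sub>2 ^ 4) * sq g))"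
      by (intro mult_left_mono mult_mono IX IY) auto
    also have "\<dots> = ennreal ((\<kappa>\<^sub>1' * \<kappa>\<^sub>2')\<^sup>2 * ((160 * d\<^sub>1 * \<kappa>\<^sub>1 ^ 4 * (L2_norm f)\<^sup>2) * (160 * d\<^sub>2 * \<kappa>\<^sub>2 ^ 4 * (L2_norm g)\<^sup>2)))"
    proof -
      have n: "0 \<le> (\<kappa>\<^sub>1' * \<kappa>\<^sub>2')\<^sup>2" "0 \<le> 160 * d\<^sub>1 * \<kappa>\<^sub>1 ^ 4" "0 \<le> 160 * d\<^sub>2 * \<kappa>\<^sub>2 ^ 4" "0 \<le> \<kappa>\<^sub>1' * \<kappa>\<^sub>2'"
        "0 \<le> (L2_norm f)\<^sup>2" "0 \<le> (L2_norm g)\<^sup>2"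
        using \<kappa> d by auto
      show ?thesis unfolding sq_eq_L2_norm[OF f] sq_eq_L2_norm[OF g] ennreal_power[OF n(4)]
        using n by (simp only: ennreal_mult[symmetric] mult_nonneg_nonneg)
    qed
    also have "\<dots> \<le> ennreal (S\<^sup>2)"
    proof (rule ennreal_leI)
      have "160\<^sup>2 * (d\<^sub>1 * d\<^sub>2) \<le> 640\<^sup>2 * (d\<^sub>1 * d\<^sub>2)\<^sup>2"
        using d self_le_power[of "d\<^sub>1 * d\<^sub>2" 2] one_le_mult_iff by (intro mult_mono) (auto intro!: self_le_power mult_ge1_I)
      then have "160\<^sup>2 * (d\<^sub>1 * d\<^sub>2) * ((\<kappa>\<^sub>1' * \<kappa>\<^sub>2')\<^sup>2 * (\<kappa>\<^sub>1 ^ 4 * \<kappa>\<^sub>2 ^ 4) * ((L2_norm f)\<^sup>2 * (L2_norm g)\<^sup>2))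
        \<le> 640\<^sup>2 * (d\<^sub>1 * d\<^sub>2)\<^sup>2 * ((\<kappa>\<^sub>1' * \<kappa>\<^sub>2')\<^sup>2 * (\<kappa>\<^sub>1 ^ 4 * \<kappa>\<^sub>2 ^ 4) * ((L2_norm f)\<^sup>2 * (L2_norm g)\<^sup>2))"
        using \<kappa> by (intro mult_right_mono) auto
      then show "(\<kappa>\<^sub>1' * \<kappa>\<^sub>2')\<^sup>2 * ((160 * d\<^sub>1 * \<kappa>\<^sub>1 ^ 4 * (L2_norm f)\<^sup>2) * (160 * d\<^sub>2 * \<kappa>\<^sub>2 ^ 4 * (L2_norm g)\<^sup>2)) \<le> S\<^sup>2"
        by (simp add: S_def power2_eq_square power4_eq_xxxx mult_ac)
    qed
    finally have sq_le: "(\<integral>\<^sup>+x. ennreal (s x) \<partial>lborel)\<^sup>2 \<le> (ennreal S)\<^sup>2" using S0 by (simp add: ennreal_power)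
    show ?thesis
    proof (cases "\<integral>\<^sup>+x. ennreal (s x) \<partial>lborel" rule: ennreal_cases)
      case (real r)
      then have "r\<^sup>2 \<le> S\<^sup>2" using sq_le S0 by (simp add: ennreal_power)
      then show ?thesis using real S0 by (auto intro: power2_le_imp_le)
    next
      case top
      then show ?thesis using sq_le S0 by (simp add: ennreal_power top_unique)
    qed
  qed
  have "(\<Sum>i\<in>F. vol2 i * (\<alpha> i * (p (fst i) (snd i) * q (fst i) (snd i)))) \<le> 4 * C * S"
  proof (rule carleson_embedding[OF F \<alpha> _ C carl S0])
    show "0 \<le> p (fst i) (snd i) * q (fst i) (snd i)" for i by (simp add: p_def q_def)
    show "(\<integral>\<^sup>+x. ennreal (sqrt (\<Sum>i\<in>F. (p (fst i) (snd i) * q (fst i) (snd i))\<^sup>2 * indicator (rect i) x)) \<partial>lborel) \<le> ennreal S"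
      using sS by (simp add: s_def)
  qed
  then show ?thesis by (simp add: p_def q_def S_def case_prod_beta')
qed

end

section \<open>Dyadic grids\<close>

lemma
  fixes u :: "real^'n"
  assumes l: "0 < l"
  shows cube_borel: "cube u l \<in> sets borel"
    and emeasure_cube: "emeasure lborel (cube u l) = ennreal (l ^ CARD('n))"
proof -
  have "cube u l = (\<Inter>j. {x. u $ j \<le> x $ j \<and> x $ j < u $ j + l})" by (auto simp: cube_def)
  moreover have "{x :: real^'n. u $ j \<le> x $ j \<and> x $ j < u $ j + l} \<in> sets borel" for j by measurable
  ultimately show b: "cube u l \<in> sets borel" by (auto intro!: sets.finite_INT)
  define v where "v = (\<chi> j. u $ j + l)"
  have dim: "(\<Prod>i\<in>Basis. (v - u) \<bullet> i) = l ^ CARD('n)"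
  proof -
    have "(v - u) \<bullet> i = l" if "i \<in> Basis" for i
      using that by (auto simp: Basis_vec_def inner_axis v_def)
    then show ?thesis by simp
  qed
  have le: "u \<bullet> i \<le> v \<bullet> i" if "i \<in> Basis" for i
    using that l by (auto simp: Basis_vec_def inner_axis v_def)
  \<comment> \<open>The half-open cube lies between the open and the closed box of equal
    volume.\<close>
  have "box u v \<subseteq> cube u l" "cube u l \<subseteq> cbox u v"
    by (auto simp: cube_def v_def mem_box_cart less_imp_le)
  then have "emeasure lborel (box u v) \<le> emeasure lborel (cube u l)" "emeasure lborel (cube u l) \<le> emeasure lborel (cbox u v)"
    using b by (auto intro!: emeasure_mono)
  then show "emeasure lborel (cube u l) = ennreal (l ^ CARD('n))"
    using le by (simp add: emeasure_lborel_box emeasure_lborel_cbox dim)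
qed

lemma cube_side_inj:
  fixes u v :: "real^'n"
  assumes "cube u (2 powi (- p)) = cube v (2 powi (- q))"
  shows "p = q"
proof -
  have "(2 powi (- p) :: real) ^ CARD('n) = (2 powi (- q)) ^ CARD('n)"
    using arg_cong[OF assms, of "emeasure lborel"] by (simp add: emeasure_cube)
  then have "(2 powi (- p) :: real) = 2 powi (- q)"
    by (rule power_eq_imp_eq_base) auto
  moreover have "(2 powi i :: real) < 2 powi j" if "i < j" for i j
    using that by (intro power_int_strict_increasing) auto
  ultimately show ?thesis by (metis linorder_neqE less_irrefl neg_less_iff_less)
qed

lemma translate_cube: "(+) a ` cube u l = cube (a + u) l"
proof
  show "cube (a + u) l \<subseteq> (+) a ` cube u l"
  proof
    fix x assume "x \<in> cube (a + u) l"
    then have "x - a \<in> cube u l" by (auto simp: cube_def algebra_simps)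
    then show "x \<in> (+) a ` cube u l" by (metis imageI add_diff_cancel_left' diff_add_cancel add.commute)
  qed
qed (auto simp: cube_def)

text \<open>The shift of a generation collects the bits of all finer scales. The series converges
  absolutely because each bit vector has norm at most the dimension, so its first term may be split
  off.\<close>

lemma grid_shift_succ:
  fixes \<omega> :: "int \<Rightarrow> real^'n"
  assumes \<omega>: "\<And>i j. \<omega> i $ j \<in> {0, 1}"
  shows "grid_shift \<omega> p = 2 powi (- (p + 1)) *\<^sub>R \<omega> (p + 1) + grid_shift \<omega> (p + 1)"
proof -
  have norm\<omega>: "norm (\<omega> i) \<le> real CARD('n)" for i
  proof -
    have "norm (\<omega> i) \<le> (\<Sum>j\<in>UNIV. \<bar>\<omega> i $ j\<bar>)" by (rule norm_le_l1_cart)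
    also have "\<dots> \<le> (\<Sum>j\<in>(UNIV :: 'n set). 1)"
    proof (rule sum_mono)
      fix j show "\<bar>\<omega> i $ j\<bar> \<le> 1" using \<omega>[of i j] by auto
    qed
    finally show ?thesis by simp
  qed
  have summable: "(\<lambda>i. 2 powi (- i) *\<^sub>R \<omega> i) summable_on {q<..}" for q :: int
  proof (rule abs_summable_summable)
    have bij: "bij_betw (\<lambda>k. q + 1 + int k) UNIV {q<..}"
      by (rule bij_betwI[where g = "\<lambda>i. nat (i - q - 1)"]) auto
    have "summable (\<lambda>k. norm (2 powi (- (q + 1 + int k)) *\<^sub>R \<omega> (q + 1 + int k)))"
    proof (rule summable_comparison_test')
      show "summable (\<lambda>k. (2 powi (- (q + 1)) * real CARD('n)) * (1 / 2 :: real) ^ k)"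
        by (intro summable_mult) simp
      fix k :: nat
      have "(2 powi (- (q + 1 + int k)) :: real) = 2 powi (- (q + 1)) * (1 / 2) ^ k"
      proof -
        have "(2 powi (- (q + 1) + (- int k)) :: real) = 2 powi (- (q + 1)) * 2 powi (- int k)"
          by (rule power_int_add) simp
        moreover have "(2 powi (- int k) :: real) = (1 / 2) ^ k" by (simp add: power_int_minus power_one_over inverse_eq_divide)
        moreover have "- (q + 1 + int k) = - (q + 1) + (- int k)" by simp
        ultimately show ?thesis by metis
      qed
      then show "norm (norm (2 powi (- (q + 1 + int k)) *\<^sub>R \<omega> (q + 1 + int k)))
          \<le> (2 powi (- (q + 1)) * real CARD('n)) * (1 / 2) ^ k"
        using norm\<omega>[of "q + 1 + int k"] by (simp add: mult_ac mult_left_mono)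
    qed
    then have "(\<lambda>k. norm (2 powi (- (q + 1 + int k)) *\<^sub>R \<omega> (q + 1 + int k))) summable_on UNIV"
      by (subst summable_on_UNIV_nonneg_real_iff) auto
    then show "(\<lambda>i. norm (2 powi (- i) *\<^sub>R \<omega> i)) summable_on {q<..}"
      using summable_on_reindex_bij_betw[OF bij, of "\<lambda>i. norm (2 powi (- i) *\<^sub>R \<omega> i)"] by simp
  qed
  have "{p<..} = {p + 1} \<union> {p + 1<..}" by auto
  then have "grid_shift \<omega> p = (\<Sum>\<^sub>\<infinity>i\<in>{p + 1} \<union> {p + 1<..}. 2 powi (- i) *\<^sub>R \<omega> i)"
    unfolding grid_shift_def by simp
  also have "\<dots> = (\<Sum>\<^sub>\<infinity>i\<in>{p + 1}. 2 powi (- i) *\<^sub>R \<omega> i) + (\<Sum>\<^sub>\<infinity>i\<in>{p + 1<..}. 2 powi (- i) *\<^sub>R \<omega> i)"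
    by (rule infsum_Un_disjoint) (use summable in auto)
  finally show ?thesis unfolding grid_shift_def by simp
qed

text \<open>Ties the filtration to the concrete \<open>generation\<close> and
  \<open>cube_level\<close>; \<open>is_cube\<close> is the link to pseudo-accretivity, which speaks
  of cubes.\<close>

locale grid = dyadic_filtration Q \<mu> d
  for Q :: "int \<Rightarrow> real^'n \<Rightarrow> (real^'n) set" and \<mu> d +
  fixes D :: "(real^'n) set set"
  assumes D_eq: "D = cubes" and generation_eq: "generation D p = range (Q p)"
    and cube_level_Q: "cube_level (Q p x) = p" and is_cube: "\<exists>u. Q p x = cube u (2 powi (- p))"

text \<open>Each point is assigned the integer vector that indexes its cube in a generation. Nesting
  then says that this index determines the index one generation coarser.\<close>

lemma dyadic_grid_imp_grid:
  fixes D :: "(real^'n) set set"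
  assumes "dyadic_grid D"
  shows "\<exists>Q \<mu>. grid Q \<mu> (2 ^ CARD('n)) D"
proof -
  obtain \<omega> where \<omega>: "\<And>i j. \<omega> i $ j \<in> {0, 1}"
    and D: "D = (\<Union>p. (\<lambda>I. (+) (grid_shift \<omega> p) ` I) ` standard_dyadic p)"
    using assms unfolding dyadic_grid_def by blast
  define s where "s = grid_shift \<omega>"
  define c where "c p k = s p + (\<chi> j. 2 powi (- p) * of_int (k $ j))" for p and k :: "int^'n"
  \<comment> \<open>Two points share a cube of generation \<open>p\<close> exactly when they share
    this index, so the geometry becomes integer arithmetic.\<close>
  define ix where "ix p x = (\<chi> j. \<lfloor>(x $ j - s p $ j) * 2 powi p\<rfloor>)" for p and x :: "real^'n"
  define Q where "Q p x = cube (c p (ix p x)) (2 powi (- p))" for p x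
  have inv: "(2 powi (- p) :: real) = inverse (2 powi p)" for p by (simp add: power_int_minus)
  have mem: "y \<in> cube (c p k) (2 powi (- p)) \<longleftrightarrow> ix p y = k" for y p k
  proof -
    have "c p k $ j \<le> y $ j \<and> y $ j < c p k $ j + 2 powi (- p) \<longleftrightarrow> \<lfloor>(y $ j - s p $ j) * 2 powi p\<rfloor> = k $ j" for j
    proof -
      have "0 < (2 powi p :: real)" by simp
      then show ?thesis
        unfolding floor_eq_iff inv c_def by (simp add: field_simps)
    qed
    then show ?thesis by (simp add: cube_def ix_def vec_eq_iff)
  qed
  have lvl: "(\<lambda>I. (+) (grid_shift \<omega> p) ` I) ` standard_dyadic p = range (Q p)" for p
  proof -
    have "(\<lambda>I. (+) (grid_shift \<omega> p) ` I) ` standard_dyadic p = range (\<lambda>k. cube (c p k) (2 powi (- p)))"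
      unfolding standard_dyadic_def image_image by (simp add: translate_cube c_def s_def)
    also have "\<dots> = range (Q p)"
    proof
      show "range (\<lambda>k. cube (c p k) (2 powi (- p))) \<subseteq> range (Q p)"
      proof (rule image_subsetI)
        fix k
        have "c p k \<in> cube (c p k) (2 powi (- p))" by (simp add: cube_def)
        then have "ix p (c p k) = k" using mem by blast
        then have "cube (c p k) (2 powi (- p)) = Q p (c p k)" by (simp add: Q_def)
        then show "cube (c p k) (2 powi (- p)) \<in> range (Q p)" by blast
      qed
      show "range (Q p) \<subseteq> range (\<lambda>k. cube (c p k) (2 powi (- p)))" by (auto simp: Q_def)
    qed
    finally show ?thesis .
  qed
  \<comment> \<open>Consecutive shifts differ by a bit times half the coarser side, and taking the
    floor of \<open>(a - of_int w) / 2\<close> amounts to integer division of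
    \<open>\<lfloor>a\<rfloor> - w\<close> by 2.\<close>
  have parent: "ix p x $ j = (ix (p + 1) x $ j - \<lfloor>\<omega> (p + 1) $ j\<rfloor>) div 2" for p x j
  proof -
    define w where "w = \<lfloor>\<omega> (p + 1) $ j\<rfloor>"
    have w: "\<omega> (p + 1) $ j = of_int w" using \<omega>[of "p + 1" j] by (auto simp: w_def)
    define a where "a = (x $ j - s (p + 1) $ j) * 2 powi (p + 1)"
    have "s p $ j = 2 powi (- (p + 1)) * of_int w + s (p + 1) $ j"
      unfolding s_def using grid_shift_succ[of \<omega> p, OF \<omega>] w by simp
    moreover have "(2 powi (p + 1) :: real) = 2 * 2 powi p" by (simp add: power_int_add)
    ultimately have "(x $ j - s p $ j) * 2 powi p = (a - of_int w) / 2"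
      unfolding a_def inv by (simp add: field_simps)
    also have "\<lfloor>(a - of_int w) / 2\<rfloor> = \<lfloor>a - of_int w\<rfloor> div 2"
      using floor_divide_real_eq_div[of 2 "a - of_int w"] by simp
    also have "\<lfloor>a - of_int w\<rfloor> = \<lfloor>a\<rfloor> - w" by simp
    finally show ?thesis by (simp add: ix_def a_def w_def)
  qed
  have filt: "dyadic_filtration Q (\<lambda>p. (2 powi (- p)) ^ CARD('n)) (2 ^ CARD('n))"
  proof
    fix p x y
    show "x \<in> Q p x" unfolding Q_def mem ..
    show "y \<in> Q p x \<Longrightarrow> Q p y = Q p x" unfolding Q_def mem by simp
    show "Q (p + 1) x \<subseteq> Q p x"
      unfolding Q_def subset_iff mem by (metis parent vec_eq_iff)
    show "Q p x \<in> sets borel" unfolding Q_def by (rule cube_borel) simp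
    show "emeasure lborel (Q p x) = ennreal ((2 powi (- p)) ^ CARD('n))" unfolding Q_def by (rule emeasure_cube) simp
    show "0 < (2 powi (- p) :: real) ^ CARD('n)" by simp
    have "(2 powi (- p) :: real) = 2 * 2 powi (- (p + 1))"
      using power_int_add[of "2::real" 1 "- (p + 1)"] by simp
    then show "(2 powi (- p) :: real) ^ CARD('n) = 2 ^ CARD('n) * (2 powi (- (p + 1))) ^ CARD('n)"
      by (simp only: power_mult_distrib)
    show "1 < (2 ^ CARD('n) :: real)" by (intro one_less_power) auto
    show "countable (range (Q p))"
    proof -
      have "range (Q p) \<subseteq> (\<lambda>k. cube (c p k) (2 powi (- p))) ` UNIV" unfolding Q_def by auto
      then show ?thesis by (rule countable_subset) simp
    qed
  qed
  interpret dyadic_filtration Q "\<lambda>p. (2 powi (- p)) ^ CARD('n)" "2 ^ CARD('n)" by (rule filt)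
  have cub: "D = cubes" unfolding D lvl cubes_def ..
  show ?thesis
  proof (intro exI, unfold_locales)
    show "D = cubes" by (rule cub)
    fix p x
    show ex: "\<exists>u. Q p x = cube u (2 powi (- p))" unfolding Q_def by blast
    show "generation D p = range (Q p)"
    proof
      show "range (Q p) \<subseteq> generation D p" by (auto simp: generation_def cub Q_def[symmetric]) (auto simp: Q_def)
      show "generation D p \<subseteq> range (Q p)"
      proof
        fix I assume "I \<in> generation D p"
        then obtain q y u where "I = Q q y" "I = cube u (2 powi (- p))" by (auto simp: generation_def cub cubes_def)
        moreover from this have "q = p" unfolding Q_def by (metis cube_side_inj)
        ultimately show "I \<in> range (Q p)" by simp
      qed
    qed
    show "cube_level (Q p x) = p"
      unfolding cube_level_def
    proof (rule the_equality)
      fix q assume "\<exists>u. Q p x = cube u (2 powi (- q))"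
      then show "q = p" using ex cube_side_inj by metis
    qed (rule ex)
  qed
qed

section \<open>Adapted differences as wavelet sums\<close>

context grid
begin

lemma cube_level_eq: "K \<in> cubes \<Longrightarrow> cube_level K = level K"
  by (metis cubesE cube_level_Q)

lemma avg_gen_eq:
  "avg_gen D b p f x = (LINT y:Q p x|lborel. f y * b y) / (LINT y:Q p x|lborel. b y)"
proof -
  have "avg_gen D b p f x = (\<Sum>\<^sub>\<infinity>I\<in>{Q p x}. (LINT y:I|lborel. f y * b y) / (LINT y:I|lborel. b y) * indicator I x)"
    unfolding avg_gen_def generation_eq
  proof (rule infsum_cong_neutral)
    fix I assume "I \<in> range (Q p) - {Q p x}"
    then obtain y where "I = Q p y" "I \<noteq> Q p x" by blast
    then have "x \<notin> I" using Q_eq by metis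
    then show "(LINT y:I|lborel. f y * b y) / (LINT y:I|lborel. b y) * indicator I x = 0" by simp
  qed auto
  then show ?thesis using in_Q by simp
qed

lemma avg_cube_eq:
  assumes "K \<in> cubes"
  shows "avg_cube D b K f x = indicator K x * pairing f (bump b K)"
  unfolding avg_cube_def avg_gen_eq cube_level_eq[OF assms] pairing_bump
  by (cases "x \<in> K") (simp_all add: Q_level_eq[OF assms])

lemma sum_ch_indicator:
  fixes P :: "(real^'n) set \<Rightarrow> 'c::semiring_1"
  assumes K: "K \<in> cubes"
  shows "x \<in> K \<Longrightarrow> (\<Sum>J\<in>ch K. indicator J x * P J) = P (Q (level K + 1) x)"
    and "x \<notin> K \<Longrightarrow> (\<Sum>J\<in>ch K. indicator J x * P J) = 0"
proof -
  assume x: "x \<in> K"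
  have "Q (level K + 1) x \<in> ch K" using x by (simp add: ch_def)
  moreover have "x \<notin> J" if "J \<in> ch K" "J \<noteq> Q (level K + 1) x" for J
    using that Q_level_eq[OF ch_in_cubes[OF K]] level_ch[OF K] by metis
  ultimately have "(\<Sum>J\<in>ch K. indicator J x * P J) = (\<Sum>J\<in>{Q (level K + 1) x}. indicator J x * P J)"
    using finite_ch[OF K] by (intro sum.mono_neutral_right) auto
  then show "(\<Sum>J\<in>ch K. indicator J x * P J) = P (Q (level K + 1) x)" using in_Q by simp
next
  assume "x \<notin> K"
  then have "x \<notin> J" if "J \<in> ch K" for J using ch_subset[OF K that] by blast
  then show "(\<Sum>J\<in>ch K. indicator J x * P J) = 0" by (intro sum.neutral) simp
qed

lemma diff_cube_eq:
  assumes K: "K \<in> cubes"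
  shows "diff_cube D b K f x = (\<Sum>J\<in>ch K. indicator J x * osc b J f)"
proof (cases "x \<in> K")
  case True
  have "diff_cube D b K f x = osc b (Q (level K + 1) x) f"
    using True unfolding diff_cube_def diff_gen_def avg_gen_eq cube_level_eq[OF K] osc_def by simp
  then show ?thesis by (simp only: sum_ch_indicator(1)[OF K True])
next
  case False
  then show ?thesis unfolding sum_ch_indicator(2)[OF K False] by (simp add: diff_cube_def)
qed

text \<open>The hypothesis on \<open>P\<close> holds for the wavelet coefficients of any function, because the multiples
  \<open>(\<integral>\<^sub>J b) w\<^sub>J\<close> of the wavelets sum to zero over the children \<open>J\<close> of a cube.\<close>

lemma sum_ch_wav:
  assumes b: "accretive \<kappa> \<beta> b" and K: "K \<in> cubes"
    and P: "(\<Sum>J\<in>ch K. (LINT y:J|lborel. b y) * P J) = 0"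
  shows "(\<Sum>J\<in>ch K. (LINT y:J|lborel. b y) * P J * wav b J x) = b x * (\<Sum>J\<in>ch K. indicator J x * P J)"
proof -
  have "(LINT y:J|lborel. b y) * P J * wav b J x = b x * (indicator J x * P J)
      - b x * indicator K x / (LINT y:K|lborel. b y) * ((LINT y:J|lborel. b y) * P J)" if J: "J \<in> ch K" for J
  proof -
    have "(LINT y:J|lborel. b y) \<noteq> 0" by (rule accretive_integral_nonzero[OF b ch_in_cubes[OF K J]])
    then show ?thesis unfolding wav_def par_ch[OF K J] by (simp add: right_diff_distrib mult_ac)
  qed
  then have "(\<Sum>J\<in>ch K. (LINT y:J|lborel. b y) * P J * wav b J x)
      = (\<Sum>J\<in>ch K. b x * (indicator J x * P J)
      - b x * indicator K x / (LINT y:K|lborel. b y) * ((LINT y:J|lborel. b y) * P J))"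
    by (rule sum.cong[OF refl])
  also have "\<dots> = b x * (\<Sum>J\<in>ch K. indicator J x * P J)
        - b x * indicator K x / (LINT y:K|lborel. b y) * (\<Sum>J\<in>ch K. (LINT y:J|lborel. b y) * P J)"
    by (simp only: sum_subtractf sum_distrib_left)
  finally show ?thesis using P by simp
qed

text \<open>The first parts of the wavelets add up to \<open>b\<close> on \<open>K\<close>, and so
  do the second parts, since the integrals of \<open>b\<close> over the children add up to that over
  \<open>K\<close>. This relation gives the hypothesis of \<open>sum_ch_wav\<close> for wavelet
  coefficients.\<close>

lemma sum_ch_wav_zero:
  assumes b: "accretive \<kappa> \<beta> b" and K: "K \<in> cubes"
  shows "(\<Sum>J\<in>ch K. (LINT y:J|lborel. b y) * wav b J x) = 0"
proof -
  have "(LINT y:J|lborel. b y) * wav b J x = b x * (indicator J x * 1)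
      - b x * indicator K x / (LINT y:K|lborel. b y) * (LINT y:J|lborel. b y)" if J: "J \<in> ch K" for J
  proof -
    have "(LINT y:J|lborel. b y) \<noteq> 0" by (rule accretive_integral_nonzero[OF b ch_in_cubes[OF K J]])
    then show ?thesis unfolding wav_def par_ch[OF K J] by (simp add: right_diff_distrib mult_ac)
  qed
  then have "(\<Sum>J\<in>ch K. (LINT y:J|lborel. b y) * wav b J x)
      = (\<Sum>J\<in>ch K. b x * (indicator J x * 1)
      - b x * indicator K x / (LINT y:K|lborel. b y) * (LINT y:J|lborel. b y))"
    by (rule sum.cong[OF refl])
  also have "\<dots> = b x * (\<Sum>J\<in>ch K. indicator J x * 1)
        - b x * indicator K x / (LINT y:K|lborel. b y) * (\<Sum>J\<in>ch K. LINT y:J|lborel. b y)"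
    by (simp only: sum_subtractf sum_distrib_left)
  also have "(\<Sum>J\<in>ch K. LINT y:J|lborel. b y) = (LINT y:K|lborel. b y)"
    by (rule set_integral_ch[OF K accretive_set_integrable[OF b K], symmetric])
  also have "(\<Sum>J\<in>ch K. indicator J x * 1) = (indicator K x :: complex)"
  proof (cases "x \<in> K")
    case True
    then show ?thesis by (subst sum_ch_indicator(1)[OF K]) simp_all
  next
    case False
    then show ?thesis by (subst sum_ch_indicator(2)[OF K]) simp_all
  qed
  finally show ?thesis using accretive_integral_nonzero[OF b K] by simp
qed

end

locale grid_pair = A: grid Q\<^sub>1 \<mu>\<^sub>1 d\<^sub>1 D1 + B: grid Q\<^sub>2 \<mu>\<^sub>2 d\<^sub>2 D2
  for Q\<^sub>1 :: "int \<Rightarrow> real^'n \<Rightarrow> (real^'n) set" and \<mu>\<^sub>1 d\<^sub>1 D1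
    and Q\<^sub>2 :: "int \<Rightarrow> real^'m \<Rightarrow> (real^'m) set" and \<mu>\<^sub>2 d\<^sub>2 D2

sublocale grid_pair \<subseteq> dyadic_pair Q\<^sub>1 \<mu>\<^sub>1 d\<^sub>1 Q\<^sub>2 \<mu>\<^sub>2 d\<^sub>2 ..

context grid_pair
begin

text \<open>The identity holds at every point although slices lie in \<open>L2\<close> only almost
  everywhere: the inner difference enters the outer one through integrals alone. An everywhere
  equality is what allows rewriting under the functional \<open>a\<close>, which acts on
  functions.\<close>

lemma diff_rect_eq:
  assumes b1: "A.accretive \<kappa>\<^sub>1 \<beta>\<^sub>1 b1" and b2: "B.accretive \<kappa>\<^sub>2 \<beta>\<^sub>2 b2" and f: "f \<in> L2"
    and K: "K \<in> A.cubes" and V: "V \<in> B.cubes"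
  shows "diff_rect D1 D2 b1 b2 K V f (y, z) =
    (\<Sum>J\<in>A.ch K. indicator J y * (\<Sum>L\<in>B.ch V. indicator L z * pairing f (tensor (A.wav b1 J) (B.wav b2 L))))"
proof -
  note fm = measurable_pair_borel[OF L2_measurable[OF f]]
  have [measurable]: "b1 \<in> borel_measurable borel" "b2 \<in> borel_measurable borel"
    using b1 b2 by (auto simp: A.accretive_def B.accretive_def)
  define h where "h y' = (\<Sum>L\<in>B.ch V. indicator L z * B.osc b2 L (\<lambda>z'. f (y', z')))" for y'
  define h' where "h' y' = (\<Sum>L\<in>B.ch V. indicator L z * slice2 f (B.wav b2 L) y')" for y'
  have sl: "slice2 f (B.wav b2 L) \<in> L2" if "L \<in> B.ch V" for L
    using that by (intro slice2_L2[OF f] B.wav_L2[OF b2] B.ch_in_cubes[OF V])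
  have h'L: "h' \<in> L2"
    unfolding h'_def[abs_def] using B.finite_ch[OF V] sl by (intro L2_sum L2_cmult)
  have om: "(\<lambda>y'. B.osc b2 L (\<lambda>z'. f (y', z'))) \<in> borel_measurable borel" if L: "L \<in> B.ch V" for L
  proof -
    have Lc: "L \<in> B.cubes" using B.ch_in_cubes[OF V L] .
    have [measurable]: "L \<in> sets borel" "B.par L \<in> sets borel" using Lc by auto
    note [measurable] = fm
    show ?thesis unfolding B.osc_def set_lebesgue_integral_def by measurable
  qed
  have hm [measurable]: "h \<in> borel_measurable borel"
    unfolding h_def[abs_def] using om by (intro borel_measurable_sum borel_measurable_times) auto
  have [measurable]: "h' \<in> borel_measurable borel" using h'L by (simp add: L2_def)
  \<comment> \<open>On exceptional slices \<open>osc\<close> need not be a pairing; there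
    \<open>h\<close> and \<open>h'\<close> may differ, but only on a null set.\<close>
  have hh: "AE y' in lborel. h y' = h' y'"
    using AE_slice2_L2[OF f]
  proof eventually_elim
    case (elim y')
    have "B.osc b2 L (\<lambda>z'. f (y', z')) = slice2 f (B.wav b2 L) y'" if "L \<in> B.ch V" for L
      unfolding slice2_def by (rule B.osc_eq_pairing[OF b2 elim B.ch_in_cubes[OF V that]])
    then show ?case by (simp add: h_def h'_def)
  qed
  have oh: "A.osc b1 J h = (\<Sum>L\<in>B.ch V. indicator L z * pairing f (tensor (A.wav b1 J) (B.wav b2 L)))"
    if J: "J \<in> A.ch K" for J
  proof -
    have Jc: "J \<in> A.cubes" using A.ch_in_cubes[OF K J] .
    have c: "(LINT y:I|lborel. h y * b1 y) = (LINT y:I|lborel. h' y * b1 y)" if "I \<in> A.cubes" for I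
    proof -
      have [measurable]: "I \<in> sets borel" using that by auto
      show ?thesis unfolding set_lebesgue_integral_def
        by (rule integral_cong_AE) (measurable, use hh in \<open>auto elim!: eventually_mono\<close>)
    qed
    have "A.osc b1 J h = A.osc b1 J h'" unfolding A.osc_def using c[OF Jc] c[OF A.par_in_cubes[OF Jc]] by simp
    also have "\<dots> = pairing h' (A.wav b1 J)" by (rule A.osc_eq_pairing[OF b1 h'L Jc])
    also have "\<dots> = (\<Sum>L\<in>B.ch V. pairing (\<lambda>y'. indicator L z * slice2 f (B.wav b2 L) y') (A.wav b1 J))"
      unfolding h'_def[abs_def] using B.finite_ch[OF V] sl A.wav_L2[OF b1 Jc]
      by (intro pairing_sum_left L2_cmult)
    also have "\<dots> = (\<Sum>L\<in>B.ch V. indicator L z * pairing f (tensor (A.wav b1 J) (B.wav b2 L)))"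
      using pairing_tensor2[OF f A.wav_L2[OF b1 Jc] B.wav_L2[OF b2 B.ch_in_cubes[OF V]]]
      by (intro sum.cong refl) (simp add: pairing_cmult_left)
    finally show ?thesis .
  qed
  have "diff_rect D1 D2 b1 b2 K V f (y, z) = diff_cube D1 b1 K h y"
    unfolding diff_rect_def in_fst_def in_snd_def h_def[abs_def] by (simp add: B.diff_cube_eq[OF V])
  then show ?thesis unfolding A.diff_cube_eq[OF K] using oh by simp
qed

text \<open>The one-variable formula \<open>sum_ch_wav\<close> is used first in \<open>y\<close> and
  then in \<open>z\<close>. Its vanishing condition is linear in the coefficients, so it survives
  the partial sums \<open>R\<close>.\<close>

lemma mult_diff_rect_eq:
  assumes b1: "A.accretive \<kappa>\<^sub>1 \<beta>\<^sub>1 b1" and b2: "B.accretive \<kappa>\<^sub>2 \<beta>\<^sub>2 b2" and f: "f \<in> L2"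
    and K: "K \<in> A.cubes" and V: "V \<in> B.cubes"
  shows "tensor b1 b2 x * diff_rect D1 D2 b1 b2 K V f x =
    (\<Sum>(J, L)\<in>A.ch K \<times> B.ch V. ((LINT y:J|lborel. b1 y) * (LINT z:L|lborel. b2 z) *
        pairing f (tensor (A.wav b1 J) (B.wav b2 L))) * tensor (A.wav b1 J) (B.wav b2 L) x)"
proof -
  obtain y z where x: "x = (y, z)" by fastforce
  define P where "P J L = pairing f (tensor (A.wav b1 J) (B.wav b2 L))" for J L
  define i1 where "i1 J = (LINT y:J|lborel. b1 y)" for J
  define i2 where "i2 L = (LINT z:L|lborel. b2 z)" for L
  have T: "tensor (A.wav b1 J) (B.wav b2 L) \<in> L2" if "J \<in> A.ch K" "L \<in> B.ch V" for J L
    by (intro tensor_L2 A.wav_L2[OF b1] B.wav_L2[OF b2] A.ch_in_cubes[OF K that(1)] B.ch_in_cubes[OF V that(2)])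
  have z1: "(\<Sum>J\<in>A.ch K. i1 J * P J L) = 0" if L: "L \<in> B.ch V" for L
  proof -
    have "(\<Sum>J\<in>A.ch K. i1 J * P J L) = (\<Sum>J\<in>A.ch K. pairing (\<lambda>x. i1 J * tensor (A.wav b1 J) (B.wav b2 L) x) f)"
      by (simp add: P_def pairing_cmult_left pairing_commute[of f])
    also have "\<dots> = pairing (\<lambda>x. \<Sum>J\<in>A.ch K. i1 J * tensor (A.wav b1 J) (B.wav b2 L) x) f"
      using A.finite_ch[OF K] T[OF _ L] f by (intro pairing_sum_left[symmetric] L2_cmult)
    also have "(\<lambda>x. \<Sum>J\<in>A.ch K. i1 J * tensor (A.wav b1 J) (B.wav b2 L) x) = (\<lambda>x. 0)"
    proof
      fix x :: "(real^'n) \<times> (real^'m)"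
      have "(\<Sum>J\<in>A.ch K. i1 J * tensor (A.wav b1 J) (B.wav b2 L) x)
          = (\<Sum>J\<in>A.ch K. i1 J * A.wav b1 J (fst x)) * B.wav b2 L (snd x)"
        by (simp add: tensor_def case_prod_beta' sum_distrib_right mult.assoc)
      then show "(\<Sum>J\<in>A.ch K. i1 J * tensor (A.wav b1 J) (B.wav b2 L) x) = 0"
        using A.sum_ch_wav_zero[OF b1 K] by (simp add: i1_def)
    qed
    finally show ?thesis by (simp add: pairing_def)
  qed
  have z2: "(\<Sum>L\<in>B.ch V. i2 L * P J L) = 0" if J: "J \<in> A.ch K" for J
  proof -
    have "(\<Sum>L\<in>B.ch V. i2 L * P J L) = (\<Sum>L\<in>B.ch V. pairing (\<lambda>x. i2 L * tensor (A.wav b1 J) (B.wav b2 L) x) f)"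
      by (simp add: P_def pairing_cmult_left pairing_commute[of f])
    also have "\<dots> = pairing (\<lambda>x. \<Sum>L\<in>B.ch V. i2 L * tensor (A.wav b1 J) (B.wav b2 L) x) f"
      using B.finite_ch[OF V] T[OF J] f by (intro pairing_sum_left[symmetric] L2_cmult)
    also have "(\<lambda>x. \<Sum>L\<in>B.ch V. i2 L * tensor (A.wav b1 J) (B.wav b2 L) x) = (\<lambda>x. 0)"
    proof
      fix x :: "(real^'n) \<times> (real^'m)"
      have "(\<Sum>L\<in>B.ch V. i2 L * tensor (A.wav b1 J) (B.wav b2 L) x)
          = A.wav b1 J (fst x) * (\<Sum>L\<in>B.ch V. i2 L * B.wav b2 L (snd x))"
        by (simp add: tensor_def case_prod_beta' sum_distrib_left mult_ac)
      then show "(\<Sum>L\<in>B.ch V. i2 L * tensor (A.wav b1 J) (B.wav b2 L) x) = 0"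
        using B.sum_ch_wav_zero[OF b2 V] by (simp add: i2_def)
    qed
    finally show ?thesis by (simp add: pairing_def)
  qed
  define R where "R L = (\<Sum>J\<in>A.ch K. indicator J y * P J L)" for L
  have zR: "(\<Sum>L\<in>B.ch V. i2 L * R L) = 0"
  proof -
    have "(\<Sum>L\<in>B.ch V. i2 L * R L) = (\<Sum>J\<in>A.ch K. indicator J y * (\<Sum>L\<in>B.ch V. i2 L * P J L))"
      unfolding R_def sum_distrib_left by (subst sum.swap) (simp add: mult_ac)
    then show ?thesis using z2 by simp
  qed
  have "(\<Sum>(J, L)\<in>A.ch K \<times> B.ch V. (i1 J * i2 L * P J L) * tensor (A.wav b1 J) (B.wav b2 L) x)
      = (\<Sum>J\<in>A.ch K. \<Sum>L\<in>B.ch V. (i1 J * i2 L * P J L) * (A.wav b1 J y * B.wav b2 L z))"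
    by (simp add: sum.cartesian_product x)
  also have "\<dots> = (\<Sum>L\<in>B.ch V. i2 L * B.wav b2 L z * (\<Sum>J\<in>A.ch K. i1 J * P J L * A.wav b1 J y))"
    by (subst sum.swap) (simp add: sum_distrib_left mult_ac)
  also have "\<dots> = (\<Sum>L\<in>B.ch V. i2 L * B.wav b2 L z * (b1 y * R L))"
    using A.sum_ch_wav[OF b1 K] z1 by (intro sum.cong refl) (simp add: i1_def R_def)
  also have "\<dots> = b1 y * (\<Sum>L\<in>B.ch V. i2 L * R L * B.wav b2 L z)"
    by (simp add: sum_distrib_left mult_ac)
  also have "(\<Sum>L\<in>B.ch V. i2 L * R L * B.wav b2 L z) = b2 z * (\<Sum>L\<in>B.ch V. indicator L z * R L)"
    using B.sum_ch_wav[OF b2 V] zR by (simp add: i2_def)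
  also have "(\<Sum>L\<in>B.ch V. indicator L z * R L) = diff_rect D1 D2 b1 b2 K V f (y, z)"
    unfolding diff_rect_eq[OF b1 b2 f K V] R_def P_def sum_distrib_left by (subst sum.swap) (simp add: mult_ac)
  finally show ?thesis by (simp add: x i1_def i2_def P_def mult.assoc)
qed

end

section \<open>Wavelet sums and product BMO\<close>

text \<open>The real infinite sum is \<open>0\<close> where it diverges, and \<open>enn2real\<close>
  sends infinity to \<open>0\<close>, so the two conventions agree. Measurability and integrals of
  \<open>square_fun\<close> can then be read off from a countable series in
  \<open>ennreal\<close>.\<close>

lemma
  fixes q :: "'i \<Rightarrow> real"
  assumes X: "countable X" "infinite X" and q: "\<And>i. 0 \<le> q i"
  shows infsum_eq_enn2real: "infsum q X = enn2real (\<Sum>k. ennreal (q (from_nat_into X k)))"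
    and summable_on_if_suminf_finite: "(\<Sum>k. ennreal (q (from_nat_into X k))) < \<infinity> \<Longrightarrow> q summable_on X"
proof -
  have bij: "bij_betw (from_nat_into X) UNIV X" by (rule bij_betw_from_nat_into[OF X])
  have re: "infsum q X = infsum (\<lambda>k. q (from_nat_into X k)) UNIV"
    by (rule infsum_reindex_bij_betw[OF bij, symmetric])
  have sre: "q summable_on X \<longleftrightarrow> (\<lambda>k. q (from_nat_into X k)) summable_on UNIV"
    by (rule summable_on_reindex_bij_betw[OF bij, symmetric])
  have siff: "(\<lambda>k. q (from_nat_into X k)) summable_on UNIV \<longleftrightarrow> summable (\<lambda>k. q (from_nat_into X k))"
    by (rule summable_on_UNIV_nonneg_real_iff) (rule q)
  show "q summable_on X" if "(\<Sum>k. ennreal (q (from_nat_into X k))) < \<infinity>"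
    unfolding sre siff using that q by (intro summable_suminf_not_top) simp_all
  show "infsum q X = enn2real (\<Sum>k. ennreal (q (from_nat_into X k)))"
  proof (cases "summable (\<lambda>k. q (from_nat_into X k))")
    case True
    then have s: "(\<lambda>k. q (from_nat_into X k)) sums suminf (\<lambda>k. q (from_nat_into X k))" by (rule summable_sums)
    have "((\<lambda>k. q (from_nat_into X k)) has_sum infsum (\<lambda>k. q (from_nat_into X k)) UNIV) UNIV"
      using True siff by (intro has_sum_infsum) simp
    then have "infsum (\<lambda>k. q (from_nat_into X k)) UNIV = suminf (\<lambda>k. q (from_nat_into X k))"
      using s by (metis has_sum_imp_sums sums_unique2)
    moreover have "(\<Sum>k. ennreal (q (from_nat_into X k))) = ennreal (suminf (\<lambda>k. q (from_nat_into X k)))"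
      by (rule suminf_ennreal_eq[OF _ s]) (rule q)
    moreover have "0 \<le> suminf (\<lambda>k. q (from_nat_into X k))" using q True by (intro suminf_nonneg) simp_all
    ultimately show ?thesis using re by simp
  next
    case False
    then have "(\<Sum>k. ennreal (q (from_nat_into X k))) = top"
      using summable_suminf_not_top[of "\<lambda>k. q (from_nat_into X k)"] q by blast
    moreover have "infsum (\<lambda>k. q (from_nat_into X k)) UNIV = 0"
      using False siff by (intro infsum_not_exists) simp
    ultimately show ?thesis using re by simp
  qed
qed

section \<open>Mean zero and localisation of wavelets\<close>

context dyadic_filtration
begin

lemma accretive_one: "accretive 1 1 (\<lambda>_. 1)"
  unfolding accretive_def
proof (intro conjI ballI)
  fix K assume K: "K \<in> cubes"
  then show "1 * vol K \<le> 1 * cmod (LINT y:K|lborel. 1)"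
    using cubes_fin[OF K] by (simp add: set_lebesgue_integral_def)
qed auto

lemma wav_support: "x \<notin> par J \<Longrightarrow> J \<in> cubes \<Longrightarrow> wav b J x = 0"
  using subset_par[of J] by (cases "x \<in> J") (auto simp: wav_def)

lemma wav_integrable:
  assumes b: "accretive \<kappa> \<beta> b" and J: "J \<in> cubes"
  shows "integrable lborel (wav b J)" and "(LINT x|lborel. wav b J x) = 0"
proof -
  have bi: "integrable lborel (bump b I)" and be: "(LINT x|lborel. bump b I x) = 1" if I: "I \<in> cubes" for I
  proof -
    have eq: "bump b I = (\<lambda>x. indicator I x *\<^sub>R b x / (LINT y:I|lborel. b y))"
      by (auto simp: bump_def fun_eq_iff split: split_indicator)
    show "integrable lborel (bump b I)"
      using accretive_set_integrable[OF b I] unfolding eq set_integrable_def by simp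
    show "(LINT x|lborel. bump b I x) = 1"
      unfolding eq using accretive_integral_nonzero[OF b I] by (simp add: set_lebesgue_integral_def)
  qed
  note P = par_in_cubes[OF J]
  show "integrable lborel (wav b J)" unfolding wav_bump[abs_def] by (intro Bochner_Integration.integrable_diff bi J P)
  show "(LINT x|lborel. wav b J x) = 0" unfolding wav_bump[abs_def] using bi[OF J] bi[OF P] be[OF J] be[OF P] by simp
qed

text \<open>Both \<open>J\<close> and its parent contain \<open>y\<close>, so neither lies inside
  \<open>par J0\<close>; each either contains \<open>par J0\<close> or misses it. Hence the
  classical wavelet of \<open>J\<close> is constant on \<open>par J0\<close>, where the adapted
  wavelet of \<open>J0\<close> has mean zero.\<close>

lemma pairing_wav_wav_eq_0:
  assumes b: "accretive \<kappa> \<beta> b" and J0: "J0 \<in> cubes" and J: "J \<in> cubes" and y: "y \<in> J" "y \<notin> par J0"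
  shows "pairing (wav b J0) (wav (\<lambda>_. 1) J) = 0"
proof -
  define u where "u = wav b J0"
  have supp: "u x = 0" if "x \<notin> par J0" for x unfolding u_def by (rule wav_support[OF that J0])
  have S0: "(LINT x:S|lborel. u x) = 0" if "par J0 \<inter> S = {} \<or> par J0 \<subseteq> S" for S
    using that
  proof
    assume "par J0 \<inter> S = {}"
    then have "(\<lambda>x. indicator S x *\<^sub>R u x) = (\<lambda>x. 0)"
      using supp by (auto simp: fun_eq_iff split: split_indicator)
    then show ?thesis by (simp add: set_lebesgue_integral_def)
  next
    assume "par J0 \<subseteq> S"
    then have "(\<lambda>x. indicator S x *\<^sub>R u x) = u"
      using supp by (auto simp: fun_eq_iff split: split_indicator)
    then show ?thesis using wav_integrable(2)[OF b J0] by (simp add: set_lebesgue_integral_def u_def)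
  qed
  have P0: "par J0 \<in> cubes" and P: "par J \<in> cubes" using J0 J by auto
  have dich: "par J0 \<inter> J = {} \<or> par J0 \<subseteq> J"
  proof (cases "level J \<le> level (par J0)")
    case True
    then show ?thesis using nested[OF J P0] by blast
  next
    case False
    then show ?thesis using nested[OF P0 J] y by (cases "par J0 \<inter> J = {}") auto
  qed
  have dichP: "par J0 \<inter> par J = {} \<or> par J0 \<subseteq> par J"
  proof (cases "level (par J) \<le> level (par J0)")
    case True
    then show ?thesis using nested[OF P P0] by blast
  next
    case False
    then show ?thesis using nested[OF P0 P] y subset_par[OF J] by (cases "par J0 \<inter> par J = {}") auto
  qed
  have "osc (\<lambda>_. 1) J u = 0"
    unfolding osc_def using S0[OF dich] S0[OF dichP] by simp
  then show ?thesis
    using osc_eq_pairing[OF accretive_one wav_L2[OF b J0] J] by (simp add: u_def)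
qed

end

section \<open>Wavelet sums in the Hardy space\<close>

context grid_pair
begin

abbreviation wavelet :: "(real^'n \<Rightarrow> complex) \<Rightarrow> (real^'m \<Rightarrow> complex) \<Rightarrow> (real^'n) set \<times> (real^'m) set \<Rightarrow> (real^'n) \<times> (real^'m) \<Rightarrow> complex" where
  "wavelet b1 b2 i \<equiv> tensor (A.wav b1 (fst i)) (B.wav b2 (snd i))"

definition wsum :: "(real^'n \<Rightarrow> complex) \<Rightarrow> (real^'m \<Rightarrow> complex) \<Rightarrow> ((real^'n) set \<times> (real^'m) set) set \<Rightarrow>
    ((real^'n) set \<times> (real^'m) set \<Rightarrow> complex) \<Rightarrow> (real^'n) \<times> (real^'m) \<Rightarrow> complex" where
  "wsum b1 b2 F z x = (\<Sum>i\<in>F. z i * wavelet b1 b2 i x)"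

lemma vol2_pos: "i \<in> A.cubes \<times> B.cubes \<Longrightarrow> 0 < vol2 i"
  using A.vol_pos B.vol_pos by auto

lemma wavelet_L2:
  assumes "A.accretive \<kappa>\<^sub>1 \<beta>\<^sub>1 b1" "B.accretive \<kappa>\<^sub>2 \<beta>\<^sub>2 b2" "i \<in> A.cubes \<times> B.cubes"
  shows "wavelet b1 b2 i \<in> L2"
  using assms by (auto intro!: tensor_L2 A.wav_L2 B.wav_L2)

lemma wsum_L2:
  assumes "A.accretive \<kappa>\<^sub>1 \<beta>\<^sub>1 b1" "B.accretive \<kappa>\<^sub>2 \<beta>\<^sub>2 b2" "finite F" "F \<subseteq> A.cubes \<times> B.cubes"
  shows "wsum b1 b2 F z \<in> L2"
  unfolding wsum_def[abs_def] using assms by (intro L2_sum L2_cmult wavelet_L2) auto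

text \<open>The dual of \<open>square_estimate2\<close>: pairing with \<open>g\<close> and
  Cauchy-Schwarz with weights \<open>vol2 i\<close>. The constant is the root of
  \<open>40 * \<kappa>\<^sub>1 ^ 4 * (40 * \<kappa>\<^sub>2 ^ 4)\<close>.\<close>

lemma wsum_norm_le:
  assumes b1: "A.accretive \<kappa>\<^sub>1 \<beta>\<^sub>1 b1" and b2: "B.accretive \<kappa>\<^sub>2 \<beta>\<^sub>2 b2"
    and F: "finite F" "F \<subseteq> A.cubes \<times> B.cubes"
  shows "L2_norm (wsum b1 b2 F z) \<le> 40 * \<kappa>\<^sub>1\<^sup>2 * \<kappa>\<^sub>2\<^sup>2 * sqrt (\<Sum>i\<in>F. (cmod (z i))\<^sup>2 / vol2 i)"
proof (rule L2_norm_le_by_duality[OF wsum_L2[OF b1 b2 F]])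
  define T where "T = (\<Sum>i\<in>F. (cmod (z i))\<^sup>2 / vol2 i)"
  have T0: "0 \<le> T" unfolding T_def by (intro sum_nonneg) simp
  show "0 \<le> 40 * \<kappa>\<^sub>1\<^sup>2 * \<kappa>\<^sub>2\<^sup>2 * sqrt (\<Sum>i\<in>F. (cmod (z i))\<^sup>2 / vol2 i)" using T0 by (simp add: T_def)
  fix g :: "(real^'n) \<times> (real^'m) \<Rightarrow> complex" assume g: "g \<in> L2"
  define P where "P i = cmod (pairing g (wavelet b1 b2 i))" for i
  have wi: "wavelet b1 b2 i \<in> L2" if "i \<in> F" for i using that F wavelet_L2[OF b1 b2, of i] by blast
  have "pairing (wsum b1 b2 F z) g = (\<Sum>i\<in>F. z i * pairing (wavelet b1 b2 i) g)"
    unfolding wsum_def[abs_def] using F(1) wi g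
    by (subst pairing_sum_left) (simp_all add: L2_cmult pairing_cmult_left)
  then have "cmod (pairing (wsum b1 b2 F z) g) \<le> (\<Sum>i\<in>F. cmod (z i) * P i)"
    unfolding P_def pairing_commute[of g] by (simp only: norm_mult[symmetric] norm_sum)
  also have "\<dots> = (\<Sum>i\<in>F. (cmod (z i) / sqrt (vol2 i)) * (sqrt (vol2 i) * P i))"
  proof (rule sum.cong[OF refl])
    have cancel: "x * p = (x / r) * (r * p)" if "0 < r" for x p r :: real using that by simp
    fix i assume "i \<in> F"
    then have "i \<in> A.cubes \<times> B.cubes" using F by blast
    from vol2_pos[OF this] have "0 < sqrt (vol2 i)" by (simp only: real_sqrt_gt_0_iff)
    then show "cmod (z i) * P i = (cmod (z i) / sqrt (vol2 i)) * (sqrt (vol2 i) * P i)" by (rule cancel)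
  qed
  finally have le: "cmod (pairing (wsum b1 b2 F z) g) \<le> (\<Sum>i\<in>F. (cmod (z i) / sqrt (vol2 i)) * (sqrt (vol2 i) * P i))" .
  have "(\<Sum>i\<in>F. (cmod (z i) / sqrt (vol2 i)) * (sqrt (vol2 i) * P i))\<^sup>2
      \<le> (\<Sum>i\<in>F. (cmod (z i) / sqrt (vol2 i))\<^sup>2) * (\<Sum>i\<in>F. (sqrt (vol2 i) * P i)\<^sup>2)"
    by (rule Cauchy_Schwarz_ineq_sum)
  also have "(\<Sum>i\<in>F. (cmod (z i) / sqrt (vol2 i))\<^sup>2) = T"
    unfolding T_def by (intro sum.cong refl) (simp add: power_divide)
  also have "(\<Sum>i\<in>F. (sqrt (vol2 i) * P i)\<^sup>2) = (\<Sum>(J, L)\<in>F. A.vol J * B.vol L * (cmod (pairing g (tensor (A.wav b1 J) (B.wav b2 L))))\<^sup>2)"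
    by (intro sum.cong refl) (simp add: power_mult_distrib P_def case_prod_beta')
  also have "T * \<dots> \<le> T * (40 * \<kappa>\<^sub>1 ^ 4 * (40 * \<kappa>\<^sub>2 ^ 4) * (L2_norm g)\<^sup>2)"
    by (intro mult_left_mono square_estimate2[OF b1 b2 g F] T0)
  also have "\<dots> = (40 * \<kappa>\<^sub>1\<^sup>2 * \<kappa>\<^sub>2\<^sup>2 * sqrt T * L2_norm g)\<^sup>2"
    using T0 by (simp add: power_mult_distrib)
  finally have "(\<Sum>i\<in>F. (cmod (z i) / sqrt (vol2 i)) * (sqrt (vol2 i) * P i)) \<le> 40 * \<kappa>\<^sub>1\<^sup>2 * \<kappa>\<^sub>2\<^sup>2 * sqrt T * L2_norm g"
    by (rule power2_le_imp_le) (use T0 in simp)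
  then show "cmod (pairing (wsum b1 b2 F z) g) \<le> 40 * \<kappa>\<^sub>1\<^sup>2 * \<kappa>\<^sub>2\<^sup>2 * sqrt (\<Sum>i\<in>F. (cmod (z i))\<^sup>2 / vol2 i) * L2_norm g"
    using le by (simp add: T_def)
qed

abbreviation haar_diff :: "(real^'n) set \<Rightarrow> (real^'m) set \<Rightarrow> ((real^'n) \<times> (real^'m) \<Rightarrow> complex) \<Rightarrow> (real^'n) \<times> (real^'m) \<Rightarrow> complex" where
  "haar_diff \<equiv> diff_rect D1 D2 (\<lambda>_. 1) (\<lambda>_. 1)"

text \<open>At most one child rectangle contains a given point, so the square of the difference has
  no mixed terms and integrates term by term.\<close>

lemma nn_integral_diff_rect:
  assumes f: "f \<in> L2" and K: "K \<in> A.cubes" and V: "V \<in> B.cubes"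
  shows "(\<lambda>x. (cmod (haar_diff K V f x))\<^sup>2) \<in> borel_measurable borel"
    and "(\<integral>\<^sup>+x. ennreal ((cmod (haar_diff K V f x))\<^sup>2) \<partial>lborel)
      = ennreal (\<Sum>i\<in>A.ch K \<times> B.ch V. vol2 i * (cmod (pairing f (wavelet (\<lambda>_. 1) (\<lambda>_. 1) i)))\<^sup>2)"
proof -
  define P where "P J L = pairing f (tensor (A.wav (\<lambda>_. 1) J) (B.wav (\<lambda>_. 1) L))" for J L
  note eq = diff_rect_eq[OF A.accretive_one B.accretive_one f K V]
  have pw: "(cmod (haar_diff K V f x))\<^sup>2
      = (\<Sum>i\<in>A.ch K \<times> B.ch V. indicator (fst i \<times> snd i) x * (cmod (P (fst i) (snd i)))\<^sup>2)" for x
  proof -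
    obtain y z where x: "x = (y, z)" by fastforce
    have "(\<Sum>i\<in>A.ch K \<times> B.ch V. indicator (fst i \<times> snd i) x * (cmod (P (fst i) (snd i)))\<^sup>2)
        = (\<Sum>J\<in>A.ch K. \<Sum>L\<in>B.ch V. indicator J y * (indicator L z * (cmod (P J L))\<^sup>2))"
      by (simp add: sum.cartesian_product x indicator_times mult.assoc case_prod_beta')
    also have "\<dots> = (\<Sum>J\<in>A.ch K. indicator J y * (\<Sum>L\<in>B.ch V. indicator L z * (cmod (P J L))\<^sup>2))"
      by (simp only: sum_distrib_left)
    also have "\<dots> = (cmod (\<Sum>J\<in>A.ch K. indicator J y * (\<Sum>L\<in>B.ch V. indicator L z * P J L)))\<^sup>2"
    proof (cases "y \<in> K")
      case y: True
      show ?thesis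
      proof (cases "z \<in> V")
        case True
        show ?thesis unfolding A.sum_ch_indicator(1)[OF K y] B.sum_ch_indicator(1)[OF V True] ..
      next
        case False
        show ?thesis unfolding A.sum_ch_indicator(1)[OF K y] B.sum_ch_indicator(2)[OF V False] by simp
      qed
    next
      case False
      show ?thesis unfolding A.sum_ch_indicator(2)[OF K False] by simp
    qed
    finally show ?thesis unfolding x eq P_def by simp
  qed
  have RL: "fst i \<times> snd i \<in> sets borel" "emeasure lborel (fst i \<times> snd i) = ennreal (vol2 i)"
    if i: "i \<in> A.ch K \<times> B.ch V" for i
  proof -
    have c: "fst i \<in> A.cubes" "snd i \<in> B.cubes"
      using i A.ch_in_cubes[OF K, of "fst i"] B.ch_in_cubes[OF V, of "snd i"] by auto
    then have s: "fst i \<in> sets borel" "snd i \<in> sets borel" by auto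
    have "fst i \<times> snd i \<in> sets (borel \<Otimes>\<^sub>M borel)" using s by (rule pair_measureI)
    then show "fst i \<times> snd i \<in> sets borel" by (simp only: borel_prod)
    have "emeasure (lborel \<Otimes>\<^sub>M lborel) (fst i \<times> snd i) = ennreal (A.vol (fst i)) * ennreal (B.vol (snd i))"
      using s by (subst lborel.emeasure_pair_measure_Times) (simp_all add: A.emeasure_cubes[OF c(1)] B.emeasure_cubes[OF c(2)])
    then show "emeasure lborel (fst i \<times> snd i) = ennreal (vol2 i)"
      by (simp only: lborel_prod ennreal_mult[symmetric] measure_nonneg)
  qed
  have m1: "(\<lambda>x. indicator (fst i \<times> snd i) x * (cmod (P (fst i) (snd i)))\<^sup>2) \<in> borel_measurable borel"
    if "i \<in> A.ch K \<times> B.ch V" for i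
  proof -
    have [measurable]: "fst i \<times> snd i \<in> sets borel" by (rule RL(1)[OF that])
    show ?thesis by measurable
  qed
  show "(\<lambda>x. (cmod (haar_diff K V f x))\<^sup>2) \<in> borel_measurable borel"
    unfolding pw by (intro borel_measurable_sum m1)
  have "(\<integral>\<^sup>+x. ennreal ((cmod (haar_diff K V f x))\<^sup>2) \<partial>lborel)
      = (\<integral>\<^sup>+x. (\<Sum>i\<in>A.ch K \<times> B.ch V. ennreal (indicator (fst i \<times> snd i) x * (cmod (P (fst i) (snd i)))\<^sup>2)) \<partial>lborel)"
    unfolding pw by (intro nn_integral_cong sum_ennreal[symmetric]) simp
  also have "\<dots> = (\<Sum>i\<in>A.ch K \<times> B.ch V. \<integral>\<^sup>+x. ennreal (indicator (fst i \<times> snd i) x * (cmod (P (fst i) (snd i)))\<^sup>2) \<partial>lborel)"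
  proof (rule nn_integral_sum)
    fix i assume "i \<in> A.ch K \<times> B.ch V"
    note [measurable] = m1[OF this]
    show "(\<lambda>x. ennreal (indicator (fst i \<times> snd i) x * (cmod (P (fst i) (snd i)))\<^sup>2)) \<in> borel_measurable lborel"
      by measurable
  qed
  also have "\<dots> = (\<Sum>i\<in>A.ch K \<times> B.ch V. ennreal (vol2 i * (cmod (P (fst i) (snd i)))\<^sup>2))"
  proof (rule sum.cong[OF refl])
    fix i assume i: "i \<in> A.ch K \<times> B.ch V"
    have "(\<integral>\<^sup>+x. ennreal (indicator (fst i \<times> snd i) x * (cmod (P (fst i) (snd i)))\<^sup>2) \<partial>lborel)
        = (\<integral>\<^sup>+x. ennreal ((cmod (P (fst i) (snd i)))\<^sup>2) * indicator (fst i \<times> snd i) x \<partial>lborel)"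
      by (rule nn_integral_cong) (auto split: split_indicator)
    also have "\<dots> = ennreal ((cmod (P (fst i) (snd i)))\<^sup>2) * ennreal (vol2 i)"
      using RL[OF i] by (subst nn_integral_cmult_indicator) simp_all
    finally show "(\<integral>\<^sup>+x. ennreal (indicator (fst i \<times> snd i) x * (cmod (P (fst i) (snd i)))\<^sup>2) \<partial>lborel)
        = ennreal (vol2 i * (cmod (P (fst i) (snd i)))\<^sup>2)"
      by (simp add: ennreal_mult mult.commute)
  qed
  also have "\<dots> = ennreal (\<Sum>i\<in>A.ch K \<times> B.ch V. vol2 i * (cmod (P (fst i) (snd i)))\<^sup>2)"
    by (intro sum_ennreal) simp
  finally show "(\<integral>\<^sup>+x. ennreal ((cmod (haar_diff K V f x))\<^sup>2) \<partial>lborel)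
      = ennreal (\<Sum>i\<in>A.ch K \<times> B.ch V. vol2 i * (cmod (pairing f (wavelet (\<lambda>_. 1) (\<lambda>_. 1) i)))\<^sup>2)"
    by (simp add: P_def)
qed

lemma children_disjoint:
  assumes "K \<in> A.cubes" "V \<in> B.cubes" "K' \<in> A.cubes" "V' \<in> B.cubes" "(K, V) \<noteq> (K', V')"
  shows "(A.ch K \<times> B.ch V) \<inter> (A.ch K' \<times> B.ch V') = {}"
proof (rule ccontr)
  assume "\<not> ?thesis"
  then obtain J L where "J \<in> A.ch K" "J \<in> A.ch K'" "L \<in> B.ch V" "L \<in> B.ch V'" by blast
  then have "K = K'" "V = V'"
    using A.par_ch[OF assms(1)] A.par_ch[OF assms(3)] B.par_ch[OF assms(2)] B.par_ch[OF assms(4)] by metis+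
  then show False using assms(5) by simp
qed

text \<open>The constant function 1 is accretive with \<kappa> equal to 1, so
  \<open>square_estimate2\<close> applies with \<open>40 * 40 = 1600\<close>. Distinct parent
  rectangles have disjoint families of children, hence finitely many differences amount to one
  finite family of wavelets.\<close>

lemma square_fun_L2:
  assumes f: "f \<in> L2"
  shows "square_fun D1 D2 f \<in> borel_measurable borel"
    and "(\<integral>\<^sup>+x. ennreal ((square_fun D1 D2 f x)\<^sup>2) \<partial>lborel) \<le> ennreal (1600 * (L2_norm f)\<^sup>2)"
    and "AE x in lborel. (\<lambda>(K, V). (cmod (haar_diff K V f x))\<^sup>2) summable_on D1 \<times> D2"
proof -
  define X where "X = D1 \<times> D2"
  have Xc: "X = A.cubes \<times> B.cubes" by (simp add: X_def A.D_eq B.D_eq)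
  have X: "countable X" "infinite X"
  proof -
    show "countable X" unfolding Xc by (intro countable_SIGMA A.countable_cubes B.countable_cubes)
    have "B.cubes \<noteq> {}" using B.infinite_cubes by auto
    then show "infinite X" unfolding Xc using A.infinite_cubes finite_cartesian_productD1 by blast
  qed
  define e where "e = from_nat_into X"
  have bij: "bij_betw e UNIV X" unfolding e_def by (rule bij_betw_from_nat_into[OF X])
  have eX: "fst (e k) \<in> A.cubes" "snd (e k) \<in> B.cubes" for k
  proof -
    have "e k \<in> X" using bij_betwE[OF bij] by blast
    then show "fst (e k) \<in> A.cubes" "snd (e k) \<in> B.cubes" unfolding Xc by (simp_all add: mem_Times_iff)
  qed
  define q where "q i x = (cmod (haar_diff (fst i) (snd i) f x))\<^sup>2" for i x
  have q0: "0 \<le> q i x" for i x by (simp add: q_def)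
  have qcase: "(\<lambda>(K, V). (cmod (haar_diff K V f x))\<^sup>2) = (\<lambda>i. q i x)" for x
    by (simp add: q_def fun_eq_iff)
  have qm [measurable]: "q (e k) \<in> borel_measurable borel" for k
    unfolding q_def[abs_def] by (rule nn_integral_diff_rect(1)[OF f eX])
  define Q where "Q x = (\<Sum>k. ennreal (q (e k) x))" for x
  have Qm [measurable]: "Q \<in> borel_measurable borel" unfolding Q_def[abs_def] by measurable
  have sf: "square_fun D1 D2 f x = sqrt (enn2real (Q x))" for x
  proof -
    have "infsum (\<lambda>i. q i x) X = enn2real (\<Sum>k. ennreal (q (from_nat_into X k) x))"
      by (rule infsum_eq_enn2real[OF X q0])
    then show ?thesis unfolding square_fun_def Q_def e_def qcase X_def by (simp only:)
  qed
  show "square_fun D1 D2 f \<in> borel_measurable borel"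
    unfolding sf[abs_def] by measurable
  define w where "w i = vol2 i * (cmod (pairing f (wavelet (\<lambda>_. 1) (\<lambda>_. 1) i)))\<^sup>2" for i
  define c where "c k = A.ch (fst (e k)) \<times> B.ch (snd (e k))" for k
  have cfin: "finite (c k)" for k unfolding c_def using A.finite_ch[OF eX(1)] B.finite_ch[OF eX(2)] by simp
  have csub: "c k \<subseteq> A.cubes \<times> B.cubes" for k
    unfolding c_def using A.ch_in_cubes[OF eX(1)] B.ch_in_cubes[OF eX(2)] by auto
  have cdis: "c k \<inter> c l = {}" if "k \<noteq> l" for k l
  proof -
    have "e k \<noteq> e l" using that bij by (metis bij_betw_imp_inj_on injD)
    then show ?thesis unfolding c_def by (intro children_disjoint eX) (simp add: prod_eq_iff)
  qed
  have part: "(\<Sum>k<N. \<integral>\<^sup>+x. ennreal (q (e k) x) \<partial>lborel) \<le> ennreal (1600 * (L2_norm f)\<^sup>2)" for N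
  proof -
    have "(\<Sum>k<N. \<integral>\<^sup>+x. ennreal (q (e k) x) \<partial>lborel) = (\<Sum>k<N. ennreal (\<Sum>i\<in>c k. w i))"
      unfolding q_def w_def c_def by (intro sum.cong refl nn_integral_diff_rect(2)[OF f eX])
    also have "\<dots> = ennreal (\<Sum>k<N. \<Sum>i\<in>c k. w i)"
      by (intro sum_ennreal sum_nonneg) (simp add: w_def)
    also have "(\<Sum>k<N. \<Sum>i\<in>c k. w i) = (\<Sum>i\<in>(\<Union>k<N. c k). w i)"
      using cfin cdis by (intro sum.UNION_disjoint[symmetric]) simp_all
    also have "\<dots> = (\<Sum>(J, L)\<in>(\<Union>k<N. c k). A.vol J * B.vol L * (cmod (pairing f (tensor (A.wav (\<lambda>_. 1) J) (B.wav (\<lambda>_. 1) L))))\<^sup>2)"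
      by (simp add: w_def case_prod_beta')
    also have "\<dots> \<le> 40 * 1 ^ 4 * (40 * 1 ^ 4) * (L2_norm f)\<^sup>2"
    proof (rule square_estimate2[OF A.accretive_one B.accretive_one f])
      show "finite (\<Union>k<N. c k)" using cfin by blast
      show "(\<Union>k<N. c k) \<subseteq> A.cubes \<times> B.cubes" using csub by blast
    qed
    finally show ?thesis by (simp add: ennreal_leI)
  qed
  have IQ: "(\<integral>\<^sup>+x. Q x \<partial>lborel) \<le> ennreal (1600 * (L2_norm f)\<^sup>2)"
  proof -
    have "(\<integral>\<^sup>+x. Q x \<partial>lborel) = (\<Sum>k. \<integral>\<^sup>+x. ennreal (q (e k) x) \<partial>lborel)"
      unfolding Q_def by (rule nn_integral_suminf) measurable
    also have "\<dots> \<le> ennreal (1600 * (L2_norm f)\<^sup>2)" by (intro suminf_le_const part) simp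
    finally show ?thesis .
  qed
  have "(\<integral>\<^sup>+x. ennreal ((square_fun D1 D2 f x)\<^sup>2) \<partial>lborel) \<le> (\<integral>\<^sup>+x. Q x \<partial>lborel)"
  proof (rule nn_integral_mono)
    fix x
    have "(square_fun D1 D2 f x)\<^sup>2 = enn2real (Q x)" unfolding sf by simp
    then show "ennreal ((square_fun D1 D2 f x)\<^sup>2) \<le> Q x"
      by (cases "Q x" rule: ennreal_cases) simp_all
  qed
  then show "(\<integral>\<^sup>+x. ennreal ((square_fun D1 D2 f x)\<^sup>2) \<partial>lborel) \<le> ennreal (1600 * (L2_norm f)\<^sup>2)"
    using IQ by (rule order_trans)
  have "(\<integral>\<^sup>+x. Q x \<partial>lborel) \<noteq> \<infinity>" using IQ by (auto simp: top_unique)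
  then have "AE x in lborel. Q x \<noteq> \<infinity>" by (intro nn_integral_PInf_AE) simp_all
  then show "AE x in lborel. (\<lambda>(K, V). (cmod (haar_diff K V f x))\<^sup>2) summable_on D1 \<times> D2"
  proof eventually_elim
    case (elim x)
    then have "(\<lambda>i. q i x) summable_on X"
      unfolding Q_def e_def by (intro summable_on_if_suminf_finite[OF X]) (simp_all add: q0 less_top)
    then show ?case unfolding qcase X_def .
  qed
qed

text \<open>The sum and its classical square function both vanish off the union \<Omega> of the
  parent rectangles. Cauchy-Schwarz on \<Omega> then passes from \<open>L1\<close> to
  \<open>L2\<close>, and 40 is the root of 1600.\<close>

lemma wsum_H1:
  assumes b1: "A.accretive \<kappa>\<^sub>1 \<beta>\<^sub>1 b1" and b2: "B.accretive \<kappa>\<^sub>2 \<beta>\<^sub>2 b2"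
    and F: "finite F" "F \<subseteq> A.cubes \<times> B.cubes"
  shows "wsum b1 b2 F z \<in> dyadic_H1 D1 D2"
    and "dyadic_H1_norm D1 D2 (wsum b1 b2 F z)
      \<le> 40 * sqrt (measure lborel (\<Union>i\<in>F. rect i)) * L2_norm (wsum b1 b2 F z)"
proof -
  define h where "h = wsum b1 b2 F z"
  have h: "h \<in> L2" unfolding h_def by (rule wsum_L2[OF b1 b2 F])
  define \<Omega> where "\<Omega> = (\<Union>i\<in>F. rect i)"
  have Fc: "i \<in> A.cubes \<times> B.cubes" if "i \<in> F" for i using that F by blast
  have Om [measurable]: "\<Omega> \<in> sets borel"
    unfolding \<Omega>_def using F(1) rect_borel[OF Fc] by (intro sets.finite_UN) simp_all
  have "emeasure lborel \<Omega> \<le> (\<Sum>i\<in>F. emeasure lborel (rect i))"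
    unfolding \<Omega>_def using F(1) rect_borel[OF Fc] by (intro emeasure_subadditive_finite) auto
  also have "\<dots> < \<infinity>" using F(1) rect_fin[OF Fc] by simp
  finally have Ofin: "emeasure lborel \<Omega> < \<infinity>" .
  have out: "x \<notin> A.par (fst i) \<times> B.par (snd i)" if "x \<notin> \<Omega>" "i \<in> F" for x i
    using that by (auto simp: \<Omega>_def rect_def)
  have h0: "h x = 0" if x: "x \<notin> \<Omega>" for x
    unfolding h_def wsum_def
  proof (rule sum.neutral, rule ballI)
    fix i assume i: "i \<in> F"
    have c: "fst i \<in> A.cubes" "snd i \<in> B.cubes" using Fc[OF i] by auto
    show "z i * wavelet b1 b2 i x = 0"
      using out[OF x i] A.wav_support[OF _ c(1), of "fst x" b1] B.wav_support[OF _ c(2), of "snd x" b2]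
      by (cases x) auto
  qed
  \<comment> \<open>A point off \<Omega> leaves every parent rectangle in at least one coordinate.
    The pairing of tensor wavelets is a product, and its factor in that coordinate vanishes.\<close>
  have d0: "haar_diff K V h x = 0" if x: "x \<notin> \<Omega>" and K: "K \<in> A.cubes" and V: "V \<in> B.cubes" for x K V
  proof -
    obtain y w where yw: "x = (y, w)" by fastforce
    have z0: "pairing h (tensor (A.wav (\<lambda>_. 1) J) (B.wav (\<lambda>_. 1) L)) = 0"
      if J: "J \<in> A.ch K" "y \<in> J" and L: "L \<in> B.ch V" "w \<in> L" for J L
    proof -
      have Jc: "J \<in> A.cubes" and Lc: "L \<in> B.cubes" using A.ch_in_cubes[OF K J(1)] B.ch_in_cubes[OF V L(1)] by auto
      note wJ = A.wav_L2[OF A.accretive_one Jc] and wL = B.wav_L2[OF B.accretive_one Lc]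
      have "pairing h (tensor (A.wav (\<lambda>_. 1) J) (B.wav (\<lambda>_. 1) L))
          = (\<Sum>i\<in>F. z i * pairing (wavelet b1 b2 i) (tensor (A.wav (\<lambda>_. 1) J) (B.wav (\<lambda>_. 1) L)))"
        unfolding h_def wsum_def[abs_def] using F(1) wavelet_L2[OF b1 b2 Fc] tensor_L2[OF wJ wL]
        by (subst pairing_sum_left) (simp_all add: L2_cmult pairing_cmult_left)
      also have "\<dots> = 0"
      proof (rule sum.neutral, rule ballI)
        fix i assume i: "i \<in> F"
        have c: "fst i \<in> A.cubes" "snd i \<in> B.cubes" using Fc[OF i] by auto
        note wi = A.wav_L2[OF b1 c(1)] B.wav_L2[OF b2 c(2)]
        have "slice1 (wavelet b1 b2 i) (A.wav (\<lambda>_. 1) J) = (\<lambda>v. pairing (A.wav b1 (fst i)) (A.wav (\<lambda>_. 1) J) * B.wav b2 (snd i) v)"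
          by (simp add: slice1_def[abs_def] pairing_def mult.commute[of _ "B.wav b2 (snd i) _"] mult.assoc fun_eq_iff)
        then have "pairing (wavelet b1 b2 i) (tensor (A.wav (\<lambda>_. 1) J) (B.wav (\<lambda>_. 1) L))
            = pairing (A.wav b1 (fst i)) (A.wav (\<lambda>_. 1) J) * pairing (B.wav b2 (snd i)) (B.wav (\<lambda>_. 1) L)"
          unfolding pairing_tensor1[OF tensor_L2[OF wi] wJ wL] by (simp add: pairing_cmult_left)
        moreover have "y \<notin> A.par (fst i) \<or> w \<notin> B.par (snd i)" using out[OF x i] yw by auto
        ultimately show "z i * pairing (wavelet b1 b2 i) (tensor (A.wav (\<lambda>_. 1) J) (B.wav (\<lambda>_. 1) L)) = 0"
          using A.pairing_wav_wav_eq_0[OF b1 c(1) Jc J(2)] B.pairing_wav_wav_eq_0[OF b2 c(2) Lc L(2)] by auto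
      qed
      finally show ?thesis .
    qed
    show ?thesis
      unfolding yw diff_rect_eq[OF A.accretive_one B.accretive_one h K V]
    proof (rule sum.neutral, rule ballI)
      fix J assume J: "J \<in> A.ch K"
      have "(\<Sum>L\<in>B.ch V. indicator L w * pairing h (tensor (A.wav (\<lambda>_. 1) J) (B.wav (\<lambda>_. 1) L))) = 0" if "y \<in> J"
      proof (rule sum.neutral, rule ballI)
        fix L assume "L \<in> B.ch V"
        then show "indicator L w * pairing h (tensor (A.wav (\<lambda>_. 1) J) (B.wav (\<lambda>_. 1) L)) = 0"
          using z0[OF J that] by (cases "w \<in> L") simp_all
      qed
      then show "indicator J y * (\<Sum>L\<in>B.ch V. indicator L w * pairing h (tensor (A.wav (\<lambda>_. 1) J) (B.wav (\<lambda>_. 1) L))) = 0"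
        by (cases "y \<in> J") simp_all
    qed
  qed
  define S where "S = square_fun D1 D2 h"
  have S0: "S x = 0" if "x \<notin> \<Omega>" for x
  proof -
    have "(\<Sum>\<^sub>\<infinity>(K, V)\<in>D1 \<times> D2. (cmod (haar_diff K V h x))\<^sup>2) = 0"
    proof (rule infsum_0)
      fix i assume "i \<in> D1 \<times> D2"
      then have c: "fst i \<in> A.cubes" "snd i \<in> B.cubes" using A.D_eq B.D_eq by auto
      show "(case i of (K, V) \<Rightarrow> (cmod (haar_diff K V h x))\<^sup>2) = 0"
        by (simp add: case_prod_beta' d0[OF that c])
    qed
    then show ?thesis by (simp add: S_def square_fun_def)
  qed
  note Sm = square_fun_L2(1)[OF h, folded S_def] and SI = square_fun_L2(2)[OF h, folded S_def]
  have Ssi: "set_integrable lborel \<Omega> S"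
  proof (rule set_integrable_square[OF Sm Om Ofin])
    show "(\<integral>\<^sup>+x. ennreal ((norm (S x))\<^sup>2) \<partial>lborel) < \<infinity>" using le_less_trans[OF SI] by simp
  qed
  have hsi: "set_integrable lborel \<Omega> h"
    using h by (intro set_integrable_square[OF L2_measurable[OF h] Om Ofin]) (simp add: L2_iff_sq sq_def)
  have indS: "(\<lambda>x. indicator \<Omega> x *\<^sub>R S x) = S" and indh: "(\<lambda>x. indicator \<Omega> x *\<^sub>R h x) = h"
    using S0 h0 by (auto simp: fun_eq_iff split: split_indicator)
  have hi: "integrable lborel h" and Si: "integrable lborel S"
    using hsi Ssi unfolding set_integrable_def indS indh by auto
  show "wsum b1 b2 F z \<in> dyadic_H1 D1 D2"
    unfolding dyadic_H1_def using hi Si square_fun_L2(3)[OF h] by (simp add: h_def S_def)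
  have "ennreal ((norm (LINT x:\<Omega>|lborel. S x))\<^sup>2)
      \<le> emeasure lborel \<Omega> * (\<integral>\<^sup>+x. ennreal ((norm (S x))\<^sup>2) * indicator \<Omega> x \<partial>lborel)"
    by (rule set_integral_CS[OF Sm Om])
  also have "\<dots> \<le> emeasure lborel \<Omega> * (\<integral>\<^sup>+x. ennreal ((S x)\<^sup>2) \<partial>lborel)"
    by (intro mult_left_mono nn_integral_mono) (auto split: split_indicator)
  also have "\<dots> \<le> ennreal (measure lborel \<Omega>) * ennreal (1600 * (L2_norm h)\<^sup>2)"
    using Ofin by (intro mult_mono SI) (simp_all add: emeasure_eq_ennreal_measure)
  also have "\<dots> = ennreal (measure lborel \<Omega> * (1600 * (L2_norm h)\<^sup>2))" by (simp add: ennreal_mult)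
  finally have "(LINT x:\<Omega>|lborel. S x)\<^sup>2 \<le> measure lborel \<Omega> * (1600 * (L2_norm h)\<^sup>2)"
    by (subst (asm) ennreal_le_iff) simp_all
  also have "\<dots> = (40 * sqrt (measure lborel \<Omega>) * L2_norm h)\<^sup>2" by (simp add: power_mult_distrib)
  finally have "(LINT x:\<Omega>|lborel. S x) \<le> 40 * sqrt (measure lborel \<Omega>) * L2_norm h"
    by (rule power2_le_imp_le) simp
  then show "dyadic_H1_norm D1 D2 (wsum b1 b2 F z)
      \<le> 40 * sqrt (measure lborel (\<Union>i\<in>F. rect i)) * L2_norm (wsum b1 b2 F z)"
    unfolding dyadic_H1_norm_def set_lebesgue_integral_def indS by (simp add: h_def S_def \<Omega>_def)
qed

section \<open>The Carleson condition for BMO functionals\<close>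

context
  fixes a :: "((real^'n) \<times> (real^'m) \<Rightarrow> complex) \<Rightarrow> complex"
  assumes a: "a \<in> dyadic_BMO D1 D2"
begin

text \<open>The supremum of reals bounds its members only once the set is known to be bounded above;
  membership in BMO provides this.\<close>

lemma BMO_norm_upper:
  assumes "h \<in> dyadic_H1 D1 D2" "dyadic_H1_norm D1 D2 h \<le> 1"
  shows "cmod (a h) \<le> dyadic_BMO_norm D1 D2 a"
proof -
  obtain M where M: "\<And>h. h \<in> dyadic_H1 D1 D2 \<Longrightarrow> cmod (a h) \<le> M * dyadic_H1_norm D1 D2 h"
    using a unfolding dyadic_BMO_def by blast
  \<comment> \<open>The constant \<open>M\<close> may be negative, so it is replaced by
    \<open>max M 0\<close> before multiplying.\<close>
  have "cmod (a g) \<le> max M 0" if "g \<in> dyadic_H1 D1 D2" "dyadic_H1_norm D1 D2 g \<le> 1" for g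
  proof -
    have "0 \<le> dyadic_H1_norm D1 D2 g"
      unfolding dyadic_H1_norm_def square_fun_def by (intro Bochner_Integration.integral_nonneg real_sqrt_ge_zero infsum_nonneg) auto
    then have "M * dyadic_H1_norm D1 D2 g \<le> max M 0 * 1" using that by (intro mult_mono) auto
    then show ?thesis using M[OF that(1)] by simp
  qed
  then have "bdd_above ((\<lambda>h. cmod (a h)) ` {h \<in> dyadic_H1 D1 D2. dyadic_H1_norm D1 D2 h \<le> 1})"
    by (intro bdd_aboveI2[where M = "max M 0"]) simp
  then show ?thesis
    unfolding dyadic_BMO_norm_def using assms by (intro cSUP_upper) simp_all
qed

lemma BMO_cmult: "h \<in> dyadic_H1 D1 D2 \<Longrightarrow> a (\<lambda>x. z * h x) = z * a h"
  using a unfolding dyadic_BMO_def by blast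

lemma BMO_add: "g \<in> dyadic_H1 D1 D2 \<Longrightarrow> h \<in> dyadic_H1 D1 D2 \<Longrightarrow> a (\<lambda>x. g x + h x) = a g + a h"
  using a unfolding dyadic_BMO_def by blast

context
  fixes b1 b2 \<kappa>\<^sub>1 \<beta>\<^sub>1 \<kappa>\<^sub>2 \<beta>\<^sub>2
  assumes b1: "A.accretive \<kappa>\<^sub>1 \<beta>\<^sub>1 b1" and b2: "B.accretive \<kappa>\<^sub>2 \<beta>\<^sub>2 b2"
begin

lemma wsum_cmult: "(\<lambda>x. r * wsum b1 b2 F z x) = wsum b1 b2 F (\<lambda>i. r * z i)"
  by (simp add: wsum_def fun_eq_iff sum_distrib_left mult.assoc)

lemma BMO_norm_nonneg: "0 \<le> dyadic_BMO_norm D1 D2 a"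
proof -
  have "wsum b1 b2 {} z = (\<lambda>_. 0)" for z by (simp add: wsum_def fun_eq_iff)
  then have "(\<lambda>_. 0) \<in> dyadic_H1 D1 D2" "dyadic_H1_norm D1 D2 (\<lambda>_. 0) \<le> 1"
    using wsum_H1[OF b1 b2, of "{}" "\<lambda>_. 0"] by simp_all
  from BMO_norm_upper[OF this] show ?thesis by (meson norm_ge_zero order_trans)
qed

text \<open>Homogeneity, with division by an arbitrary \<open>N > t\<close> in place of
  \<open>t\<close>, since \<open>t\<close> can vanish. The excess is then sent to zero.\<close>

lemma BMO_wsum_le:
  assumes F: "finite F" "F \<subseteq> A.cubes \<times> B.cubes"
  shows "cmod (a (wsum b1 b2 F z)) \<le> dyadic_BMO_norm D1 D2 a *
    (40 * sqrt (measure lborel (\<Union>i\<in>F. rect i)) * L2_norm (wsum b1 b2 F z))"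
proof -
  define t where "t = 40 * sqrt (measure lborel (\<Union>i\<in>F. rect i)) * L2_norm (wsum b1 b2 F z)"
  have t0: "0 \<le> t" by (simp add: t_def)
  have le: "cmod (a (wsum b1 b2 F z)) \<le> dyadic_BMO_norm D1 D2 a * N" if "t < N" for N
  proof -
    have N: "0 < N" using that t0 by linarith
    define h where "h = wsum b1 b2 F (\<lambda>i. of_real (1 / N) * z i)"
    have h: "h = (\<lambda>x. of_real (1 / N) * wsum b1 b2 F z x)" unfolding h_def by (rule wsum_cmult[symmetric])
    have "L2_norm h = L2_norm (wsum b1 b2 F z) / N"
      unfolding h L2_norm_def using N by (simp add: norm_mult norm_divide power_divide real_sqrt_divide)
    then have "dyadic_H1_norm D1 D2 h \<le> t / N"
      using wsum_H1(2)[OF b1 b2 F, of "\<lambda>i. of_real (1 / N) * z i"] by (simp add: h_def t_def)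
    also have "\<dots> \<le> 1" using that N by simp
    finally have "cmod (a h) \<le> dyadic_BMO_norm D1 D2 a"
      unfolding h_def by (rule BMO_norm_upper[OF wsum_H1(1)[OF b1 b2 F]])
    moreover have "a h = of_real (1 / N) * a (wsum b1 b2 F z)"
      unfolding h by (rule BMO_cmult[OF wsum_H1(1)[OF b1 b2 F]])
    ultimately show ?thesis using N by (simp add: norm_mult norm_divide pos_divide_le_eq)
  qed
  show ?thesis unfolding t_def[symmetric]
  proof (rule field_le_epsilon)
    fix e :: real assume e: "0 < e"
    define n where "n = dyadic_BMO_norm D1 D2 a"
    have n0: "0 \<le> n" unfolding n_def by (rule BMO_norm_nonneg)
    have "cmod (a (wsum b1 b2 F z)) \<le> n * (t + e / (n + 1))"
      unfolding n_def by (rule le) (use e n0 in \<open>simp add: n_def add_nonneg_pos\<close>)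
    also have "\<dots> = n * t + e * (n / (n + 1))" by (simp add: distrib_left)
    also have "\<dots> \<le> n * t + e * 1" using e n0 by (intro add_left_mono mult_left_mono) simp_all
    finally show "cmod (a (wsum b1 b2 F z)) \<le> dyadic_BMO_norm D1 D2 a * t + e" by (simp add: n_def)
  qed
qed

lemma wavelet_H1:
  assumes "i \<in> A.cubes \<times> B.cubes" shows "wavelet b1 b2 i \<in> dyadic_H1 D1 D2"
proof -
  have "wavelet b1 b2 i = wsum b1 b2 {i} (\<lambda>_. 1)" by (simp add: wsum_def fun_eq_iff)
  then show ?thesis using wsum_H1(1)[OF b1 b2, of "{i}"] assms by simp
qed

lemma BMO_wsum:
  assumes "finite F" "F \<subseteq> A.cubes \<times> B.cubes"
  shows "a (wsum b1 b2 F z) = (\<Sum>i\<in>F. z i * a (wavelet b1 b2 i))"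
  using assms
proof (induction F rule: finite_induct)
  \<comment> \<open>Homogeneity with the scalar \<open>0\<close> shows that \<open>a\<close>
    vanishes at the zero function.\<close>
  case empty
  have H: "wsum b1 b2 {} z \<in> dyadic_H1 D1 D2" by (rule wsum_H1(1)[OF b1 b2]) simp_all
  have "a (\<lambda>x. 0 * wsum b1 b2 {} z x) = 0 * a (wsum b1 b2 {} z)" by (rule BMO_cmult[OF H])
  then show ?case by (simp add: wsum_def[abs_def])
next
  case (insert i F)
  have i: "i \<in> A.cubes \<times> B.cubes" and F: "F \<subseteq> A.cubes \<times> B.cubes" using insert.prems by auto
  have si: "(\<lambda>x. z i * wavelet b1 b2 i x) \<in> dyadic_H1 D1 D2"
  proof -
    have "(\<lambda>x. z i * wavelet b1 b2 i x) = wsum b1 b2 {i} z" by (simp add: wsum_def fun_eq_iff)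
    then show ?thesis using wsum_H1(1)[OF b1 b2, of "{i}"] i by simp
  qed
  have "wsum b1 b2 (insert i F) z = (\<lambda>x. z i * wavelet b1 b2 i x + wsum b1 b2 F z x)"
    using insert.hyps by (simp add: wsum_def fun_eq_iff)
  then have "a (wsum b1 b2 (insert i F) z) = a (\<lambda>x. z i * wavelet b1 b2 i x) + a (wsum b1 b2 F z)"
    using BMO_add[OF si wsum_H1(1)[OF b1 b2 insert.hyps(1) F]] by simp
  then show ?case
    using insert BMO_cmult[OF wavelet_H1[OF i], of "z i"] F by simp
qed

text \<open>Testing \<open>a\<close> on the sum with coefficients \<open>z\<close> gives back
  exactly the sum \<open>T\<close> to be bounded, while the norm of that test function is at most a
  multiple of the root of \<open>T\<close>. Dividing by this root leaves the claim; 1600 is the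
  product of the factors 40 from \<open>wsum_H1\<close> and \<open>wsum_norm_le\<close>.\<close>

lemma BMO_carleson:
  assumes F: "finite F" "F \<subseteq> A.cubes \<times> B.cubes"
  shows "(\<Sum>i\<in>F. vol2 i * (cmod (a (wavelet b1 b2 i)))\<^sup>2)
    \<le> (1600 * \<kappa>\<^sub>1\<^sup>2 * \<kappa>\<^sub>2\<^sup>2 * dyadic_BMO_norm D1 D2 a)\<^sup>2 * measure lborel (\<Union>i\<in>F. rect i)"
proof -
  \<comment> \<open>The conjugate makes the values of \<open>a\<close> add up without cancellation,
    and the volume makes the weighted square sum of \<open>z\<close> equal to \<open>T\<close> as
    well.\<close>
  define z where "z i = of_real (vol2 i) * cnj (a (wavelet b1 b2 i))" for i
  define T where "T = (\<Sum>i\<in>F. vol2 i * (cmod (a (wavelet b1 b2 i)))\<^sup>2)"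
  define N where "N = 1600 * \<kappa>\<^sub>1\<^sup>2 * \<kappa>\<^sub>2\<^sup>2 * dyadic_BMO_norm D1 D2 a * sqrt (measure lborel (\<Union>i\<in>F. rect i))"
  have T0: "0 \<le> T" unfolding T_def by (intro sum_nonneg) simp
  have N0: "0 \<le> N" unfolding N_def using BMO_norm_nonneg by simp
  have "a (wsum b1 b2 F z) = of_real T"
    unfolding BMO_wsum[OF F] T_def z_def of_real_sum
    by (intro sum.cong refl) (simp add: complex_norm_square mult_ac del: of_real_power)
  then have "T = cmod (a (wsum b1 b2 F z))" using T0 by simp
  also have "\<dots> \<le> dyadic_BMO_norm D1 D2 a * (40 * sqrt (measure lborel (\<Union>i\<in>F. rect i)) * L2_norm (wsum b1 b2 F z))"
    by (rule BMO_wsum_le[OF F])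
  also have "\<dots> \<le> dyadic_BMO_norm D1 D2 a * (40 * sqrt (measure lborel (\<Union>i\<in>F. rect i)) * (40 * \<kappa>\<^sub>1\<^sup>2 * \<kappa>\<^sub>2\<^sup>2 * sqrt T))"
  proof (intro mult_left_mono BMO_norm_nonneg)
    have "(cmod (z i))\<^sup>2 / vol2 i = vol2 i * (cmod (a (wavelet b1 b2 i)))\<^sup>2" if "i \<in> F" for i
    proof -
      have "vol2 i \<noteq> 0" using F that vol2_pos[of i] by fastforce
      then show ?thesis by (simp add: z_def norm_mult power_mult_distrib power2_eq_square)
    qed
    then have "(\<Sum>i\<in>F. (cmod (z i))\<^sup>2 / vol2 i) = T" unfolding T_def by (rule sum.cong[OF refl])
    then show "L2_norm (wsum b1 b2 F z) \<le> 40 * \<kappa>\<^sub>1\<^sup>2 * \<kappa>\<^sub>2\<^sup>2 * sqrt T"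
      using wsum_norm_le[OF b1 b2 F, of z] by simp
  qed simp
  also have "\<dots> = N * sqrt T" by (simp add: N_def)
  finally have *: "sqrt T * sqrt T \<le> N * sqrt T" using T0 by simp
  have "sqrt T \<le> N"
  proof (cases "T = 0")
    case False
    then have "0 < sqrt T" using T0 by simp
    then show ?thesis using * by (simp only: mult_le_cancel_right_pos)
  qed (use N0 in simp)
  then have "(sqrt T)\<^sup>2 \<le> N\<^sup>2" using T0 by (intro power_mono) simp_all
  then show ?thesis using T0 by (simp add: T_def N_def power_mult_distrib)
qed

end

end

end

section \<open>The paraproduct\<close>

text \<open>The function \<open>mult_diff_BMO\<close> is known only up to null sets, whereas the
  paraproduct integrates it along slices; Fubini for null sets bridges the two.\<close>

lemma AE_slice1_eq:
  assumes f: "f \<in> L2" and g: "g \<in> L2" and eq: "AE x in lborel. f x = g x"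
  shows "AE z in lborel. AE y in lborel. f (y, z) = g (y, z)"
proof -
  define h where "h x = f x - g x" for x
  have h: "h \<in> L2" unfolding h_def[abs_def] by (rule L2_diff[OF f g])
  note hm = measurable_pair_borel[OF L2_measurable[OF h]]
  note [measurable] = hm
  have "sq h = 0"
  proof -
    have "AE x in lborel. ennreal ((cmod (h x))\<^sup>2) = 0" using eq by eventually_elim (simp add: h_def)
    then show ?thesis unfolding sq_def using L2_measurable[OF h] by (subst nn_integral_0_iff_AE) simp_all
  qed
  then have "(\<integral>\<^sup>+z. sq (\<lambda>y. h (y, z)) \<partial>lborel) = 0"
    using sq_slices1[OF L2_measurable[OF h]] by simp
  then have "AE z in lborel. sq (\<lambda>y. h (y, z)) = 0"
    by (subst (asm) nn_integral_0_iff_AE) (simp_all add: sq_def)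
  then show ?thesis
  proof eventually_elim
    case (elim z)
    have [measurable]: "(\<lambda>y. h (y, z)) \<in> borel_measurable borel" by (rule slice_measurable(1)[OF L2_measurable[OF h]])
    have "AE y in lborel. ennreal ((cmod (h (y, z)))\<^sup>2) = 0"
      using elim unfolding sq_def by (subst (asm) nn_integral_0_iff_AE) simp_all
    then show ?case by eventually_elim (simp add: h_def)
  qed
qed

section \<open>Terms and partial sums of the paraproduct\<close>

context grid_pair
begin

context
  fixes a :: "((real^'n) \<times> (real^'m) \<Rightarrow> complex) \<Rightarrow> complex"
    and b1 b1' :: "real^'n \<Rightarrow> complex" and b2 b2' :: "real^'m \<Rightarrow> complex"
    and \<kappa>\<^sub>1 \<beta>\<^sub>1 \<kappa>\<^sub>2 \<beta>\<^sub>2 \<kappa>\<^sub>1' \<beta>\<^sub>1' \<kappa>\<^sub>2' \<beta>\<^sub>2' :: real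
  assumes a: "a \<in> dyadic_BMO D1 D2"
    and b1: "A.accretive \<kappa>\<^sub>1 \<beta>\<^sub>1 b1" and b2: "B.accretive \<kappa>\<^sub>2 \<beta>\<^sub>2 b2"
    and b1': "A.accretive \<kappa>\<^sub>1' \<beta>\<^sub>1' b1'" and b2': "B.accretive \<kappa>\<^sub>2' \<beta>\<^sub>2' b2'"
begin

text \<open>Coefficients of the wavelet expansion that \<open>mult_diff_BMO\<close> has almost
  everywhere.\<close>

definition coef :: "(real^'n) set \<times> (real^'m) set \<Rightarrow> complex" where
  "coef i = (LINT y:fst i|lborel. b1 y) * (LINT z:snd i|lborel. b2 z) * a (wavelet b1 b2 i)"

lemma children_props:
  assumes "K \<in> A.cubes" "V \<in> B.cubes"
  shows "finite (A.ch K \<times> B.ch V)" "A.ch K \<times> B.ch V \<subseteq> A.cubes \<times> B.cubes"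
  using A.finite_ch[OF assms(1)] B.finite_ch[OF assms(2)] A.ch_in_cubes[OF assms(1)] B.ch_in_cubes[OF assms(2)] by auto

text \<open>The wavelet sum with coefficients \<open>coef\<close> represents the required
  functional, because \<open>a\<close> is linear on the finite sum of
  \<open>mult_diff_rect_eq\<close>. It witnesses the choice, and representers in \<open>L2\<close>
  agree almost everywhere.\<close>

lemma mult_diff_BMO_eq:
  assumes K: "K \<in> A.cubes" and V: "V \<in> B.cubes"
  shows "mult_diff_BMO D1 D2 b1 b2 K V a \<in> L2"
    and "AE x in lborel. mult_diff_BMO D1 D2 b1 b2 K V a x = wsum b1 b2 (A.ch K \<times> B.ch V) coef x"
proof -
  define R where "R = A.ch K \<times> B.ch V"
  have R: "finite R" "R \<subseteq> A.cubes \<times> B.cubes" unfolding R_def by (rule children_props[OF K V])+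
  have wi: "wavelet b1 b2 i \<in> L2" if "i \<in> R" for i using that R wavelet_L2[OF b1 b2, of i] by blast
  have w: "wsum b1 b2 R coef \<in> L2" by (rule wsum_L2[OF b1 b2 R])
  have pw: "pairing (wsum b1 b2 R coef) g = a (\<lambda>x. tensor b1 b2 x * diff_rect D1 D2 b1 b2 K V g x)" if g: "g \<in> L2" for g
  proof -
    have "(\<lambda>x. tensor b1 b2 x * diff_rect D1 D2 b1 b2 K V g x) = wsum b1 b2 R
        (\<lambda>i. (LINT y:fst i|lborel. b1 y) * (LINT z:snd i|lborel. b2 z) * pairing g (wavelet b1 b2 i))"
      unfolding mult_diff_rect_eq[OF b1 b2 g K V] wsum_def[abs_def] R_def by (simp add: case_prod_beta')
    then have "a (\<lambda>x. tensor b1 b2 x * diff_rect D1 D2 b1 b2 K V g x)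
        = (\<Sum>i\<in>R. (LINT y:fst i|lborel. b1 y) * (LINT z:snd i|lborel. b2 z) * pairing g (wavelet b1 b2 i) * a (wavelet b1 b2 i))"
      by (simp only: BMO_wsum[OF a b1 b2 R])
    also have "\<dots> = (\<Sum>i\<in>R. coef i * pairing (wavelet b1 b2 i) g)"
      by (intro sum.cong refl) (simp add: coef_def pairing_commute[of g] mult_ac)
    also have "\<dots> = pairing (wsum b1 b2 R coef) g"
      unfolding wsum_def[abs_def] using R(1) wi g
      by (subst pairing_sum_left) (simp_all add: L2_cmult pairing_cmult_left)
    finally show ?thesis by simp
  qed
  have "\<exists>\<phi>. \<phi> \<in> L2 \<and> (\<forall>g\<in>L2. pairing \<phi> g = a (\<lambda>x. tensor b1 b2 x * diff_rect D1 D2 b1 b2 K V g x))"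
    using w pw by blast
  then have s: "mult_diff_BMO D1 D2 b1 b2 K V a \<in> L2 \<and>
      (\<forall>g\<in>L2. pairing (mult_diff_BMO D1 D2 b1 b2 K V a) g = a (\<lambda>x. tensor b1 b2 x * diff_rect D1 D2 b1 b2 K V g x))"
    unfolding mult_diff_BMO_def by (rule someI_ex)
  then show "mult_diff_BMO D1 D2 b1 b2 K V a \<in> L2" by blast
  show "AE x in lborel. mult_diff_BMO D1 D2 b1 b2 K V a x = wsum b1 b2 (A.ch K \<times> B.ch V) coef x"
    unfolding R_def[symmetric] using s pw by (intro pairing_eq_AE w) simp_all
qed

text \<open>After the transposed average in the first variable, only the bump \<open>E\<close>
  depends on that variable. The term is thus a tensor product, whose second factor is almost
  everywhere a combination of the wavelets of the children of \<open>V\<close>.\<close>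

lemma paraproduct_term_pairing:
  assumes K: "K \<in> A.cubes" and V: "V \<in> B.cubes" and f: "f \<in> L2"
  shows "paraproduct_term D1 D2 b1' b2' b1 b2 a f (K, V) \<in> L2"
    and "g \<in> L2 \<Longrightarrow> pairing (paraproduct_term D1 D2 b1' b2' b1 b2 a f (K, V)) g =
      (\<Sum>i\<in>A.ch K \<times> B.ch V. coef i * pairing f (tensor (A.wav b1 (fst i)) (B.bump b2' V))
        * pairing g (tensor (A.bump b1' K) (B.wav b2 (snd i))))"
proof -
  define R where "R = A.ch K \<times> B.ch V"
  have R: "finite R" "R \<subseteq> A.cubes \<times> B.cubes" unfolding R_def by (rule children_props[OF K V])+
  define \<phi> where "\<phi> = mult_diff_BMO D1 D2 b1 b2 K V a"
  define \<phi>0 where "\<phi>0 = wsum b1 b2 R coef"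
  have \<phi>: "\<phi> \<in> L2" unfolding \<phi>_def by (rule mult_diff_BMO_eq(1)[OF K V])
  have \<phi>0: "\<phi>0 \<in> L2" unfolding \<phi>0_def by (rule wsum_L2[OF b1 b2 R])
  have ae: "AE x in lborel. \<phi> x = \<phi>0 x" unfolding \<phi>_def \<phi>0_def R_def by (rule mult_diff_BMO_eq(2)[OF K V])
  define E where "E = A.bump b1' K"
  define e where "e = B.bump b2' V"
  have E: "E \<in> L2" unfolding E_def by (rule A.bump_L2[OF b1' K])
  have e: "e \<in> L2" unfolding e_def by (rule B.bump_L2[OF b2' V])
  define F where "F = slice2 f e"
  have F: "F \<in> L2" unfolding F_def by (rule slice2_L2[OF f e])
  define G where "G z = (LINT y:K|lborel. indicator V z * F y * \<phi> (y, z))" for z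
  define G0 where "G0 z = (\<Sum>i\<in>R. (coef i * pairing f (tensor (A.wav b1 (fst i)) e)) * B.wav b2 (snd i) z)" for z
  have t: "paraproduct_term D1 D2 b1' b2' b1 b2 a f (K, V) = tensor E G"
    unfolding paraproduct_term_def in_fst_def in_snd_def avg_cube_star_def
    by (simp add: B.avg_cube_eq[OF V] fun_eq_iff E_def A.bump_def G_def F_def e_def slice2_def \<phi>_def)
  have iR: "fst i \<in> A.cubes" "snd i \<in> B.cubes" "A.par (fst i) = K" "B.par (snd i) = V" if "i \<in> R" for i
  proof -
    have i: "fst i \<in> A.ch K" "snd i \<in> B.ch V" using that by (auto simp: R_def)
    show "fst i \<in> A.cubes" "snd i \<in> B.cubes" "A.par (fst i) = K" "B.par (snd i) = V"
      using A.ch_in_cubes[OF K i(1)] B.ch_in_cubes[OF V i(2)] A.par_ch[OF K i(1)] B.par_ch[OF V i(2)] by simp_all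
  qed
  have G0: "G0 \<in> L2"
    unfolding G0_def[abs_def] using R(1) iR B.wav_L2[OF b2] by (intro L2_sum L2_cmult) simp_all
  have [measurable]: "K \<in> sets borel" "V \<in> sets borel" using K V by auto
  have [measurable]: "F \<in> borel_measurable borel" by (rule L2_measurable[OF F])
  note \<phi>m = measurable_pair_borel[OF L2_measurable[OF \<phi>]] and \<phi>0m = measurable_pair_borel[OF L2_measurable[OF \<phi>0]]
  have Gm: "G \<in> borel_measurable borel"
  proof -
    note [measurable] = \<phi>m
    show ?thesis unfolding G_def[abs_def] set_lebesgue_integral_def by measurable
  qed
  \<comment> \<open>Off a null set of \<open>z\<close> the chosen function may be replaced by its
    wavelet expansion under the integral. The indicators of \<open>K\<close> and \<open>V\<close>
    are absorbed by the supports of the wavelets, and the remaining integral is a coefficient of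
    \<open>f\<close>.\<close>
  have GG0: "AE z in lborel. G z = G0 z"
    using AE_slice1_eq[OF \<phi> \<phi>0 ae]
  proof eventually_elim
    case (elim z)
    have [measurable]: "(\<lambda>y. \<phi> (y, z)) \<in> borel_measurable borel" "(\<lambda>y. \<phi>0 (y, z)) \<in> borel_measurable borel"
      by (rule slice_measurable(1)[OF L2_measurable[OF \<phi>]] slice_measurable(1)[OF L2_measurable[OF \<phi>0]])+
    have "G z = (LINT y|lborel. indicator K y *\<^sub>R (indicator V z * F y * \<phi>0 (y, z)))"
      unfolding G_def set_lebesgue_integral_def
    proof (rule integral_cong_AE)
      show "AE y in lborel. indicator K y *\<^sub>R (indicator V z * F y * \<phi> (y, z))
          = indicator K y *\<^sub>R (indicator V z * F y * \<phi>0 (y, z))"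
        using elim by eventually_elim simp
    qed measurable
    also have "\<dots> = (LINT y|lborel. (\<Sum>i\<in>R. (coef i * B.wav b2 (snd i) z) * (F y * A.wav b1 (fst i) y)))"
    proof (rule Bochner_Integration.integral_cong[OF refl])
      fix y
      have "indicator K y *\<^sub>R (indicator V z * F y * \<phi>0 (y, z))
          = (\<Sum>i\<in>R. coef i * (indicator V z * B.wav b2 (snd i) z) * (F y * (indicator K y *\<^sub>R A.wav b1 (fst i) y)))"
        by (simp add: \<phi>0_def wsum_def scaleR_conv_of_real sum_distrib_left sum_distrib_right mult_ac)
      also have "\<dots> = (\<Sum>i\<in>R. (coef i * B.wav b2 (snd i) z) * (F y * A.wav b1 (fst i) y))"
      proof (rule sum.cong[OF refl])
        fix i assume i: "i \<in> R"
        have "indicator V z * B.wav b2 (snd i) z = B.wav b2 (snd i) z"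
          using B.wav_support[of z "snd i" b2] iR[OF i] by (cases "z \<in> V") simp_all
        moreover have "indicator K y *\<^sub>R A.wav b1 (fst i) y = A.wav b1 (fst i) y"
          using A.wav_support[of y "fst i" b1] iR[OF i] by (cases "y \<in> K") simp_all
        ultimately show "coef i * (indicator V z * B.wav b2 (snd i) z) * (F y * (indicator K y *\<^sub>R A.wav b1 (fst i) y))
            = (coef i * B.wav b2 (snd i) z) * (F y * A.wav b1 (fst i) y)" by simp
      qed
      finally show "indicator K y *\<^sub>R (indicator V z * F y * \<phi>0 (y, z))
          = (\<Sum>i\<in>R. (coef i * B.wav b2 (snd i) z) * (F y * A.wav b1 (fst i) y))" .
    qed
    also have "\<dots> = (\<Sum>i\<in>R. (LINT y|lborel. (coef i * B.wav b2 (snd i) z) * (F y * A.wav b1 (fst i) y)))"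
      using L2_mult_integrable[OF F A.wav_L2[OF b1]] iR
      by (intro Bochner_Integration.integral_sum integrable_mult_right) simp
    also have "\<dots> = (\<Sum>i\<in>R. (coef i * B.wav b2 (snd i) z) * pairing F (A.wav b1 (fst i)))"
      unfolding pairing_def by simp
    also have "\<dots> = G0 z"
      unfolding G0_def F_def
    proof (rule sum.cong[OF refl])
      fix i assume i: "i \<in> R"
      have "pairing f (tensor (A.wav b1 (fst i)) e) = pairing (slice2 f e) (A.wav b1 (fst i))"
        by (rule pairing_tensor2[OF f A.wav_L2[OF b1 iR(1)[OF i]] e])
      then show "(coef i * B.wav b2 (snd i) z) * pairing (slice2 f e) (A.wav b1 (fst i))
          = (coef i * pairing f (tensor (A.wav b1 (fst i)) e)) * B.wav b2 (snd i) z" by (simp add: mult_ac)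
    qed
    finally show ?case .
  qed
  have G: "G \<in> L2"
  proof (rule L2_bounded_mult[OF G0 Gm])
    show "AE z in lborel. cmod (G z) \<le> 1 * cmod (G0 z)" using GG0 by eventually_elim simp
  qed
  show "paraproduct_term D1 D2 b1' b2' b1 b2 a f (K, V) \<in> L2"
    unfolding t by (rule tensor_L2[OF E G])
  assume g: "g \<in> L2"
  have "pairing (tensor E G) g = pairing G (slice1 g E)"
    unfolding pairing_commute[of _ g] pairing_tensor1[OF g E G] by (rule pairing_commute)
  also have "\<dots> = pairing G0 (slice1 g E)" by (rule pairing_cong_AE[OF G G0 slice1_L2[OF g E] GG0])
  also have "\<dots> = (\<Sum>i\<in>R. (coef i * pairing f (tensor (A.wav b1 (fst i)) e)) * pairing (B.wav b2 (snd i)) (slice1 g E))"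
    unfolding G0_def[abs_def] using R(1) iR B.wav_L2[OF b2] slice1_L2[OF g E]
    by (subst pairing_sum_left) (simp_all add: L2_cmult pairing_cmult_left)
  also have "\<dots> = (\<Sum>i\<in>R. coef i * pairing f (tensor (A.wav b1 (fst i)) e) * pairing g (tensor E (B.wav b2 (snd i))))"
  proof (rule sum.cong[OF refl])
    fix i assume i: "i \<in> R"
    show "(coef i * pairing f (tensor (A.wav b1 (fst i)) e)) * pairing (B.wav b2 (snd i)) (slice1 g E)
        = coef i * pairing f (tensor (A.wav b1 (fst i)) e) * pairing g (tensor E (B.wav b2 (snd i)))"
      unfolding pairing_tensor1[OF g E B.wav_L2[OF b2 iR(2)[OF i]]] pairing_commute[of "B.wav b2 (snd i)"] ..
  qed
  finally show "pairing (paraproduct_term D1 D2 b1' b2' b1 b2 a f (K, V)) g =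
      (\<Sum>i\<in>A.ch K \<times> B.ch V. coef i * pairing f (tensor (A.wav b1 (fst i)) (B.bump b2' V))
        * pairing g (tensor (A.bump b1' K) (B.wav b2 (snd i))))"
    unfolding t R_def E_def e_def .
qed

text \<open>The absolute values of the integrals in \<open>coef\<close> are at most
  \<open>\<beta>\<^sub>1\<close> and \<open>\<beta>\<^sub>2\<close> times volumes; these volumes are
  the weights of the bilinear estimate. \<open>BMO_carleson\<close> supplies its packing
  condition.\<close>

lemma paraproduct_partial_sums:
  assumes f: "f \<in> L2" and g: "g \<in> L2" and G: "finite G" "G \<subseteq> D1 \<times> D2"
  shows "(\<Sum>i\<in>G. cmod (pairing (paraproduct_term D1 D2 b1' b2' b1 b2 a f i) g))
    \<le> \<beta>\<^sub>1 * \<beta>\<^sub>2 * (4 * (1600 * \<kappa>\<^sub>1\<^sup>2 * \<kappa>\<^sub>2\<^sup>2 * dyadic_BMO_norm D1 D2 a) *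
      (640 * d\<^sub>1 * d\<^sub>2 * \<kappa>\<^sub>1\<^sup>2 * \<kappa>\<^sub>2\<^sup>2 * \<kappa>\<^sub>1' * \<kappa>\<^sub>2' * L2_norm f * L2_norm g))"
proof -
  have \<beta>: "0 < \<beta>\<^sub>1" "0 < \<beta>\<^sub>2" using b1 b2 by (auto simp: A.accretive_def B.accretive_def)
  have Gc: "fst r \<in> A.cubes" "snd r \<in> B.cubes" if "r \<in> G" for r
    using that G A.D_eq B.D_eq by auto
  define R where "R r = A.ch (fst r) \<times> B.ch (snd r)" for r
  have R: "finite (R r)" "R r \<subseteq> A.cubes \<times> B.cubes" if "r \<in> G" for r
    unfolding R_def using children_props[OF Gc[OF that]] by blast+
  define F where "F = (\<Union>r\<in>G. R r)"
  have F: "finite F" "F \<subseteq> A.cubes \<times> B.cubes"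
    unfolding F_def using G(1) R by blast+
  define \<alpha> where "\<alpha> i = cmod (a (wavelet b1 b2 i))" for i
  define u where "u i = vol2 i * (\<alpha> i * (cmod (pairing f (tensor (A.wav b1 (fst i)) (B.bump b2' (B.par (snd i))))) *
       cmod (pairing g (tensor (A.bump b1' (A.par (fst i))) (B.wav b2 (snd i))))))" for i
  have one: "cmod (pairing (paraproduct_term D1 D2 b1' b2' b1 b2 a f r) g) \<le> (\<Sum>i\<in>R r. \<beta>\<^sub>1 * \<beta>\<^sub>2 * u i)"
    if r: "r \<in> G" for r
  proof -
    have "cmod (pairing (paraproduct_term D1 D2 b1' b2' b1 b2 a f r) g)
        \<le> (\<Sum>i\<in>R r. cmod (coef i * pairing f (tensor (A.wav b1 (fst i)) (B.bump b2' (snd r)))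
          * pairing g (tensor (A.bump b1' (fst r)) (B.wav b2 (snd i)))))"
      using paraproduct_term_pairing(2)[OF Gc[OF r] f g] by (simp add: R_def norm_sum)
    also have "\<dots> \<le> (\<Sum>i\<in>R r. \<beta>\<^sub>1 * \<beta>\<^sub>2 * u i)"
    proof (rule sum_mono)
      fix i assume i: "i \<in> R r"
      have ic: "fst i \<in> A.cubes" "snd i \<in> B.cubes" using R(2)[OF r] i by auto
      have par: "A.par (fst i) = fst r" "B.par (snd i) = snd r"
        using i A.par_ch[OF Gc(1)[OF r], of "fst i"] B.par_ch[OF Gc(2)[OF r], of "snd i"] by (auto simp: R_def)
      have "cmod (coef i) \<le> ((\<beta>\<^sub>1 * A.vol (fst i)) * (\<beta>\<^sub>2 * B.vol (snd i))) * \<alpha> i"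
        unfolding coef_def norm_mult \<alpha>_def
        using \<beta> by (intro mult_right_mono mult_mono A.accretive_integral_le[OF b1 ic(1)] B.accretive_integral_le[OF b2 ic(2)]) simp_all
      then have "cmod (coef i) * (cmod (pairing f (tensor (A.wav b1 (fst i)) (B.bump b2' (snd r))))
          * cmod (pairing g (tensor (A.bump b1' (fst r)) (B.wav b2 (snd i)))))
          \<le> ((\<beta>\<^sub>1 * A.vol (fst i)) * (\<beta>\<^sub>2 * B.vol (snd i))) * \<alpha> i * (cmod (pairing f (tensor (A.wav b1 (fst i)) (B.bump b2' (snd r))))
          * cmod (pairing g (tensor (A.bump b1' (fst r)) (B.wav b2 (snd i)))))"
        by (rule mult_right_mono) simp
      then show "cmod (coef i * pairing f (tensor (A.wav b1 (fst i)) (B.bump b2' (snd r)))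
          * pairing g (tensor (A.bump b1' (fst r)) (B.wav b2 (snd i)))) \<le> \<beta>\<^sub>1 * \<beta>\<^sub>2 * u i"
        unfolding u_def par norm_mult by (simp add: mult_ac)
    qed
    finally show ?thesis .
  qed
  have "(\<Sum>r\<in>G. cmod (pairing (paraproduct_term D1 D2 b1' b2' b1 b2 a f r) g)) \<le> (\<Sum>r\<in>G. \<Sum>i\<in>R r. \<beta>\<^sub>1 * \<beta>\<^sub>2 * u i)"
    by (rule sum_mono[OF one])
  \<comment> \<open>A pair of children determines its parents, so the families of distinct terms are
    disjoint and merge into one sum.\<close>
  also have "\<dots> = (\<Sum>i\<in>F. \<beta>\<^sub>1 * \<beta>\<^sub>2 * u i)"
    unfolding F_def
  proof (rule sum.UNION_disjoint[symmetric, OF G(1)])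
    show "\<forall>r\<in>G. finite (R r)" using R(1) by blast
    show "\<forall>r\<in>G. \<forall>r'\<in>G. r \<noteq> r' \<longrightarrow> R r \<inter> R r' = {}"
      unfolding R_def using Gc by (intro ballI impI children_disjoint) (simp_all add: prod_eq_iff)
  qed
  also have "\<dots> = \<beta>\<^sub>1 * \<beta>\<^sub>2 * (\<Sum>i\<in>F. u i)" by (simp only: sum_distrib_left)
  also have "(\<Sum>i\<in>F. u i) = (\<Sum>(J, L)\<in>F. A.vol J * B.vol L * (\<alpha> (J, L) *
      (cmod (pairing f (tensor (A.wav b1 J) (B.bump b2' (B.par L)))) *
       cmod (pairing g (tensor (A.bump b1' (A.par J)) (B.wav b2 L))))))"
    unfolding u_def by (simp add: case_prod_beta')
  also have "\<beta>\<^sub>1 * \<beta>\<^sub>2 * \<dots> \<le> \<beta>\<^sub>1 * \<beta>\<^sub>2 * (4 * (1600 * \<kappa>\<^sub>1\<^sup>2 * \<kappa>\<^sub>2\<^sup>2 * dyadic_BMO_norm D1 D2 a) *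
      (640 * d\<^sub>1 * d\<^sub>2 * \<kappa>\<^sub>1\<^sup>2 * \<kappa>\<^sub>2\<^sup>2 * \<kappa>\<^sub>1' * \<kappa>\<^sub>2' * L2_norm f * L2_norm g))"
  proof (intro mult_left_mono bilinear_estimate[OF b1 b2 b1' b2' f g F])
    show "0 \<le> \<alpha> i" for i by (simp add: \<alpha>_def)
    show "0 \<le> 1600 * \<kappa>\<^sub>1\<^sup>2 * \<kappa>\<^sub>2\<^sup>2 * dyadic_BMO_norm D1 D2 a"
      using BMO_norm_nonneg[OF a b1 b2] by simp
    show "0 \<le> \<beta>\<^sub>1 * \<beta>\<^sub>2" using \<beta> by simp
    fix H assume "H \<subseteq> F"
    then have H: "finite H" "H \<subseteq> A.cubes \<times> B.cubes" using F finite_subset by blast+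
    show "(\<Sum>i\<in>H. vol2 i * (\<alpha> i)\<^sup>2)
      \<le> (1600 * \<kappa>\<^sub>1\<^sup>2 * \<kappa>\<^sub>2\<^sup>2 * dyadic_BMO_norm D1 D2 a)\<^sup>2 * measure lborel (\<Union>i\<in>H. rect i)"
      unfolding \<alpha>_def by (rule BMO_carleson[OF a b1 b2 H])
  qed
  finally show ?thesis .
qed

text \<open>The bound on sums of absolute pairings yields both the existence of the weak sum and its
  norm. The constant is \<open>4 * 1600 * 640\<close>.\<close>

lemma mixed_paraproduct_bounded:
  assumes f: "f \<in> L2"
  shows "weakly_sums (paraproduct_term D1 D2 b1' b2' b1 b2 a f) (D1 \<times> D2) (mixed_paraproduct D1 D2 b1' b2' b1 b2 a f)"
    and "L2_norm (mixed_paraproduct D1 D2 b1' b2' b1 b2 a f)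
      \<le> 4096000 * d\<^sub>1 * d\<^sub>2 * (\<beta>\<^sub>1 * \<beta>\<^sub>2) * \<kappa>\<^sub>1 ^ 4 * \<kappa>\<^sub>2 ^ 4 * \<kappa>\<^sub>1' * \<kappa>\<^sub>2' * dyadic_BMO_norm D1 D2 a * L2_norm f"
proof -
  define t where "t = paraproduct_term D1 D2 b1' b2' b1 b2 a f"
  define M where "M = 4096000 * d\<^sub>1 * d\<^sub>2 * (\<beta>\<^sub>1 * \<beta>\<^sub>2) * \<kappa>\<^sub>1 ^ 4 * \<kappa>\<^sub>2 ^ 4 * \<kappa>\<^sub>1' * \<kappa>\<^sub>2' * dyadic_BMO_norm D1 D2 a * L2_norm f"
  have pos: "0 < \<beta>\<^sub>1" "0 < \<beta>\<^sub>2" "1 \<le> \<kappa>\<^sub>1" "1 \<le> \<kappa>\<^sub>2" "1 \<le> \<kappa>\<^sub>1'" "1 \<le> \<kappa>\<^sub>2'" "1 < d\<^sub>1" "1 < d\<^sub>2"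
    using b1 b2 b1' b2' A.d_gt_1 B.d_gt_1 by (auto simp: A.accretive_def B.accretive_def)
  have M0: "0 \<le> M" unfolding M_def using pos BMO_norm_nonneg[OF a b1 b2] by simp
  have tL: "t i \<in> L2" if "i \<in> D1 \<times> D2" for i
    using paraproduct_term_pairing(1)[OF _ _ f, of "fst i" "snd i"] that A.D_eq B.D_eq by (auto simp: t_def)
  have bound: "(\<Sum>i\<in>G. cmod (pairing (t i) g)) \<le> M * L2_norm g" if "g \<in> L2" "finite G" "G \<subseteq> D1 \<times> D2" for g G
  proof -
    have eq: "\<beta>\<^sub>1 * \<beta>\<^sub>2 * (4 * (1600 * \<kappa>\<^sub>1\<^sup>2 * \<kappa>\<^sub>2\<^sup>2 * dyadic_BMO_norm D1 D2 a) *
      (640 * d\<^sub>1 * d\<^sub>2 * \<kappa>\<^sub>1\<^sup>2 * \<kappa>\<^sub>2\<^sup>2 * \<kappa>\<^sub>1' * \<kappa>\<^sub>2' * L2_norm f * L2_norm g)) = M * L2_norm g"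
      by (simp add: M_def power2_eq_square power4_eq_xxxx mult_ac)
    show ?thesis unfolding t_def by (rule ord_le_eq_trans[OF paraproduct_partial_sums[OF f that] eq])
  qed
  have "\<exists>T. weakly_sums t (D1 \<times> D2) T" by (rule weakly_unconditional_sums[OF tL bound M0])
  then have ws: "weakly_sums t (D1 \<times> D2) (mixed_paraproduct D1 D2 b1' b2' b1 b2 a f)"
    unfolding mixed_paraproduct_def t_def by (rule someI_ex)
  then show "weakly_sums (paraproduct_term D1 D2 b1' b2' b1 b2 a f) (D1 \<times> D2) (mixed_paraproduct D1 D2 b1' b2' b1 b2 a f)"
    by (simp only: t_def)
  show "L2_norm (mixed_paraproduct D1 D2 b1' b2' b1 b2 a f)
      \<le> 4096000 * d\<^sub>1 * d\<^sub>2 * (\<beta>\<^sub>1 * \<beta>\<^sub>2) * \<kappa>\<^sub>1 ^ 4 * \<kappa>\<^sub>2 ^ 4 * \<kappa>\<^sub>1' * \<kappa>\<^sub>2' * dyadic_BMO_norm D1 D2 a * L2_norm f"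
    using weakly_sums_norm_le[OF ws M0 bound] by (simp only: M_def)
qed

end

end

section \<open>Proof of the theorem\<close>

lemma AE_lborel_exists:
  assumes "AE x in lborel. P x" shows "\<exists>x. P x"
proof (rule eventually_happens'[OF _ assms])
  show "ae_filter lborel \<noteq> bot" by (simp add: ae_filter_eq_bot_iff)
qed

text \<open>The infimum is approached along \<open>1 / real (Suc n)\<close>, so countably many null
  sets suffice. That it is attained keeps the product of the two essential bounds exactly equal to
  \<open>B\<close>.\<close>

lemma AE_le_ess_inf:
  fixes b :: "'a::euclidean_space \<Rightarrow> complex"
  assumes ne: "\<beta>0 \<in> {\<beta>. 0 \<le> \<beta> \<and> (AE x in lborel. cmod (b x) \<le> \<beta>)}"
  shows "AE x in lborel. cmod (b x) \<le> Inf {\<beta>. 0 \<le> \<beta> \<and> (AE x in lborel. cmod (b x) \<le> \<beta>)}"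
proof -
  define E where "E = {\<beta>. 0 \<le> \<beta> \<and> (AE x in lborel. cmod (b x) \<le> \<beta>)}"
  have E: "E \<noteq> {}" "bdd_below E" using ne by (auto simp: E_def bdd_below_def)
  have "AE x in lborel. cmod (b x) \<le> Inf E + 1 / real (Suc n)" for n
  proof -
    obtain \<beta> where "\<beta> \<in> E" "\<beta> < Inf E + 1 / real (Suc n)"
      using cInf_less_iff[OF E, of "Inf E + 1 / real (Suc n)"] by auto
    then show ?thesis unfolding E_def by (auto elim!: eventually_mono)
  qed
  then have "AE x in lborel. \<forall>n. cmod (b x) \<le> Inf E + 1 / real (Suc n)" by (simp add: AE_all_countable)
  then have "AE x in lborel. cmod (b x) \<le> Inf E"
  proof eventually_elim
    case (elim x)
    show ?case
    proof (rule LIMSEQ_le_const)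
      show "(\<lambda>n. Inf E + 1 / real (Suc n)) \<longlonglongrightarrow> Inf E"
        using tendsto_add[OF tendsto_const LIMSEQ_Suc[OF lim_1_over_n]] by simp
    qed (use elim in blast)
  qed
  then show ?thesis by (simp add: E_def)
qed

context grid_pair
begin

text \<open>Only the product of the essential bounds of the two factors is given; it is distributed by taking the
  essential supremum of \<open>b1\<close> for the first factor.\<close>

lemma tensor_accretive:
  fixes b1 :: "real^'n \<Rightarrow> complex" and b2 :: "real^'m \<Rightarrow> complex"
  assumes B: "Linf_bound B (tensor b1 b2)" and c: "pseudo_accretive c (tensor b1 b2)"
  shows "\<exists>\<beta>\<^sub>1 \<beta>\<^sub>2. \<beta>\<^sub>1 * \<beta>\<^sub>2 = B \<and> A.accretive (B / c) \<beta>\<^sub>1 b1 \<and> B.accretive (B / c) \<beta>\<^sub>2 b2"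
proof -
  have tm: "tensor b1 b2 \<in> borel_measurable borel" and tB: "AE x in lborel. cmod (tensor b1 b2 x) \<le> B"
    using B by (auto simp: Linf_bound_def)
  have c0: "0 < c" using c by (simp add: pseudo_accretive_def)
  \<comment> \<open>Fubini splits the integral of the tensor product over a dyadic rectangle into a
    product.\<close>
  have rect: "c * (A.vol K * B.vol V) < cmod (LINT y:K|lborel. b1 y) * cmod (LINT z:V|lborel. b2 z)"
    if K: "K \<in> A.cubes" and V: "V \<in> B.cubes" for K V
  proof -
    have Kb: "K \<in> sets borel" "V \<in> sets borel" using K V by auto
    have KVb: "K \<times> V \<in> sets borel"
    proof -
      have "K \<times> V \<in> sets (borel \<Otimes>\<^sub>M borel)" using Kb by (rule pair_measureI)
      then show ?thesis by (simp only: borel_prod)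
    qed
    have "emeasure (lborel \<Otimes>\<^sub>M lborel) (K \<times> V) = ennreal (A.vol K) * ennreal (B.vol V)"
      using Kb by (subst lborel.emeasure_pair_measure_Times) (simp_all add: A.emeasure_cubes[OF K] B.emeasure_cubes[OF V])
    then have em: "emeasure lborel (K \<times> V) = ennreal (A.vol K * B.vol V)"
      by (simp only: lborel_prod ennreal_mult[symmetric] measure_nonneg)
    then have vol: "measure lborel (K \<times> V) = A.vol K * B.vol V" by (simp add: measure_def)
    have si: "set_integrable lborel (K \<times> V) (tensor b1 b2)"
      using em by (intro ess_bounded_set_integrable[OF tm tB KVb]) simp
    then have int: "integrable (lborel \<Otimes>\<^sub>M lborel) (\<lambda>x. indicator (K \<times> V) x *\<^sub>R tensor b1 b2 x)"
      by (simp only: set_integrable_def lborel_prod)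
    have "(LINT x:K \<times> V|lborel. tensor b1 b2 x)
        = (LINT y|lborel. LINT z|lborel. indicator (K \<times> V) (y, z) *\<^sub>R tensor b1 b2 (y, z))"
      using lborel_pair.integral_fst'[OF int] by (simp only: set_lebesgue_integral_def lborel_prod)
    also have "\<dots> = (LINT y|lborel. (indicator K y *\<^sub>R b1 y) * (LINT z:V|lborel. b2 z))"
    proof (rule Bochner_Integration.integral_cong[OF refl])
      fix y
      have "(\<lambda>z. indicator (K \<times> V) (y, z) *\<^sub>R tensor b1 b2 (y, z)) = (\<lambda>z. (indicator K y *\<^sub>R b1 y) * (indicator V z *\<^sub>R b2 z))"
        by (simp add: fun_eq_iff indicator_times)
      then show "(LINT z|lborel. indicator (K \<times> V) (y, z) *\<^sub>R tensor b1 b2 (y, z)) = (indicator K y *\<^sub>R b1 y) * (LINT z:V|lborel. b2 z)"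
        unfolding set_lebesgue_integral_def by (simp only: integral_mult_right_zero)
    qed
    also have "\<dots> = (LINT y:K|lborel. b1 y) * (LINT z:V|lborel. b2 z)"
      unfolding set_lebesgue_integral_def by (simp only: integral_mult_left_zero)
    finally have eq: "(LINT x:K \<times> V|lborel. tensor b1 b2 x) = (LINT y:K|lborel. b1 y) * (LINT z:V|lborel. b2 z)" .
    obtain y z where yz: "K = Q\<^sub>1 (A.level K) y" "V = Q\<^sub>2 (B.level V) z" using A.cubesE[OF K] B.cubesE[OF V] by metis
    obtain u v where uv: "K = cube u (2 powi (- A.level K))" "V = cube v (2 powi (- B.level V))"
      using A.is_cube[of "A.level K" y] B.is_cube[of "B.level V" z] yz by metis
    have "c < cmod (LINT x:(cube u (2 powi (- A.level K)) \<times> cube v (2 powi (- B.level V)))|lborel. tensor b1 b2 x)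
        / measure lborel (cube u (2 powi (- A.level K)) \<times> cube v (2 powi (- B.level V)))"
      using c unfolding pseudo_accretive_def by simp
    then have "c < cmod (LINT x:K \<times> V|lborel. tensor b1 b2 x) / measure lborel (K \<times> V)"
      by (simp only: uv[symmetric])
    then show ?thesis
      using A.vol_pos[OF K] B.vol_pos[OF V] by (simp add: eq vol norm_mult pos_less_divide_eq)
  qed
  define K0 where "K0 = Q\<^sub>1 0 0"
  define V0 where "V0 = Q\<^sub>2 0 0"
  have K0: "K0 \<in> A.cubes" and V0: "V0 \<in> B.cubes" by (simp_all add: K0_def V0_def)
  have "0 < c * (A.vol K0 * B.vol V0)" using c0 A.vol_pos[OF K0] B.vol_pos[OF V0] by simp
  then have n0: "(LINT y:K0|lborel. b1 y) \<noteq> 0" "(LINT z:V0|lborel. b2 z) \<noteq> 0"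
    using rect[OF K0 V0] by auto
  have "\<exists>y. b1 y \<noteq> 0"
  proof (rule ccontr)
    assume "\<not> ?thesis"
    then have "(LINT y:K0|lborel. b1 y) = 0" by (simp add: set_lebesgue_integral_def)
    then show False using n0 by simp
  qed
  then obtain y0 where y0: "b1 y0 \<noteq> 0" by blast
  have "\<exists>z. b2 z \<noteq> 0"
  proof (rule ccontr)
    assume "\<not> ?thesis"
    then have "(LINT z:V0|lborel. b2 z) = 0" by (simp add: set_lebesgue_integral_def)
    then show False using n0 by simp
  qed
  then obtain z0 where z0: "b2 z0 \<noteq> 0" by blast
  \<comment> \<open>A section of the tensor product at a point where the other factor is nonzero is
    a nonzero multiple of \<open>b1\<close>.\<close>
  have b1m [measurable]: "b1 \<in> borel_measurable borel"
  proof -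
    note [measurable] = slice_measurable(1)[OF tm, of z0]
    have "(\<lambda>y. tensor b1 b2 (y, z0) / b2 z0) \<in> borel_measurable borel" by measurable
    then show ?thesis using z0 by simp
  qed
  have b2m [measurable]: "b2 \<in> borel_measurable borel"
  proof -
    note [measurable] = slice_measurable(2)[OF tm, of y0]
    have "(\<lambda>z. tensor b1 b2 (y0, z) / b1 y0) \<in> borel_measurable borel" by measurable
    then show ?thesis using y0 by simp
  qed
  have not0: "\<not> (AE y in lborel. b1 y = 0)" "\<not> (AE z in lborel. b2 z = 0)"
  proof -
    have "(LINT y:K0|lborel. b1 y) = 0" if "AE y in lborel. b1 y = 0"
      unfolding set_lebesgue_integral_def
      by (rule integral_eq_zero_AE) (use that in eventually_elim, simp)
    then show "\<not> (AE y in lborel. b1 y = 0)" using n0 by blast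
    have "(LINT z:V0|lborel. b2 z) = 0" if "AE z in lborel. b2 z = 0"
      unfolding set_lebesgue_integral_def
      by (rule integral_eq_zero_AE) (use that in eventually_elim, simp)
    then show "\<not> (AE z in lborel. b2 z = 0)" using n0 by blast
  qed
  have swapped: "AE z in lborel. AE y in lborel. cmod (b1 y) * cmod (b2 z) \<le> B"
  proof -
    have m: "{x \<in> space (lborel \<Otimes>\<^sub>M lborel). cmod (b1 (fst x)) * cmod (b2 (snd x)) \<le> B} \<in> sets (lborel \<Otimes>\<^sub>M lborel)"
      by measurable
    have "AE x in (lborel \<Otimes>\<^sub>M lborel). cmod (b1 (fst x)) * cmod (b2 (snd x)) \<le> B"
      unfolding lborel_prod using tB by eventually_elim (simp add: tensor_def case_prod_beta' norm_mult)
    then have "AE y in lborel. AE z in lborel. cmod (b1 y) * cmod (b2 z) \<le> B"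
      by (rule lborel_pair.AE_pair[where Q = "\<lambda>x. cmod (b1 (fst x)) * cmod (b2 (snd x)) \<le> B", simplified])
    then show ?thesis
      using lborel_pair.AE_commute[where P = "\<lambda>y z. cmod (b1 y) * cmod (b2 z) \<le> B", OF m] by blast
  qed
  have B0: "0 \<le> B"
  proof -
    obtain x where "cmod (tensor b1 b2 x) \<le> B" using AE_lborel_exists[OF tB] by blast
    then show ?thesis using norm_ge_zero[of "tensor b1 b2 x"] by linarith
  qed
  define E where "E = {\<beta>. 0 \<le> \<beta> \<and> (AE y in lborel. cmod (b1 y) \<le> \<beta>)}"
  have inE: "B / cmod (b2 z) \<in> E" if "AE y in lborel. cmod (b1 y) * cmod (b2 z) \<le> B" "b2 z \<noteq> 0" for z
    unfolding E_def using that B0 by (auto simp: pos_le_divide_eq)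
  \<comment> \<open>Such a point shows that \<open>b1\<close> is essentially bounded, so
    \<open>E\<close> is nonempty and its infimum meaningful.\<close>
  have "\<exists>z. (AE y in lborel. cmod (b1 y) * cmod (b2 z) \<le> B) \<and> b2 z \<noteq> 0"
  proof (rule ccontr)
    assume "\<not> ?thesis"
    then have "AE z in lborel. b2 z = 0" using swapped by (auto elim!: eventually_mono)
    then show False using not0 by blast
  qed
  then obtain z1 where z1: "AE y in lborel. cmod (b1 y) * cmod (b2 z1) \<le> B" "b2 z1 \<noteq> 0" by blast
  define \<beta>\<^sub>1 where "\<beta>\<^sub>1 = Inf E"
  have b1le: "AE y in lborel. cmod (b1 y) \<le> \<beta>\<^sub>1"
    unfolding \<beta>\<^sub>1_def E_def using inE[OF z1] unfolding E_def by (rule AE_le_ess_inf)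
  have Elow: "\<beta>\<^sub>1 \<le> \<beta>" if "\<beta> \<in> E" for \<beta>
    unfolding \<beta>\<^sub>1_def using that by (intro cInf_lower) (auto simp: E_def bdd_below_def)
  have \<beta>1: "0 < \<beta>\<^sub>1"
  proof (rule ccontr)
    assume "\<not> 0 < \<beta>\<^sub>1"
    then have "AE y in lborel. b1 y = 0"
      using b1le by (auto elim!: eventually_mono simp flip: norm_le_zero_iff)
    then show False using not0 by blast
  qed
  have Bpos: "0 < B"
  proof -
    have "0 < B / cmod (b2 z1)" using Elow[OF inE[OF z1]] \<beta>1 by linarith
    then show ?thesis using z1(2) by (simp add: zero_less_divide_iff)
  qed
  define \<beta>\<^sub>2 where "\<beta>\<^sub>2 = B / \<beta>\<^sub>1"
  have \<beta>2: "0 < \<beta>\<^sub>2" and prod: "\<beta>\<^sub>1 * \<beta>\<^sub>2 = B" using Bpos \<beta>1 by (simp_all add: \<beta>\<^sub>2_def)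
  \<comment> \<open>For almost every \<open>z\<close> with \<open>b2 z \<noteq> 0\<close>, the
    number \<open>B / cmod (b2 z)\<close> bounds \<open>b1\<close> and hence is at least the infimum
    \<open>\<beta>\<^sub>1\<close>.\<close>
  have b2le: "AE z in lborel. cmod (b2 z) \<le> \<beta>\<^sub>2"
    using swapped
  proof eventually_elim
    case (elim z)
    show ?case
    proof (cases "b2 z = 0")
      case False
      have "\<beta>\<^sub>1 \<le> B / cmod (b2 z)" by (rule Elow[OF inE[OF elim False]])
      then show ?thesis using False \<beta>1 by (simp add: \<beta>\<^sub>2_def field_simps)
    qed (use \<beta>2 in simp)
  qed
  have up1: "cmod (LINT y:K|lborel. b1 y) \<le> \<beta>\<^sub>1 * A.vol K" if "K \<in> A.cubes" for K
    using that A.cubes_fin[OF that] by (intro ess_bounded_set_integral_le[OF b1m b1le]) auto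
  have up2: "cmod (LINT z:V|lborel. b2 z) \<le> \<beta>\<^sub>2 * B.vol V" if "V \<in> B.cubes" for V
    using that B.cubes_fin[OF that] by (intro ess_bounded_set_integral_le[OF b2m b2le]) auto
  \<comment> \<open>The rectangle with a fixed second side \<open>V0\<close> is tested: bounding
    \<open>b2\<close> there from above isolates \<open>b1\<close>. Multiplying by
    \<open>\<beta>\<^sub>1\<close> turns \<open>\<beta>\<^sub>1 * \<beta>\<^sub>2\<close> into
    \<open>B\<close>, whence the ratio \<open>B / c\<close>.\<close>
  have low1: "\<beta>\<^sub>1 * A.vol K \<le> B / c * cmod (LINT y:K|lborel. b1 y)" if K: "K \<in> A.cubes" for K
  proof -
    have "c * (A.vol K * B.vol V0) \<le> cmod (LINT y:K|lborel. b1 y) * (\<beta>\<^sub>2 * B.vol V0)"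
      using rect[OF K V0] mult_left_mono[OF up2[OF V0], of "cmod (LINT y:K|lborel. b1 y)"] by simp
    then have "(c * A.vol K) * B.vol V0 \<le> (cmod (LINT y:K|lborel. b1 y) * \<beta>\<^sub>2) * B.vol V0" by (simp only: mult.assoc)
    then have "c * A.vol K \<le> cmod (LINT y:K|lborel. b1 y) * \<beta>\<^sub>2"
      using B.vol_pos[OF V0] by (simp only: mult_le_cancel_right_pos)
    then have "\<beta>\<^sub>1 * (c * A.vol K) \<le> \<beta>\<^sub>1 * (cmod (LINT y:K|lborel. b1 y) * \<beta>\<^sub>2)"
      using \<beta>1 by (intro mult_left_mono) simp_all
    also have "\<dots> = B * cmod (LINT y:K|lborel. b1 y)" using prod by (simp add: mult_ac)
    finally show ?thesis using c0 by (simp add: field_simps)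
  qed
  have low2: "\<beta>\<^sub>2 * B.vol V \<le> B / c * cmod (LINT z:V|lborel. b2 z)" if V: "V \<in> B.cubes" for V
  proof -
    have "c * (A.vol K0 * B.vol V) \<le> (\<beta>\<^sub>1 * A.vol K0) * cmod (LINT z:V|lborel. b2 z)"
      using rect[OF K0 V] mult_right_mono[OF up1[OF K0], of "cmod (LINT z:V|lborel. b2 z)"] by simp
    then have "A.vol K0 * (c * B.vol V) \<le> A.vol K0 * (\<beta>\<^sub>1 * cmod (LINT z:V|lborel. b2 z))" by (simp only: mult_ac)
    then have "c * B.vol V \<le> \<beta>\<^sub>1 * cmod (LINT z:V|lborel. b2 z)"
      using A.vol_pos[OF K0] by (simp only: mult_le_cancel_left_pos)
    then have "\<beta>\<^sub>2 * (c * B.vol V) \<le> \<beta>\<^sub>2 * (\<beta>\<^sub>1 * cmod (LINT z:V|lborel. b2 z))"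
      using \<beta>2 by (intro mult_left_mono) simp_all
    also have "\<dots> = B * cmod (LINT z:V|lborel. b2 z)" using prod by (simp add: mult_ac)
    finally show ?thesis using c0 by (simp add: field_simps)
  qed
  \<comment> \<open>The upper and the lower bound for \<open>b1\<close> on the same cube are
    compared.\<close>
  have cB: "1 \<le> B / c"
  proof -
    have "\<beta>\<^sub>1 * A.vol K0 \<le> B / c * (\<beta>\<^sub>1 * A.vol K0)"
      using low1[OF K0] mult_left_mono[OF up1[OF K0], of "B / c"] Bpos c0 by simp
    then have "1 * (\<beta>\<^sub>1 * A.vol K0) \<le> B / c * (\<beta>\<^sub>1 * A.vol K0)" by simp
    moreover have "0 < \<beta>\<^sub>1 * A.vol K0" using \<beta>1 A.vol_pos[OF K0] by simp
    ultimately show ?thesis by (simp only: mult_le_cancel_right_pos)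
  qed
  have "A.accretive (B / c) \<beta>\<^sub>1 b1" unfolding A.accretive_def using \<beta>1 cB b1m b1le low1 by blast
  moreover have "B.accretive (B / c) \<beta>\<^sub>2 b2" unfolding B.accretive_def using \<beta>2 cB b2m b2le low2 by blast
  ultimately show ?thesis using prod by blast
qed

end

theorem proposition3p13:
  fixes B c B' c' :: real
  shows "\<exists>C>0.
    \<forall>(b1 :: real^'n \<Rightarrow> complex) (b2 :: real^'m \<Rightarrow> complex)
      (b1' :: real^'n \<Rightarrow> complex) (b2' :: real^'m \<Rightarrow> complex)
      (D1 :: (real^'n) set set) (D2 :: (real^'m) set set)
      (a :: ((real^'n) \<times> (real^'m) \<Rightarrow> complex) \<Rightarrow> complex).
      Linf_bound B (tensor b1 b2) \<longrightarrow> pseudo_accretive c (tensor b1 b2) \<longrightarrow>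
      Linf_bound B' (tensor b1' b2') \<longrightarrow> pseudo_accretive c' (tensor b1' b2') \<longrightarrow>
      dyadic_grid D1 \<longrightarrow> dyadic_grid D2 \<longrightarrow> a \<in> dyadic_BMO D1 D2 \<longrightarrow>
      (\<forall>f\<in>L2.
         weakly_sums (paraproduct_term D1 D2 b1' b2' b1 b2 a f) (D1 \<times> D2)
           (mixed_paraproduct D1 D2 b1' b2' b1 b2 a f) \<and>
         L2_norm (mixed_paraproduct D1 D2 b1' b2' b1 b2 a f)
           \<le> C * dyadic_BMO_norm D1 D2 a * L2_norm f)"
proof -
  \<comment> \<open>The bound of \<open>mixed_paraproduct_bounded\<close> with \<open>d\<close>
    equal to 2 to the dimension and ratio \<open>B / c\<close> for both factors of \<open>b\<close>;
    the lone \<open>B\<close> is the product of their essential bounds.\<close>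
  define C where "C = 4096000 * 2 ^ CARD('n) * 2 ^ CARD('m) * B * (B / c) ^ 4 * (B / c) ^ 4 * (B' / c') * (B' / c')"
  have main: "weakly_sums (paraproduct_term D1 D2 b1' b2' b1 b2 a f) (D1 \<times> D2) (mixed_paraproduct D1 D2 b1' b2' b1 b2 a f)
      \<and> L2_norm (mixed_paraproduct D1 D2 b1' b2' b1 b2 a f) \<le> (\<bar>C\<bar> + 1) * dyadic_BMO_norm D1 D2 a * L2_norm f"
    if b: "Linf_bound B (tensor b1 b2)" "pseudo_accretive c (tensor b1 b2)"
      and b': "Linf_bound B' (tensor b1' b2')" "pseudo_accretive c' (tensor b1' b2')"
      and D: "dyadic_grid D1" "dyadic_grid D2" and a: "a \<in> dyadic_BMO D1 D2" and f: "f \<in> L2"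
    for b1 b1' :: "real^'n \<Rightarrow> complex" and b2 b2' :: "real^'m \<Rightarrow> complex"
      and D1 :: "(real^'n) set set" and D2 :: "(real^'m) set set"
      and a :: "((real^'n) \<times> (real^'m) \<Rightarrow> complex) \<Rightarrow> complex" and f
  proof -
    obtain Q1 \<mu>1 where g1: "grid Q1 \<mu>1 (2 ^ CARD('n)) D1" using dyadic_grid_imp_grid[OF D(1)] by blast
    obtain Q2 \<mu>2 where g2: "grid Q2 \<mu>2 (2 ^ CARD('m)) D2" using dyadic_grid_imp_grid[OF D(2)] by blast
    interpret grid_pair Q1 \<mu>1 "2 ^ CARD('n)" D1 Q2 \<mu>2 "2 ^ CARD('m)" D2
      by (rule grid_pair.intro[OF g1 g2])
    obtain \<beta>1 \<beta>2 where ac: "\<beta>1 * \<beta>2 = B" "A.accretive (B / c) \<beta>1 b1" "B.accretive (B / c) \<beta>2 b2"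
      using tensor_accretive[OF b] by blast
    obtain \<beta>1' \<beta>2' where ac': "A.accretive (B' / c') \<beta>1' b1'" "B.accretive (B' / c') \<beta>2' b2'"
      using tensor_accretive[OF b'] by blast
    note bounded = mixed_paraproduct_bounded[OF a ac(2,3) ac' f]
    have "C * (dyadic_BMO_norm D1 D2 a * L2_norm f) \<le> (\<bar>C\<bar> + 1) * (dyadic_BMO_norm D1 D2 a * L2_norm f)"
      using BMO_norm_nonneg[OF a ac(2,3)] by (intro mult_right_mono) simp_all
    then show ?thesis using bounded unfolding ac(1) C_def[symmetric] by (simp add: mult.assoc)
  qed
  show ?thesis
    \<comment> \<open>The four constants are arbitrary reals, possibly such that no function
      qualifies; the absolute value and the summand \<open>1\<close> make the constant positive in
      every case.\<close>
    by (rule exI[of _ "\<bar>C\<bar> + 1"]) (use main in auto)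
qed

end
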